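(* \textsc{min-avg} RFTT (on general weighted graphs) admits a polynomial-time $O(\log n)$-approximation algorithm, where $n$ is the number of clients.
   Context: RFTT: an instance is $(G,\tau)$ with $G=(V\cup\{s\},E,c)$ a connected graph with depot $s$, nonnegative edge weights $c$, clients $V=\{v_1,\dots,v_n\}$ and turnover times $\tau\in\mathbb{N}^n$. A solution gives for each day $k\ge1$ a closed walk $T_k$ in $G$ from $s$ to $s$ and a set $J_k\subseteq V$ of clients on $T_k$ visited that day; it is feasible if for all $t\ge0$ and all $j$, $v_j\in\bigcup_{k=t+1}^{t+\tau_j}J_k$; solutions are periodic with some period $\ell$. \textsc{min-avg} minimizes $\frac1\ell\sum_{k=1}^\ell c(T_k)$, where $c(T_k)$ is the total edge weight of $T_k$ with multiplicity. *)

theory Defs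
  imports
    Complex_Main
    "HOL-Library.Log_Nat"
    "HOL-Library.Landau_Symbols"
    "HOL-Computational_Algebra.Polynomial"
begin

section \<open>Replenishment with fixed turnover times\<close>

record 'v rftt =
  depot :: 'v
  clients :: "'v set"
  edges :: "'v set set"
  weight :: "'v set \<Rightarrow> real"
  turnover :: "'v \<Rightarrow> nat"

definition verts :: "'v rftt \<Rightarrow> 'v set" where
  "verts I = insert (depot I) (clients I)"

text \<open>A walk is the nonempty list of the vertices it traverses; \<open>[v]\<close> is the walk that stays at \<open>v\<close>.\<close>

definition is_walk :: "'v rftt \<Rightarrow> 'v list \<Rightarrow> bool" where
  "is_walk I w \<longleftrightarrow> w \<noteq> [] \<and> set w \<subseteq> verts I \<and> successively (\<lambda>u v. {u, v} \<in> edges I) w"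

definition walk_cost :: "'v rftt \<Rightarrow> 'v list \<Rightarrow> real" where
  "walk_cost I w = (\<Sum>i<length w - 1. weight I {w ! i, w ! Suc i})"

definition depot_tour :: "'v rftt \<Rightarrow> 'v list \<Rightarrow> bool" where
  "depot_tour I w \<longleftrightarrow> is_walk I w \<and> hd w = depot I \<and> last w = depot I"

definition rftt_instance :: "'v rftt \<Rightarrow> bool" where
  "rftt_instance I \<longleftrightarrow>
     finite (clients I) \<and> depot I \<notin> clients I \<and>
     (\<forall>e\<in>edges I. \<exists>u\<in>verts I. \<exists>v\<in>verts I. u \<noteq> v \<and> e = {u, v}) \<and>
     (\<forall>u\<in>verts I. \<forall>v\<in>verts I. \<exists>w. is_walk I w \<and> hd w = u \<and> last w = v) \<and>
     (\<forall>e\<in>edges I. weight I e \<ge> 0) \<and>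
     (\<forall>v\<in>clients I. turnover I v \<ge> 1)"

text \<open>
  A schedule is given by \<open>T\<close> and \<open>J\<close>, where \<open>T k\<close> is the walk of day \<open>k\<close> and \<open>J k\<close> the set of
  clients visited that day. Days are numbered from \<open>1\<close>; the values at \<open>0\<close> are irrelevant.
\<close>

definition feasible :: "'v rftt \<Rightarrow> (nat \<Rightarrow> 'v list) \<Rightarrow> (nat \<Rightarrow> 'v set) \<Rightarrow> bool" where
  "feasible I T J \<longleftrightarrow>
     (\<forall>k\<ge>1. depot_tour I (T k) \<and> J k \<subseteq> clients I \<inter> set (T k)) \<and>
     (\<forall>t. \<forall>v\<in>clients I. v \<in> (\<Union>k\<in>{t + 1..t + turnover I v}. J k))"

definition periodic :: "nat \<Rightarrow> (nat \<Rightarrow> 'a) \<Rightarrow> bool" where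
  "periodic l f \<longleftrightarrow> l \<ge> 1 \<and> (\<forall>k\<ge>1. f (k + l) = f k)"

definition periodic_solution ::
    "'v rftt \<Rightarrow> nat \<Rightarrow> (nat \<Rightarrow> 'v list) \<Rightarrow> (nat \<Rightarrow> 'v set) \<Rightarrow> bool" where
  "periodic_solution I l T J \<longleftrightarrow> feasible I T J \<and> periodic l T \<and> periodic l J"

definition avg_cost :: "'v rftt \<Rightarrow> nat \<Rightarrow> (nat \<Rightarrow> 'v list) \<Rightarrow> real" where
  "avg_cost I l T = (\<Sum>k=1..l. walk_cost I (T k)) / real l"

text \<open>
  For an instance this is an infimum of a nonempty set of nonnegative reals: visiting all clients
  every day is a solution because the graph is connected and turnover times are positive.
\<close>

definition min_avg_opt :: "'v rftt \<Rightarrow> real" where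
  "min_avg_opt I = Inf {avg_cost I l T | l T J. periodic_solution I l T J}"


section \<open>Polynomial time\<close>

text \<open>
  The machine model is a random access machine with the logarithmic cost criterion, programmed in
  a structured language. Memory consists of named arrays of natural numbers (a scalar is an array
  used at index \<open>0\<close> only). Every number that is read, computed or used as an address is charged
  its length in binary, so that running times agree, up to a polynomial, with those of
  multitape Turing machines. \<open>Minus\<close> is truncated subtraction, and a condition holds if its value
  is not \<open>0\<close>, so \<open>Minus b a\<close> tests for \<open>a < b\<close>.
\<close>

type_synonym state = "string \<Rightarrow> nat \<Rightarrow> nat"

datatype exp =
    Num nat
  | Get string exp
  | Plus exp exp
  | Minus exp exp
  | Times exp exp
  | Div exp exp

datatype com =
    Skip
  | Assign string exp exp
  | Seq com com
  | If exp com com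
  | While exp com

definition num_size :: "nat \<Rightarrow> nat" where
  "num_size m = Suc (floorlog 2 m)"

fun aval :: "exp \<Rightarrow> state \<Rightarrow> nat" where
  "aval (Num m) s = m"
| "aval (Get x e) s = s x (aval e s)"
| "aval (Plus e f) s = aval e s + aval f s"
| "aval (Minus e f) s = aval e s - aval f s"
| "aval (Times e f) s = aval e s * aval f s"
| "aval (Div e f) s = aval e s div aval f s"

fun acost :: "exp \<Rightarrow> state \<Rightarrow> nat" where
  "acost (Num m) s = num_size m"
| "acost (Get x e) s = acost e s + num_size (aval (Get x e) s)"
| "acost (Plus e f) s = acost e s + acost f s + num_size (aval (Plus e f) s)"
| "acost (Minus e f) s = acost e s + acost f s + num_size (aval (Minus e f) s)"
| "acost (Times e f) s = acost e s + acost f s + num_size (aval (Times e f) s)"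
| "acost (Div e f) s = acost e s + acost f s + num_size (aval (Div e f) s)"

text \<open>
  \<open>exec c s t s'\<close>: started in \<open>s\<close>, the program \<open>c\<close> halts in \<open>s'\<close> after time \<open>t\<close>.
  \<open>Assign x i e\<close> stores the value of \<open>e\<close> in cell \<open>i\<close> of the array \<open>x\<close>.
\<close>

inductive exec :: "com \<Rightarrow> state \<Rightarrow> nat \<Rightarrow> state \<Rightarrow> bool" where
  Skip: "exec Skip s 1 s"
| Assign: "exec (Assign x i e) s (1 + acost i s + acost e s) (s(x := (s x)(aval i s := aval e s)))"
| Seq: "exec c1 s1 t1 s2 \<Longrightarrow> exec c2 s2 t2 s3 \<Longrightarrow> exec (Seq c1 c2) s1 (t1 + t2) s3"
| IfTrue: "aval b s \<noteq> 0 \<Longrightarrow> exec c1 s t s' \<Longrightarrow> exec (If b c1 c2) s (1 + acost b s + t) s'"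
| IfFalse: "aval b s = 0 \<Longrightarrow> exec c2 s t s' \<Longrightarrow> exec (If b c1 c2) s (1 + acost b s + t) s'"
| WhileFalse: "aval b s = 0 \<Longrightarrow> exec (While b c) s (1 + acost b s) s"
| WhileTrue: "aval b s1 \<noteq> 0 \<Longrightarrow> exec c s1 t1 s2 \<Longrightarrow> exec (While b c) s2 t2 s3 \<Longrightarrow>
    exec (While b c) s1 (1 + acost b s1 + t1 + t2) s3"

inductive_cases SkipE: "exec Skip s t s'"
inductive_cases AssignE: "exec (Assign x i e) s t s'"
inductive_cases SeqE: "exec (Seq c1 c2) s t s'"
inductive_cases IfE: "exec (If b c1 c2) s t s'"
inductive_cases WhileE: "exec (While b c) s t s'"

lemma exec_deterministic:
  "exec c s t s' \<Longrightarrow> exec c s u s'' \<Longrightarrow> t = u \<and> s' = s''"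
proof (induction arbitrary: u s'' rule: exec.induct)
  case (Seq c1 s1 t1 s2 c2 t2 s3)
  from Seq.prems obtain u1 s u2
    where 1: "exec c1 s1 u1 s" and 2: "exec c2 s u2 s''" and "u = u1 + u2"
    by (elim SeqE)
  with Seq.IH(1)[OF 1] Seq.IH(2)[of u2 s''] show ?case by simp
next
  case (IfTrue b s c1 t s' c2)
  from IfTrue.prems IfTrue.hyps obtain v
    where 1: "exec c1 s v s''" and "u = 1 + acost b s + v"
    by (elim IfE) simp_all
  with IfTrue.IH[OF 1] show ?case by simp
next
  case (IfFalse b s c2 t s' c1)
  from IfFalse.prems IfFalse.hyps obtain v
    where 1: "exec c2 s v s''" and "u = 1 + acost b s + v"
    by (elim IfE) simp_all
  with IfFalse.IH[OF 1] show ?case by simp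
next
  case (WhileTrue b s1 c t1 s2 t2 s3)
  from WhileTrue.prems obtain u1 s u2
    where 1: "exec c s1 u1 s" and 2: "exec (While b c) s u2 s''"
      and "u = 1 + acost b s1 + u1 + u2"
    by (rule WhileE) (simp_all add: WhileTrue.hyps)
  with WhileTrue.IH(1)[OF 1] WhileTrue.IH(2)[of u2 s''] show ?case by simp
next
  case (WhileFalse b s c)
  from WhileFalse.prems show ?case by (rule WhileE) (simp_all add: WhileFalse.hyps)
qed (erule SkipE AssignE, simp)+

text \<open>Input and output are finite sequences of natural numbers written in binary.\<close>

definition input_state :: "nat list \<Rightarrow> state" where
  "input_state xs = (\<lambda>x i. if x = ''in'' \<and> i < length xs then xs ! i
                            else if x = ''inlen'' \<and> i = 0 then length xs else 0)"

definition output_of :: "state \<Rightarrow> nat list" where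
  "output_of s = map (s ''out'') [0..<s ''outlen'' 0]"

definition enc_size :: "nat list \<Rightarrow> nat" where
  "enc_size xs = sum_list (map num_size xs)"

text \<open>
  \<open>F\<close> is computable in polynomial time on the inputs \<open>D\<close>, with respect to the encodings \<open>ein\<close> and
  \<open>eout\<close>. Reading off the output is charged as well, since cells of \<open>out\<close> that the program
  never writes to are \<open>0\<close>.
\<close>

definition poly_time_computable ::
    "('a \<Rightarrow> nat list) \<Rightarrow> ('b \<Rightarrow> nat list) \<Rightarrow> 'a set \<Rightarrow> ('a \<Rightarrow> 'b) \<Rightarrow> bool" where
  "poly_time_computable ein eout D F \<longleftrightarrow>
     (\<exists>c. \<exists>p :: nat poly. \<forall>x\<in>D. \<exists>t s.
        exec c (input_state (ein x)) t s \<and> output_of s = eout (F x) \<and>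
        t + enc_size (eout (F x)) \<le> poly p (enc_size (ein x)))"


section \<open>Approximation algorithms for the average cost\<close>

text \<open>
  Concrete instances: \<open>(\<tau>s, es)\<close> has depot \<open>0\<close>, clients \<open>1, \<dots>, n\<close> where \<open>n = length \<tau>s\<close>, client
  \<open>j\<close> having turnover time \<open>\<tau>s ! (j - 1)\<close>; an entry \<open>(u, v, a, b)\<close> of \<open>es\<close> is the edge \<open>{u, v}\<close> of
  weight \<open>a / b\<close>.
\<close>

type_synonym rftt_input = "nat list \<times> (nat \<times> nat \<times> nat \<times> nat) list"

definition edge_table :: "rftt_input \<Rightarrow> (nat set \<times> real) list" where
  "edge_table X = map (\<lambda>(u, v, a, b). ({u, v}, real a / real b)) (snd X)"

definition to_rftt :: "rftt_input \<Rightarrow> nat rftt" where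
  "to_rftt X =
     \<lparr>depot = 0, clients = {1..length (fst X)},
      edges = fst ` set (edge_table X),
      weight = (\<lambda>e. the (map_of (edge_table X) e)),
      turnover = (\<lambda>j. fst X ! (j - 1))\<rparr>"

definition valid_input :: "rftt_input \<Rightarrow> bool" where
  "valid_input X \<longleftrightarrow>
     distinct (map fst (edge_table X)) \<and> (\<forall>(u, v, a, b)\<in>set (snd X). b > 0) \<and>
     rftt_instance (to_rftt X)"

definition enc_input :: "rftt_input \<Rightarrow> nat list" where
  "enc_input X = length (fst X) # fst X @ length (snd X) #
     concat (map (\<lambda>(u, v, a, b). [u, v, a, b]) (snd X))"

text \<open>
  The period of a good solution may be exponential in the input size. An algorithm therefore
  presents its solution implicitly: given the instance and a day \<open>k\<close> in binary, it returns the
  period \<open>l\<close>, the walk \<open>T\<^sub>k\<close> and a list of the members of \<open>J\<^sub>k\<close>.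
\<close>

definition enc_query :: "rftt_input \<times> nat \<Rightarrow> nat list" where
  "enc_query = (\<lambda>(X, k). k # enc_input X)"

definition enc_answer :: "nat \<times> nat list \<times> nat list \<Rightarrow> nat list" where
  "enc_answer = (\<lambda>(l, w, js). l # length w # w @ js)"

definition poly_time_min_avg_approximable :: "(nat \<Rightarrow> real) \<Rightarrow> bool" where
  "poly_time_min_avg_approximable \<alpha> \<longleftrightarrow>
     (\<exists>(l :: rftt_input \<Rightarrow> nat) (T :: rftt_input \<Rightarrow> nat \<Rightarrow> nat list)
        (J :: rftt_input \<Rightarrow> nat \<Rightarrow> nat list).
        poly_time_computable enc_query enc_answer {(X, k). valid_input X \<and> k \<ge> 1}
          (\<lambda>(X, k). (l X, T X k, J X k)) \<and>
        (\<forall>X. valid_input X \<longrightarrow>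
           periodic_solution (to_rftt X) (l X) (T X) (\<lambda>k. set (J X k)) \<and>
           avg_cost (to_rftt X) (l X) (T X)
             \<le> \<alpha> (card (clients (to_rftt X))) * min_avg_opt (to_rftt X)))"

end

theory Submission
  imports Defs
begin

text \<open>
  Serve the clients \<open>o\<^sub>1, o\<^sub>2, \<dots>\<close> in order of turnover time, with periods \<open>p\<^sub>1 dvd p\<^sub>2 dvd \<dots>\<close> where
  \<open>p\<^sub>t \<le> \<tau>(o\<^sub>t) < 2 p\<^sub>t\<close>. The clients due on a given day form a prefix of the order, and they are joined to
  a cycle through the depot by inserting each next to its nearest predecessor. If \<open>\<delta>\<^sub>t\<close> is the distance
  of \<open>o\<^sub>t\<close> to its predecessors, a day costs at most twice the sum of \<open>\<delta>\<^sub>t\<close> over the clients served, so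
  that the average cost is at most \<open>4 \<Sum>\<^sub>t \<delta>\<^sub>t / \<tau>(o\<^sub>t)\<close>.

  For the lower bound, group the clients by the value of \<open>\<delta>\<^sub>t / \<tau>(o\<^sub>t)\<close> up to a factor of 2. Within a
  group, later clients have a \<open>\<delta>\<close> at least half as large, hence the balls of radius \<open>\<delta>\<^sub>t / 3\<close> around
  them are disjoint and avoid the depot. Every visit to \<open>o\<^sub>t\<close> pays twice the radius inside its ball, and
  there is one visit in \<open>\<tau>(o\<^sub>t)\<close> days; so every group contributes at most 3/2 times the optimum.
  Ratios smaller by a factor of \<open>n\<close> than the largest one are negligible, which leaves about \<open>log\<^sub>2 n\<close>
  groups.

  Polynomial running time is read off the program text: all loops are bounded by input numbers that do
  not exceed the input length, and no assignment lengthens the numbers in memory by more than a constant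
  multiple of the input length.
\<close>

section \<open>Programs with bounded loops\<close>

text \<open>The divisibility chain lets a single insertion process serve all days: whenever a client
  is due, the predecessor next to which it is inserted is due too or is the depot. Three losses make
  up the constant 6 per group: 2 for insertion (there and back), 2 for rounding turnover times down
  to periods, 3/2 for the packing.

  The machine charges the lengths of numbers, so a polynomial number of operations is not enough;
  repeated squaring would double lengths in every step. The second form is what rounding to a
  multiple and testing divisibility need. The machine knows only natural numbers, hence rational
  weights are multiplied by a common denominator, and non-edges get an entry too large for any
  shortest route.

  The common period is that of the last client and thus at most its turnover time: possibly
  exponential in value, but short in binary. A single day is computed without looking at the other
  days.\<close>

datatype prog =
    PSkip
  | PAssign string exp exp
  | PSeq prog prog
  | PIf exp prog prog
  | PFor string exp prog

text \<open>The bound of a loop is evaluated once, while the compiled \<open>While\<close> evaluates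
  it in every round; \<open>wf_prog\<close> makes the two agree. The last update records the counter
  value at which the test fails.\<close>

primrec sem :: "prog \<Rightarrow> state \<Rightarrow> state" where
  "sem PSkip s = s"
| "sem (PAssign x i e) s = s(x := (s x)(aval i s := aval e s))"
| "sem (PSeq p q) s = sem q (sem p s)"
| "sem (PIf b p q) s = (if aval b s \<noteq> 0 then sem p s else sem q s)"
| "sem (PFor x e p) s =
     (let s' = fold (\<lambda>i s. sem p (s(x := (s x)(0 := i)))) [0..<aval e s] s
      in s'(x := (s' x)(0 := aval e s)))"

primrec compile :: "prog \<Rightarrow> com" where
  "compile PSkip = Skip"
| "compile (PAssign x i e) = Assign x i e"
| "compile (PSeq p q) = Seq (compile p) (compile q)"
| "compile (PIf b p q) = If b (compile p) (compile q)"
| "compile (PFor x e p) =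
     Seq (Assign x (Num 0) (Num 0))
       (While (Minus e (Get x (Num 0)))
         (Seq (compile p) (Assign x (Num 0) (Plus (Get x (Num 0)) (Num 1)))))"

primrec mods :: "prog \<Rightarrow> string set" where
  "mods PSkip = {}"
| "mods (PAssign x i e) = {x}"
| "mods (PSeq p q) = mods p \<union> mods q"
| "mods (PIf b p q) = mods p \<union> mods q"
| "mods (PFor x e p) = insert x (mods p)"

primrec bounds :: "prog \<Rightarrow> exp set" where
  "bounds PSkip = {}"
| "bounds (PAssign x i e) = {}"
| "bounds (PSeq p q) = bounds p \<union> bounds q"
| "bounds (PIf b p q) = bounds p \<union> bounds q"
| "bounds (PFor x e p) = insert e (bounds p)"

primrec input_only :: "exp \<Rightarrow> bool" where
  "input_only (Num m) = True"
| "input_only (Get x e) = (x = ''in'' \<and> input_only e)"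
| "input_only (Plus e f) = (input_only e \<and> input_only f)"
| "input_only (Minus e f) = (input_only e \<and> input_only f)"
| "input_only (Times e f) = (input_only e \<and> input_only f)"
| "input_only (Div e f) = (input_only e \<and> input_only f)"

text \<open>Under \<open>Get\<close> the index is arbitrary: whichever cell of the input is read,
  its value is short.\<close>

primrec input_sized :: "exp \<Rightarrow> bool" where
  "input_sized (Num m) = True"
| "input_sized (Get x e) = (x = ''in'')"
| "input_sized (Plus e f) = (input_sized e \<and> input_sized f)"
| "input_sized (Minus e f) = False"
| "input_sized (Times e f) = False"
| "input_sized (Div e f) = False"

text \<open>
  Evaluating a tame expression lengthens the numbers involved only by an additive constant
  multiple of the input length. Hence a program with tame expressions that makes polynomially many
  steps never leaves the numbers of polynomial length, and its logarithmic cost is polynomial.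
\<close>

primrec tame :: "exp \<Rightarrow> bool" where
  "tame (Num m) = True"
| "tame (Get x e) = tame e"
| "tame (Plus e f) = (tame e \<and> tame f)"
| "tame (Minus e f) = (tame e \<and> tame f)"
| "tame (Times e f) = (tame e \<and> tame f \<and> (input_sized f \<or> (\<exists>g. f = Div g e)))"
| "tame (Div e f) = (tame e \<and> tame f)"

text \<open>As \<open>''in''\<close> is read-only, loop bounds are constants of the whole run; as
  the body does not write the counter, the number of rounds is the bound.\<close>

primrec wf_prog :: "prog \<Rightarrow> bool" where
  "wf_prog PSkip = True"
| "wf_prog (PAssign x i e) = (x \<noteq> ''in'' \<and> tame i \<and> tame e)"
| "wf_prog (PSeq p q) = (wf_prog p \<and> wf_prog q)"
| "wf_prog (PIf b p q) = (tame b \<and> wf_prog p \<and> wf_prog q)"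
| "wf_prog (PFor x e p) =
     (x \<noteq> ''in'' \<and> x \<notin> mods p \<and> input_only e \<and> tame e \<and> wf_prog p)"

primrec esize :: "exp \<Rightarrow> nat" where
  "esize (Num m) = num_size m"
| "esize (Get x e) = 1 + esize e"
| "esize (Plus e f) = 1 + esize e + esize f"
| "esize (Minus e f) = 1 + esize e + esize f"
| "esize (Times e f) = 1 + esize e + esize f"
| "esize (Div e f) = 1 + esize e + esize f"

text \<open>
  When all loops make at most \<open>M\<close> iterations, \<open>growth p M\<close> counts by how many multiples of the
  input length the numbers grow, and \<open>work p M\<close> the number of operations.
\<close>

primrec growth :: "prog \<Rightarrow> nat \<Rightarrow> nat" where
  "growth PSkip M = 0"
| "growth (PAssign x i e) M = esize i + esize e"
| "growth (PSeq p q) M = growth p M + growth q M"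
| "growth (PIf b p q) M = esize b + growth p M + growth q M"
| "growth (PFor x e p) M = 20 + esize e + M * (growth p M + 20)"

primrec work :: "prog \<Rightarrow> nat \<Rightarrow> nat" where
  "work PSkip M = 1"
| "work (PAssign x i e) M = 1 + esize i + esize e"
| "work (PSeq p q) M = work p M + work q M"
| "work (PIf b p q) M = 1 + esize b + work p M + work q M"
| "work (PFor x e p) M = 20 + esize e + M * (work p M + esize e + 30)"

section \<open>Values, bit lengths and running times of tame programs\<close>

lemma sem_unmodified: "x \<notin> mods p \<Longrightarrow> sem p s x = s x"
proof (induction p arbitrary: s)
  case (PFor y e p)
  have "fold (\<lambda>i s. sem p (s(y := (s y)(0 := i)))) is s x = s x" for "is" s
    using PFor by (induction "is" arbitrary: s) auto
  with PFor show ?case by (simp add: Let_def)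
qed auto

lemma wf_prog_not_in: "wf_prog p \<Longrightarrow> ''in'' \<notin> mods p"
  by (induction p) auto

lemma sem_in: "wf_prog p \<Longrightarrow> sem p s ''in'' = s ''in''"
  by (intro sem_unmodified wf_prog_not_in)

lemma aval_input_only: "input_only e \<Longrightarrow> s ''in'' = s' ''in'' \<Longrightarrow> aval e s = aval e s'"
  by (induction e) auto

lemma input_only_bounds: "wf_prog p \<Longrightarrow> e \<in> bounds p \<Longrightarrow> input_only e"
  by (induction p) auto

lemma less_2_power_iff: "m < 2 ^ b \<longleftrightarrow> floorlog 2 m \<le> b"
  by (simp add: floorlog_le_iff)

lemma num_size_le: "m < 2 ^ b \<Longrightarrow> num_size m \<le> Suc b"
  by (simp add: num_size_def less_2_power_iff)

lemma less_2_power_num_size: "m < 2 ^ num_size m"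
  unfolding less_2_power_iff num_size_def by simp

lemma less_2_power_mono: "m < 2 ^ a \<Longrightarrow> a \<le> b \<Longrightarrow> m < (2::nat) ^ b"
  by (meson less_le_trans one_le_numeral power_increasing)

lemma add_less_2_power:
  assumes "m < (2::nat) ^ a" "n < 2 ^ b" "a < c" "b < c"
  shows "m + n < 2 ^ c"
proof -
  obtain d where c: "c = Suc d" using assms by (cases c) auto
  have "m < 2 ^ d" "n < 2 ^ d"
    using assms less_2_power_mono[of m a d] less_2_power_mono[of n b d] unfolding c by auto
  then show ?thesis unfolding c by simp
qed

lemma mult_less_2_power:
  "m < (2::nat) ^ a \<Longrightarrow> n < 2 ^ b \<Longrightarrow> m * n < 2 ^ (a + b)"
  by (simp add: power_add mult_strict_mono)

text \<open>The bound does not involve the lengths in the rest of the memory, unlike the one for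
  tame expressions. This is why multiplying by such a value adds to lengths and cannot double
  them.\<close>

lemma aval_input_sized:
  assumes "\<And>i. s ''in'' i < 2 ^ B" "B \<ge> 1" "input_sized e"
  shows "aval e s < 2 ^ (esize e * B)"
  using assms(3)
proof (induction e)
  case (Num m)
  show ?case using assms(2) by (simp add: less_2_power_mono[OF less_2_power_num_size])
next
  case (Get x e)
  then have "s ''in'' (aval e s) < 2 ^ (esize (Get x e) * B)"
    by (intro less_2_power_mono[OF assms(1)]) simp
  with Get show ?case by simp
next
  case (Plus e f)
  then show ?case using assms(2) by (auto intro!: add_less_2_power simp: algebra_simps)
qed auto

lemma aval_tame:
  assumes "\<And>x i. s x i < 2 ^ b" "\<And>i. s ''in'' i < 2 ^ B" "B \<ge> 1" "tame e"
  shows "aval e s < 2 ^ (b + esize e * B)"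
proof -
  \<comment> \<open>The second conjunct keeps the bound on the dividend of a quotient. It is needed
    for \<open>e * (g div e)\<close>, whose value is controlled by that of \<open>g\<close> and not
    by those of its two factors.\<close>
  have "aval e s < 2 ^ (b + esize e * B) \<and>
    (\<forall>g h. e = Div g h \<longrightarrow> aval g s < 2 ^ (b + esize e * B))"
    using assms(4)
  proof (induction e)
    case (Num m)
    have "num_size m \<le> b + num_size m * B" using assms(3) by (simp add: trans_le_add2)
    then show ?case using less_2_power_mono[OF less_2_power_num_size] by simp
  next
    case (Get x e)
    have "s x (aval e s) < 2 ^ (b + esize (Get x e) * B)"
      by (rule less_2_power_mono[OF assms(1)]) simp
    then show ?case by simp
  next
    case (Plus e f)
    then show ?case using assms(3) by (auto intro!: add_less_2_power simp: algebra_simps)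
  next
    case (Minus e f)
    then have "aval e s < 2 ^ (b + esize e * B)" by simp
    then have "aval e s < 2 ^ (b + esize (Minus e f) * B)"
      by (rule less_2_power_mono) (simp add: add_mult_distrib)
    moreover have "aval (Minus e f) s \<le> aval e s" by simp
    ultimately show ?case by (auto intro: le_less_trans)
  next
    case (Times e f)
    show ?case
    proof (cases "input_sized f")
      case True
      have "aval e s * aval f s < 2 ^ ((b + esize e * B) + esize f * B)"
        using Times aval_input_sized[of s B f] assms True by (intro mult_less_2_power) auto
      then have "aval (Times e f) s < 2 ^ (b + esize (Times e f) * B)"
        unfolding aval.simps by (rule less_2_power_mono) (simp add: add_mult_distrib)
      then show ?thesis by simp
    next
      case False
      then obtain g where f: "f = Div g e" and "tame f" using Times.prems by auto
      then have "aval g s < 2 ^ (b + esize f * B)" using Times.IH(2) by blast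
      moreover have "aval e s * aval f s \<le> aval g s" by (simp add: f)
      ultimately have "aval e s * aval f s < 2 ^ (b + esize f * B)" by linarith
      then have "aval (Times e f) s < 2 ^ (b + esize (Times e f) * B)"
        unfolding aval.simps by (rule less_2_power_mono) (simp add: add_mult_distrib)
      then show ?thesis by simp
    qed
  next
    case (Div e f)
    then have "aval e s < 2 ^ (b + esize e * B)" by simp
    then have "aval e s < 2 ^ (b + esize (Div e f) * B)"
      by (rule less_2_power_mono) (simp add: add_mult_distrib)
    then show ?case using le_less_trans[OF div_le_dividend] by simp
  qed
  then show ?thesis by simp
qed

lemma acost_tame:
  assumes "\<And>x i. s x i < 2 ^ b" "\<And>i. s ''in'' i < 2 ^ B" "B \<ge> 1" "tame e"
    and "b + esize e * B + 1 \<le> C"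
  shows "acost e s \<le> esize e * C"
proof -
  have v: "num_size (aval e s) \<le> Suc (b + esize e * B)" if "tame e" for e
    using num_size_le aval_tame[of s b B e] assms that by blast
  show ?thesis
    using assms(4,5)
  proof (induction e)
    case (Num m)
    then show ?case by (cases C) auto
  next
    case (Get x e)
    with v[of "Get x e"] show ?case by (simp add: algebra_simps)
  next
    case (Plus e f)
    with v[of "Plus e f"] show ?case by (simp add: algebra_simps)
  next
    case (Minus e f)
    with v[of "Minus e f"] show ?case by (simp add: algebra_simps)
  next
    case (Times e f)
    with v[of "Times e f"] show ?case by (simp add: algebra_simps)
  next
    case (Div e f)
    with v[of "Div e f"] show ?case by (simp add: algebra_simps)
  qed
qed

lemma charge:
  "t \<le> w * C \<Longrightarrow> x \<le> e * C \<Longrightarrow> 1 \<le> C \<Longrightarrow> 1 + x + t \<le> (1 + e + w) * (C::nat)"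
  by (simp add: algebra_simps)

text \<open>
  The bounds of the loop counter are absorbed in the generous constants of \<open>growth\<close> and \<open>work\<close>.
\<close>

lemma exec_compile:
  assumes "wf_prog p" "\<And>x i. s x i < 2 ^ b" "\<And>i. s ''in'' i < 2 ^ B" "B \<ge> 1"
    and "\<And>e. e \<in> bounds p \<Longrightarrow> aval e s \<le> M"
  shows "(\<forall>x i. sem p s x i < 2 ^ (b + growth p M * B)) \<and>
    (\<exists>t. exec (compile p) s t (sem p s) \<and> t \<le> work p M * (b + growth p M * B + 2))"
  using assms
proof (induction p arbitrary: s b)
  case PSkip
  then show ?case using exec.Skip[of s] by (intro conjI exI[of _ 1]) auto
next
  case (PAssign x i e)
  let ?C = "b + (esize i + esize e) * B + 2"
  have v: "aval e s < 2 ^ (b + esize e * B)"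
    using PAssign by (intro aval_tame) auto
  have "acost i s \<le> esize i * ?C"
    by (rule acost_tame[where b = b and B = B]) (use PAssign in \<open>auto simp: add_mult_distrib\<close>)
  moreover have "acost e s \<le> esize e * ?C"
    by (rule acost_tame[where b = b and B = B]) (use PAssign in \<open>auto simp: add_mult_distrib\<close>)
  ultimately have "1 + acost i s + acost e s \<le> (1 + esize i + esize e) * ?C"
    by (simp add: algebra_simps)
  moreover have "(s(x := (s x)(aval i s := aval e s))) y j < 2 ^ (b + (esize i + esize e) * B)" for y j
  proof -
    have "aval e s < 2 ^ (b + (esize i + esize e) * B)"
      by (rule less_2_power_mono[OF v]) (simp add: add_mult_distrib)
    moreover have "s y j < 2 ^ (b + (esize i + esize e) * B)" for y j
      by (rule less_2_power_mono[OF PAssign.prems(2)]) simp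
    ultimately show ?thesis by simp
  qed
  ultimately show ?case
    unfolding sem.simps compile.simps work.simps growth.simps
    using exec.Assign[of x i e s] by blast
next
  case (PSeq p q)
  let ?b = "b + growth p M * B"
  have p: "\<forall>x i. sem p s x i < 2 ^ ?b"
    "\<exists>t. exec (compile p) s t (sem p s) \<and> t \<le> work p M * (?b + 2)"
    using PSeq by auto
  have "aval e (sem p s) \<le> M" if "e \<in> bounds q" for e
  proof -
    have "aval e (sem p s) = aval e s"
      using that PSeq.prems by (intro aval_input_only) (auto intro: input_only_bounds simp: sem_in)
    then show ?thesis using that PSeq.prems by simp
  qed
  then have q: "\<forall>x i. sem q (sem p s) x i < 2 ^ (?b + growth q M * B)"
    "\<exists>t. exec (compile q) (sem p s) t (sem q (sem p s)) \<and> t \<le> work q M * (?b + growth q M * B + 2)"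
    using PSeq.IH(2)[of "sem p s" ?b] PSeq.prems p by (auto simp: sem_in)
  from p q obtain t u where t: "exec (compile p) s t (sem p s)" "t \<le> work p M * (?b + 2)"
    and u: "exec (compile q) (sem p s) u (sem q (sem p s))" "u \<le> work q M * (?b + growth q M * B + 2)"
    by blast
  have "work p M * (?b + 2) \<le> work p M * (?b + growth q M * B + 2)"
    by (intro mult_left_mono) auto
  then have "t + u \<le> (work p M + work q M) * (?b + growth q M * B + 2)"
    using t(2) u(2) unfolding distrib_right by linarith
  moreover have eq: "b + growth (PSeq p q) M * B = ?b + growth q M * B"
    by (simp add: add_mult_distrib)
  ultimately show ?case
    unfolding eq sem.simps compile.simps work.simps
    using q(1) exec.Seq[OF t(1) u(1)] by blast
next
  case (PIf c p q)
  let ?C = "b + growth (PIf c p q) M * B"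
  have *: "acost c s \<le> esize c * (?C + 2)"
    using PIf by (intro acost_tame[where b = b and B = B]) (auto simp: algebra_simps)
  have le: "b + growth p M * B \<le> ?C" "b + growth q M * B \<le> ?C" by (auto simp: algebra_simps)
  show ?case
  proof (cases "aval c s = 0")
    case False
    have "\<forall>x i. sem p s x i < 2 ^ (b + growth p M * B)"
      "\<exists>t. exec (compile p) s t (sem p s) \<and> t \<le> work p M * (b + growth p M * B + 2)"
      using PIf.IH(1)[of s b] PIf.prems by auto
    then obtain t where t: "exec (compile p) s t (sem p s)" "t \<le> work p M * (b + growth p M * B + 2)"
      and v0: "\<forall>x i. sem p s x i < 2 ^ (b + growth p M * B)" by blast
    have v: "\<forall>x i. sem p s x i < 2 ^ ?C"
      using v0 le less_2_power_mono by metis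
    have "t \<le> work p M * (?C + 2)"
      by (rule order_trans[OF t(2)]) (intro mult_left_mono, use le in auto)
    then have "1 + acost c s + t \<le> (1 + esize c + work p M) * (?C + 2)"
      using * by (rule charge) simp
    also have "\<dots> \<le> work (PIf c p q) M * (?C + 2)"
      by (intro mult_right_mono) auto
    finally have "1 + acost c s + t \<le> work (PIf c p q) M * (?C + 2)" .
    then show ?thesis using v exec.IfTrue[of c s "compile p" t "sem p s" "compile q", OF False t(1)]
      False by auto
  next
    case True
    have "\<forall>x i. sem q s x i < 2 ^ (b + growth q M * B)"
      "\<exists>t. exec (compile q) s t (sem q s) \<and> t \<le> work q M * (b + growth q M * B + 2)"
      using PIf.IH(2)[of s b] PIf.prems by auto
    then obtain t where t: "exec (compile q) s t (sem q s)" "t \<le> work q M * (b + growth q M * B + 2)"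
      and v0: "\<forall>x i. sem q s x i < 2 ^ (b + growth q M * B)" by blast
    have v: "\<forall>x i. sem q s x i < 2 ^ ?C"
      using v0 le less_2_power_mono by metis
    have "t \<le> work q M * (?C + 2)"
      by (rule order_trans[OF t(2)]) (intro mult_left_mono, use le in auto)
    then have "1 + acost c s + t \<le> (1 + esize c + work q M) * (?C + 2)"
      using * by (rule charge) simp
    also have "\<dots> \<le> work (PIf c p q) M * (?C + 2)"
      by (intro mult_right_mono) auto
    finally have "1 + acost c s + t \<le> work (PIf c p q) M * (?C + 2)" .
    then show ?thesis using v exec.IfFalse[of c s "compile q" t "sem q s" "compile p", OF True t(1)]
      True by auto
  qed
next
  case (PFor x e p)
  define N where "N = aval e s"
  define test where "test = Minus e (Get x (Num 0))"
  define incr where "incr = Assign x (Num 0) (Plus (Get x (Num 0)) (Num 1))"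
  define loop where "loop = While test (Seq (compile p) incr)"
  define upd where "upd = (\<lambda>i (s::state). s(x := (s x)(0 := i)))"
  define G where "G = growth p M + 20"
  define W where "W = work p M + esize e + 30"
  have N: "N \<le> M" using PFor.prems(5)[of e] by (simp add: N_def)
  have wf: "wf_prog p" "x \<noteq> ''in''" "x \<notin> mods p" "input_only e" "tame e" using PFor.prems by auto
  have "tame test" by (simp add: test_def wf)
  \<comment> \<open>Generalised to a loop with \<open>k\<close> rounds to go that is entered with
    the counter at \<open>i\<close>. The exponent \<open>b'\<close> stays free because each round
    enlarges it by \<open>G * B\<close>.\<close>
  have loop: "(\<forall>y j. upd N (fold (\<lambda>i s. sem p (upd i s)) [i..<N] s') y j < 2 ^ (b' + k * G * B)) \<and>
     (\<exists>t. exec loop s' t (upd N (fold (\<lambda>i s. sem p (upd i s)) [i..<N] s')) \<and>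
       t \<le> (k * W + esize e + 10) * (b' + (k * G + esize e + 10) * B + 2))"
    if "s' x 0 = i" "i + k = N" "\<And>y j. s' y j < 2 ^ b'" "s' ''in'' = s ''in''" for s' i k b'
    using that
  proof (induction k arbitrary: s' i b')
    case 0
    have e0: "aval e s' = N" unfolding N_def using wf 0 by (intro aval_input_only) auto
    have "aval test s' = 0" using 0 e0 by (simp add: test_def)
    then have ex: "exec loop s' (1 + acost test s') s'" unfolding loop_def by (rule exec.WhileFalse)
    have ac: "acost test s' \<le> esize test * (b' + (esize e + 10) * B + 2)"
      using 0 PFor.prems \<open>tame test\<close> by (intro acost_tame[where b = b' and B = B])
        (auto simp: test_def algebra_simps num_size_def floorlog_def)
    have "upd N s' = s'" using 0 by (auto simp: upd_def)
    moreover have "1 + acost test s' \<le> (esize e + 10) * (b' + (esize e + 10) * B + 2)"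
    proof -
      have "1 + acost test s' \<le> (1 + esize test) * (b' + (esize e + 10) * B + 2)"
        using ac by simp
      also have "\<dots> \<le> (esize e + 10) * (b' + (esize e + 10) * B + 2)"
        by (intro mult_right_mono) (auto simp: test_def num_size_def floorlog_def)
      finally show ?thesis .
    qed
    ultimately show ?case using 0 ex by auto
  next
    case (Suc k)
    have e0: "aval e s' = N" unfolding N_def using wf Suc by (intro aval_input_only) auto
    have t0: "aval test s' \<noteq> 0" using Suc e0 by (simp add: test_def)
    let ?C = "b' + (Suc k * G + esize e + 10) * B + 2"
    have ac: "acost test s' \<le> esize test * ?C"
      using Suc PFor.prems \<open>tame test\<close> by (intro acost_tame[where b = b' and B = B])
        (auto simp: test_def algebra_simps num_size_def floorlog_def)
    have bp: "aval e s' \<le> M" if "e \<in> bounds p" for e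
    proof -
      have "aval e s' = aval e s"
        using that wf Suc.prems by (intro aval_input_only) (auto intro: input_only_bounds)
      then show ?thesis using that PFor.prems(5)[of e] by simp
    qed
    let ?b1 = "b' + growth p M * B"
    have IHp: "\<forall>x i. sem p s' x i < 2 ^ ?b1"
      "\<exists>t. exec (compile p) s' t (sem p s') \<and> t \<le> work p M * (?b1 + 2)"
      using PFor.IH[of s' b'] wf Suc.prems PFor.prems bp by auto
    then obtain t where t: "exec (compile p) s' t (sem p s')" "t \<le> work p M * (?b1 + 2)" by blast
    let ?s1 = "sem p s'"
    let ?s2 = "upd (Suc i) ?s1"
    let ?inc = "Plus (Get x (Num 0)) (Num 1)"
    have x1: "?s1 x 0 = i" using wf Suc.prems sem_unmodified by metis
    have in1: "?s1 ''in'' = s ''in''" using wf Suc.prems sem_in by metis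
    have "tame ?inc" by simp
    have vi: "aval ?inc ?s1 < 2 ^ (?b1 + esize ?inc * B)"
      using IHp(1) in1 PFor.prems by (intro aval_tame) auto
    have es: "esize ?inc \<le> 10" by (simp add: num_size_def floorlog_def)
    have es0: "esize (Num 0) \<le> 10" by (simp add: num_size_def floorlog_def)
    have "?b1 + esize ?inc * B \<le> ?b1 + 10 * B"
      by (intro add_left_mono mult_right_mono es) simp
    also have "\<dots> \<le> b' + G * B" by (simp add: G_def algebra_simps)
    finally have "aval ?inc ?s1 < 2 ^ (b' + G * B)"
      by (rule less_2_power_mono[OF vi])
    then have vi': "Suc i < 2 ^ (b' + G * B)" using x1 by simp
    have ex2: "exec incr ?s1 (1 + acost (Num 0) ?s1 + acost ?inc ?s1) ?s2"
      unfolding incr_def upd_def using exec.Assign[of x "Num 0" ?inc ?s1] x1 by simp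
    have "?b1 + esize ?inc * B + 1 \<le> ?b1 + 10 * B + 1"
      by (intro add_right_mono add_left_mono mult_right_mono es) simp
    also have "\<dots> \<le> ?C" by (simp add: G_def algebra_simps)
    finally have aci: "acost ?inc ?s1 \<le> esize ?inc * ?C"
      using IHp(1) in1 PFor.prems \<open>tame ?inc\<close>
      by (intro acost_tame[where b = ?b1 and B = B]) auto
    have aci': "acost ?inc ?s1 \<le> 10 * ?C"
      by (rule order_trans[OF aci]) (intro mult_right_mono es, simp)
    have ac0: "acost (Num 0) ?s1 \<le> 2" by (simp add: num_size_def floorlog_def)
    have s2: "\<And>y j. ?s2 y j < 2 ^ (b' + G * B)"
      using vi' IHp(1) less_2_power_mono[of _ ?b1 "b' + G * B"]
      by (auto simp: upd_def G_def algebra_simps)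
    let ?F = "\<lambda>i s. sem p (upd i s)"
    \<comment> \<open>The compiled loop increments the counter at the end of a round, the fold
      writes it at the start of the next one. The difference is invisible: the next round or, after
      the last one, the outer \<open>upd N\<close> overwrites the counter.\<close>
    have eq: "upd N (fold ?F [i..<N] s') = upd N (fold ?F [Suc i..<N] ?s2)"
    proof -
      have "upd i s' = s'" using Suc.prems by (auto simp: upd_def)
      then have "fold ?F [i..<N] s' = fold ?F [Suc i..<N] ?s1"
        using Suc.prems by (simp add: upt_conv_Cons)
      moreover have "upd N (fold ?F [Suc i..<N] ?s1) = upd N (fold ?F [Suc i..<N] ?s2)"
      proof (cases "Suc i < N")
        case True
        have "upd (Suc i) ?s2 = upd (Suc i) ?s1" by (auto simp: upd_def)
        with True show ?thesis by (simp add: upt_conv_Cons)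
      qed (auto simp: upd_def)
      ultimately show ?thesis by simp
    qed
    have "?s2 x 0 = Suc i" "?s2 ''in'' = s ''in''" using in1 wf by (auto simp: upd_def)
    note IH = Suc.IH[OF this(1) _ s2 this(2)]
    have IHk: "\<forall>y j. upd N (fold ?F [Suc i..<N] ?s2) y j < 2 ^ (b' + G * B + k * G * B)"
      "\<exists>t. exec loop ?s2 t (upd N (fold ?F [Suc i..<N] ?s2)) \<and>
         t \<le> (k * W + esize e + 10) * (b' + G * B + (k * G + esize e + 10) * B + 2)"
      using IH Suc.prems by auto
    then obtain u where u: "exec loop ?s2 u (upd N (fold ?F [Suc i..<N] ?s2))"
      "u \<le> (k * W + esize e + 10) * ?C" by (auto simp: algebra_simps)
    have ex: "exec loop s' (1 + acost test s' + (t + (1 + acost (Num 0) ?s1 + acost ?inc ?s1)) + u)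
       (upd N (fold ?F [Suc i..<N] ?s2))"
      unfolding loop_def using t0 exec.Seq[OF t(1) ex2] u(1)[unfolded loop_def]
      by (rule exec.WhileTrue)
    have "t \<le> work p M * ?C"
      by (rule order_trans[OF t(2)]) (intro mult_left_mono, auto simp: G_def algebra_simps)
    moreover have "acost test s' \<le> (esize e + 10) * ?C"
      by (rule order_trans[OF ac], intro mult_right_mono) (auto simp: test_def num_size_def floorlog_def)
    \<comment> \<open>The unit charges of the loop and of the increment, and at most 2 for the index
      constant of the increment.\<close>
    moreover have "4 \<le> 2 * ?C" by simp
    ultimately have "1 + acost test s' + (t + (1 + acost (Num 0) ?s1 + acost ?inc ?s1)) + u
      \<le> 2 * ?C + (esize e + 10) * ?C + work p M * ?C + 10 * ?C + (k * W + esize e + 10) * ?C"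
      using aci' ac0 u(2) by linarith
    also have "\<dots> = (2 + (esize e + 10) + work p M + 10 + (k * W + esize e + 10)) * ?C"
      by (simp only: distrib_right)
    also have "\<dots> \<le> (Suc k * W + esize e + 10) * ?C"
      by (intro mult_right_mono) (auto simp: W_def)
    finally show ?case unfolding eq using IHk(1) ex by (auto simp: algebra_simps)
  qed
  let ?s0 = "upd 0 s"
  have fold_eq: "upd N (fold (\<lambda>i s. sem p (upd i s)) [0..<N] ?s0) = sem (PFor x e p) s"
  proof (cases "N = 0")
    case False
    then show ?thesis by (simp add: upt_conv_Cons upd_def Let_def flip: N_def)
  qed (auto simp: upd_def Let_def simp flip: N_def)
  have ex0: "exec (Assign x (Num 0) (Num 0)) s 3 ?s0"
    using exec.Assign[of x "Num 0" "Num 0" s] by (simp add: upd_def num_size_def floorlog_def numeral_3_eq_3)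
  have "?s0 x 0 = 0" "0 + N = N" "\<And>y j. ?s0 y j < 2 ^ b" "?s0 ''in'' = s ''in''"
    using PFor.prems wf by (auto simp: upd_def)
  from loop[OF this] obtain t where
    v: "\<forall>y j. sem (PFor x e p) s y j < 2 ^ (b + N * G * B)" and
    t: "exec loop ?s0 t (sem (PFor x e p) s)"
      "t \<le> (N * W + esize e + 10) * (b + (N * G + esize e + 10) * B + 2)"
    unfolding fold_eq by blast
  let ?C = "b + growth (PFor x e p) M * B + 2"
  have NG: "N * G + esize e + 10 \<le> growth (PFor x e p) M"
    using mult_le_mono1[OF N, of G] unfolding growth.simps G_def by linarith
  then have le: "(N * G + esize e + 10) * B \<le> growth (PFor x e p) M * B"
    by (rule mult_right_mono) simp
  have "3 + t \<le> 3 * ?C + (N * W + esize e + 10) * ?C"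
    by (rule add_mono, simp, rule order_trans[OF t(2)], intro mult_left_mono) (use le in auto)
  also have "\<dots> = (3 + (N * W + esize e + 10)) * ?C" by (simp only: distrib_right)
  also have "\<dots> \<le> work (PFor x e p) M * ?C"
  proof (intro mult_right_mono)
    show "3 + (N * W + esize e + 10) \<le> work (PFor x e p) M"
      using mult_le_mono1[OF N, of W] unfolding work.simps W_def by linarith
  qed simp
  finally have "3 + t \<le> work (PFor x e p) M * ?C" .
  moreover have "exec (compile (PFor x e p)) s (3 + t) (sem (PFor x e p) s)"
    using exec.Seq[OF ex0 t(1)] by (simp add: loop_def test_def incr_def)
  moreover have "N * G * B \<le> growth (PFor x e p) M * B"
    by (rule mult_right_mono) (use NG in auto)
  then have "\<forall>y j. sem (PFor x e p) s y j < 2 ^ (b + growth (PFor x e p) M * B)"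
    using v less_2_power_mono[of _ "b + N * G * B" "b + growth (PFor x e p) M * B"] by auto
  ultimately show ?case by blast
qed

section \<open>Polynomially bounded functions and polynomial running time\<close>

definition poly_bounded :: "(nat \<Rightarrow> nat) \<Rightarrow> bool" where
  "poly_bounded f \<longleftrightarrow> (\<exists>q :: nat poly. \<forall>z. f z \<le> poly q z)"

lemma poly_bounded_const: "poly_bounded (\<lambda>z. c)"
  unfolding poly_bounded_def by (intro exI[of _ "[:c:]"]) simp

lemma poly_bounded_id: "poly_bounded (\<lambda>z. z)"
  unfolding poly_bounded_def by (intro exI[of _ "[:0, 1:]"]) simp

lemma poly_bounded_add:
  assumes "poly_bounded f" "poly_bounded g"
  shows "poly_bounded (\<lambda>z. f z + g z)"
proof -
  obtain p q :: "nat poly" where "\<And>z. f z \<le> poly p z" "\<And>z. g z \<le> poly q z"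
    using assms unfolding poly_bounded_def by blast
  then show ?thesis
    unfolding poly_bounded_def by (intro exI[of _ "p + q"]) (simp add: add_mono)
qed

lemma poly_bounded_mult:
  assumes "poly_bounded f" "poly_bounded g"
  shows "poly_bounded (\<lambda>z. f z * g z)"
proof -
  obtain p q :: "nat poly" where "\<And>z. f z \<le> poly p z" "\<And>z. g z \<le> poly q z"
    using assms unfolding poly_bounded_def by blast
  then show ?thesis
    unfolding poly_bounded_def by (intro exI[of _ "p * q"]) (simp add: mult_mono)
qed

text \<open>For a fixed program only sums and products with \<open>M\<close> occur, one factor
  \<open>M\<close> per level of loop nesting; so the degree is at most the nesting depth.\<close>

lemma poly_bounded_growth: "poly_bounded (\<lambda>M. growth p M)"
  by (induction p; simp only: growth.simps; intro poly_bounded_add poly_bounded_mult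
      poly_bounded_const poly_bounded_id; assumption?)

lemma poly_bounded_work: "poly_bounded (\<lambda>M. work p M)"
  by (induction p; simp only: work.simps; intro poly_bounded_add poly_bounded_mult
      poly_bounded_const poly_bounded_id; assumption?)

lemma length_le_enc_size: "length xs \<le> enc_size xs"
  by (induction xs) (auto simp: enc_size_def num_size_def)

lemma num_size_le_enc_size: "x \<in> set xs \<Longrightarrow> num_size x \<le> enc_size xs"
  unfolding enc_size_def by (rule member_le_sum_list) auto

lemma input_state_less: "input_state xs x i < 2 ^ Suc (enc_size xs)"
proof -
  have "xs ! i < 2 ^ Suc (enc_size xs)" if "i < length xs" for i
    by (rule less_2_power_mono[OF less_2_power_num_size])
      (use that num_size_le_enc_size[of "xs ! i" xs] in auto)
  moreover have "length xs < 2 ^ Suc (enc_size xs)"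
    by (rule less_2_power_mono[OF less_exp]) (use length_le_enc_size[of xs] in auto)
  ultimately show ?thesis unfolding input_state_def by simp
qed

lemma enc_size_le: "(\<And>x. x \<in> set xs \<Longrightarrow> num_size x \<le> c) \<Longrightarrow> enc_size xs \<le> length xs * c"
  unfolding enc_size_def using sum_list_mono[of xs num_size "\<lambda>_. c"]
  by (simp add: sum_list_triv)

text \<open>\<open>exec_compile\<close> is applied with \<open>M\<close> the input length
  \<open>z\<close> and both memory bounds equal to \<open>z + 1\<close>. Output entries are memory
  cells, hence as short as all others, so only their number needs a polynomial bound
  \<open>g\<close> of its own.\<close>

theorem poly_time_computableI:
  assumes wf: "wf_prog p"
    and bounds: "\<And>x e. x \<in> D \<Longrightarrow> e \<in> bounds p \<Longrightarrow>
      aval e (input_state (ein x)) \<le> enc_size (ein x)"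
    and out: "\<And>x. x \<in> D \<Longrightarrow> output_of (sem p (input_state (ein x))) = eout (F x)"
    and g: "poly_bounded g" "\<And>x. x \<in> D \<Longrightarrow> length (eout (F x)) \<le> g (enc_size (ein x))"
  shows "poly_time_computable ein eout D F"
proof -
  define C where "C = (\<lambda>z. (z + 1) + growth p z * (z + 1) + 2)"
  have "poly_bounded (\<lambda>z. work p z * C z + g z * C z)"
    unfolding C_def 
    by (intro poly_bounded_add poly_bounded_mult poly_bounded_const poly_bounded_id
        poly_bounded_growth poly_bounded_work g(1))
  then obtain q :: "nat poly" where q: "\<And>z. work p z * C z + g z * C z \<le> poly q z"
    unfolding poly_bounded_def by blast
  have "\<exists>t s. exec (compile p) (input_state (ein x)) t s \<and> output_of s = eout (F x) \<and>
      t + enc_size (eout (F x)) \<le> poly q (enc_size (ein x))" if x: "x \<in> D" for x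
  proof -
    define z where "z = enc_size (ein x)"
    let ?s = "input_state (ein x)"
    have "(\<forall>y i. sem p ?s y i < 2 ^ (Suc z + growth p z * Suc z)) \<and>
      (\<exists>t. exec (compile p) ?s t (sem p ?s) \<and> t \<le> work p z * (Suc z + growth p z * Suc z + 2))"
      using wf input_state_less bounds[OF x] unfolding z_def
      by (intro exec_compile) auto
    then obtain t where v: "\<And>y i. sem p ?s y i < 2 ^ (Suc z + growth p z * Suc z)"
      and t: "exec (compile p) ?s t (sem p ?s)" "t \<le> work p z * C z"
      by (auto simp: C_def)
    have "enc_size (eout (F x)) \<le> length (eout (F x)) * C z"
    proof (rule enc_size_le)
      fix y assume "y \<in> set (eout (F x))"
      then obtain i where "y = sem p ?s ''out'' i"
        unfolding out[OF x, symmetric] output_of_def by auto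
      then show "num_size y \<le> C z" using num_size_le[OF v, of "''out''" i] by (simp add: C_def)
    qed
    also have "\<dots> \<le> g z * C z" using g(2)[OF x] by (intro mult_right_mono) (auto simp: z_def)
    finally show ?thesis using t q[of z] out[OF x] unfolding z_def
      by (intro exI[of _ t] exI[of _ "sem p ?s"]) auto
  qed
  then show ?thesis unfolding poly_time_computable_def by blast
qed

section \<open>Lower bounds from disjoint balls\<close>

text \<open>With \<open>A\<close> the maximum, the elements with
  \<open>A / 2^(r+1) < a t \<le> A / 2^r\<close> form an admissible \<open>K\<close>. After
  \<open>R\<close> such layers at most \<open>2^R\<close> elements of value at most
  \<open>A / 2^R\<close> remain; together they contribute at most \<open>A\<close>, which accounts
  for the \<open>+ 1\<close>.\<close>

lemma dyadic_sum_bound: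
  fixes a :: "'a \<Rightarrow> real"
  assumes "finite S" "\<And>t. t \<in> S \<Longrightarrow> a t \<ge> 0"
    and X: "\<And>K. K \<subseteq> S \<Longrightarrow> (\<And>s t. s \<in> K \<Longrightarrow> t \<in> K \<Longrightarrow> a s \<le> 2 * a t) \<Longrightarrow> sum a K \<le> X"
    and "card S \<le> 2 ^ R"
  shows "sum a S \<le> real (R + 1) * X"
proof (cases "S = {}")
  case True
  then show ?thesis using X[of "{}"] by simp
next
  case False
  define A where "A = Max (a ` S)"
  have A: "a t \<le> A" if "t \<in> S" for t using that assms(1) by (simp add: A_def)
  have "A \<in> a ` S" unfolding A_def using assms(1) False by (intro Max_in) auto
  then obtain m where m: "m \<in> S" "A = a m" by auto
  \<comment> \<open>A singleton is an admissible \<open>K\<close>, as \<open>a m\<close> is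
    nonnegative; so the maximum itself is at most \<open>X\<close>.\<close>
  then have "A \<ge> 0" "A \<le> X" using X[of "{m}"] assms(2)[of m] by auto
  define S' where "S' = (\<lambda>r::nat. {t \<in> S. a t \<le> A / 2 ^ r})"
  have "sum a S \<le> real r * X + sum a (S' r)" for r
  proof (induction r)
    case 0
    have "S' 0 = S" using A by (auto simp: S'_def)
    then show ?case by simp
  next
    case (Suc r)
    have half: "A / 2 ^ Suc r \<le> A / 2 ^ r" using \<open>A \<ge> 0\<close> by (simp add: field_simps)
    have "sum a (S' r) = sum a (S' r - S' (Suc r)) + sum a (S' (Suc r))"
      using assms(1) half by (intro sum.subset_diff) (auto simp: S'_def)
    moreover have "sum a (S' r - S' (Suc r)) \<le> X"
    proof (rule X)
      fix s t assume "s \<in> S' r - S' (Suc r)" "t \<in> S' r - S' (Suc r)"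
      then have "a s \<le> A / 2 ^ r" "A / 2 ^ Suc r < a t" by (auto simp: S'_def)
      moreover have "A / 2 ^ r = 2 * (A / 2 ^ Suc r)" by simp
      ultimately show "a s \<le> 2 * a t" by linarith
    qed (auto simp: S'_def)
    ultimately show ?case using Suc.IH by (simp add: algebra_simps)
  qed
  from this[of R] have "sum a S \<le> real R * X + sum a (S' R)" .
  also have "sum a (S' R) \<le> real (card (S' R)) * (A / 2 ^ R)"
    by (intro sum_bounded_above) (auto simp: S'_def)
  also have "\<dots> \<le> real (card S) * (A / 2 ^ R)"
    using assms(1) \<open>A \<ge> 0\<close> by (intro mult_right_mono) (auto simp: S'_def intro!: card_mono)
  also have "\<dots> \<le> 2 ^ R * (A / 2 ^ R)"
    using assms(4) \<open>A \<ge> 0\<close> by (intro mult_right_mono) (auto simp flip: of_nat_le_iff)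
  also have "\<dots> \<le> X" using \<open>A \<le> X\<close> by simp
  finally show ?thesis by (simp add: algebra_simps)
qed

section \<open>Counting visits over a period\<close>

lemma card_shift_window:
  "card {k \<in> {1..a + b}. P k} = card {k \<in> {1..a}. P k} + card {k \<in> {1..b :: nat}. P (a + k)}"
proof -
  have eq: "{k \<in> {1..a + b}. P k} = {k \<in> {1..a}. P k} \<union> (+) a ` {k \<in> {1..b}. P (a + k)}" (is "?L = ?R")
  proof (intro set_eqI iffI)
    fix x assume "x \<in> ?L"
    then show "x \<in> ?R" by (cases "x \<le> a") (auto intro!: image_eqI[of _ _ "x - a"])
  qed auto
  show ?thesis unfolding eq
    by (subst card_Un_disjoint) (auto simp: card_image)
qed

lemma card_windows:
  assumes "\<And>t. \<exists>k \<in> {t + 1..t + w}. P k"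
  shows "m \<le> card {k \<in> {1..m * w}. P (k :: nat)}"
proof (induction m)
  case (Suc m)
  have "1 \<le> card {k \<in> {1..w}. P (m * w + k)}"
  proof -
    obtain k where "k \<in> {m * w + 1..m * w + w}" "P k" using assms by blast
    then have "k - m * w \<in> {k \<in> {1..w}. P (m * w + k)}" by auto
    then have "card {k \<in> {1..w}. P (m * w + k)} > 0" by (subst card_gt_0_iff) auto
    then show ?thesis by simp
  qed
  moreover have "card {k \<in> {1..Suc m * w}. P k} = card {k \<in> {1..m * w + w}. P k}"
    by (simp add: add.commute)
  ultimately show ?case using Suc card_shift_window[of "m * w" w P] by linarith
qed simp

lemma periodic_add:
  assumes "periodic l f" "k \<ge> 1"
  shows "f (m * l + k) = f k"
proof (induction m)
  case (Suc m)
  have "Suc m * l + k = (m * l + k) + l" by simp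
  with Suc assms show ?case unfolding periodic_def by (metis trans_le_add2)
qed simp

lemma card_periodic:
  assumes "periodic l f"
  shows "card {k \<in> {1..m * l}. P (f k)} = m * card {k \<in> {1..l}. P (f k)}"
proof (induction m)
  case (Suc m)
  have "{k \<in> {1..l}. P (f (m * l + k))} = {k \<in> {1..l}. P (f k)}"
    using periodic_add[OF assms] by auto
  then have "card {k \<in> {1..l}. P (f (m * l + k))} = card {k \<in> {1..l}. P (f k)}" by simp
  moreover have "card {k \<in> {1..Suc m * l}. P (f k)} = card {k \<in> {1..m * l + l}. P (f k)}"
    by (simp add: add.commute)
  ultimately show ?case using Suc card_shift_window[of "m * l" l "\<lambda>k. P (f k)"]
    unfolding mult_Suc by linarith
qed simp

text \<open>The visits during \<open>l * turnover I v\<close> days are counted twice: these days are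
  \<open>l\<close> windows with at least one visit each, and also \<open>turnover I v\<close>
  periods with equally many visits each.\<close>

lemma visits_per_period:
  assumes "periodic_solution I l T J" "v \<in> clients I"
  shows "l \<le> turnover I v * card {k \<in> {1..l}. v \<in> J k}"
proof -
  have "\<exists>k\<in>{t + 1..t + turnover I v}. v \<in> J k" for t
    using assms unfolding periodic_solution_def feasible_def by blast
  then have "l \<le> card {k \<in> {1..l * turnover I v}. v \<in> J k}" by (rule card_windows)
  also have "\<dots> = turnover I v * card {k \<in> {1..l}. v \<in> J k}"
    using card_periodic[of l J "turnover I v" "\<lambda>A. v \<in> A"] assms
    by (simp add: periodic_solution_def mult.commute)
  finally show ?thesis .
qed

section \<open>A packing bound for tours in a pseudometric\<close>

lemma abs_telescope:
  fixes f :: "nat \<Rightarrow> real"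
  assumes "a \<le> b"
  shows "\<bar>f a - f b\<bar> \<le> (\<Sum>i=a..<b. \<bar>f i - f (Suc i)\<bar>)"
  using assms by (induction rule: dec_induct) auto

text \<open>The packing argument is carried out for a pseudometric dominated by the edge weights;
  distinct vertices may have distance 0. The shortest path distance is put in for \<open>d\<close>
  later.\<close>

locale rftt_metric =
  fixes I :: "'v rftt" and d :: "'v \<Rightarrow> 'v \<Rightarrow> real"
  assumes finite_clients: "finite (clients I)"
    and depot_not_client: "depot I \<notin> clients I"
    and turnover_pos: "v \<in> clients I \<Longrightarrow> turnover I v \<ge> 1"
    and d_self: "x \<in> verts I \<Longrightarrow> d x x = 0"
    and d_sym: "x \<in> verts I \<Longrightarrow> y \<in> verts I \<Longrightarrow> d x y = d y x"
    and d_triangle: "x \<in> verts I \<Longrightarrow> y \<in> verts I \<Longrightarrow> z \<in> verts I \<Longrightarrow> d x z \<le> d x y + d y z"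
    and d_edge: "x \<in> verts I \<Longrightarrow> y \<in> verts I \<Longrightarrow> {x, y} \<in> edges I \<Longrightarrow> d x y \<le> weight I {x, y}"
begin

lemma d_nonneg: "x \<in> verts I \<Longrightarrow> y \<in> verts I \<Longrightarrow> d x y \<ge> 0"
  using d_triangle[of x y x] d_self[of x] d_sym[of x y] by simp

lemma clients_verts: "v \<in> clients I \<Longrightarrow> v \<in> verts I"
  and depot_verts: "depot I \<in> verts I"
  by (auto simp: verts_def)

text \<open>
  Disjoint balls around clients that avoid the depot: the heights \<open>max 0 (r j - d j x)\<close> turn the
  part of a walk inside the ball of \<open>j\<close> into the variation of a function.
\<close>

definition height :: "('v \<Rightarrow> real) \<Rightarrow> 'v \<Rightarrow> 'v \<Rightarrow> real" where
  "height r j x = max 0 (r j - d j x)"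

text \<open>The balls are disjoint, so at \<open>x\<close> and at \<open>y\<close> at most one
  height each is positive. If a single client is concerned, its height is 1-Lipschitz. For different
  clients \<open>i\<close> and \<open>k\<close>, the heights \<open>r i - d i x\<close> and
  \<open>r k - d k y\<close> sum to at most \<open>d x y\<close>, by separation and the triangle
  inequality along \<open>i\<close>, \<open>x\<close>, \<open>y\<close>, \<open>k\<close>.\<close>

lemma height_variation:
  assumes C: "C \<subseteq> clients I"
    and sep: "\<And>i j. i \<in> C \<Longrightarrow> j \<in> C \<Longrightarrow> i \<noteq> j \<Longrightarrow> r i + r j \<le> d i j"
    and x: "x \<in> verts I" and y: "y \<in> verts I"
  shows "(\<Sum>j\<in>C. \<bar>height r j x - height r j y\<bar>) \<le> d x y"
proof -
  have fin: "finite C" using C finite_clients finite_subset by blast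
  have V: "j \<in> verts I" if "j \<in> C" for j using that C clients_verts by auto
  have single: "\<exists>i. \<forall>j\<in>C. j \<noteq> i \<longrightarrow> height r j z = 0" if z: "z \<in> verts I" for z
  proof (rule ccontr)
    assume *: "\<not> ?thesis"
    then obtain i where i: "i \<in> C" "height r i z \<noteq> 0" by blast
    with * obtain j where j: "j \<in> C" "j \<noteq> i" "height r j z \<noteq> 0" by blast
    have "d i z < r i" "d j z < r j" using i j by (auto simp: height_def max_def split: if_splits)
    moreover have "d i j \<le> d i z + d j z"
      using d_triangle[of i z j] d_sym[of z j] V i j z by auto
    ultimately show False using sep[of i j] i j by auto
  qed
  have lip: "\<bar>height r j x - height r j y\<bar> \<le> d x y" if "j \<in> C" for j
    using d_triangle[of j x y] d_triangle[of j y x] d_sym[of x y] V[OF that] x y d_nonneg[of x y]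
    unfolding height_def by linarith
  obtain i where i: "\<forall>j\<in>C. j \<noteq> i \<longrightarrow> height r j x = 0" using single[OF x] by blast
  obtain k where k: "\<forall>j\<in>C. j \<noteq> k \<longrightarrow> height r j y = 0" using single[OF y] by blast
  let ?f = "\<lambda>j. \<bar>height r j x - height r j y\<bar>"
  have eq: "sum ?f C = sum ?f (C \<inter> {i, k})"
    using i k fin by (intro sum.mono_neutral_right) auto
  show ?thesis
  proof (cases "i \<noteq> k \<and> i \<in> C \<and> k \<in> C")
    case True
    then have "sum ?f C = height r i x + height r k y"
      unfolding eq using i k by (auto simp: Int_insert_right height_def)
    also have "\<dots> \<le> d x y"
    proof (cases "height r i x = 0 \<or> height r k y = 0")
      case True
      then show ?thesis using lip[of i] lip[of k] i k \<open>i \<noteq> k \<and> i \<in> C \<and> k \<in> C\<close>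
        by (auto simp: height_def)
    next
      case False
      then have "height r i x = r i - d i x" "height r k y = r k - d k y"
        by (auto simp: height_def max_def split: if_splits)
      moreover have "d i k \<le> d i x + (d x y + d k y)"
        using d_triangle[of i x k] d_triangle[of x y k] d_sym[of y k] V True x y by auto
      ultimately show ?thesis using sep[of i k] True by auto
    qed
    finally show ?thesis .
  next
    case False
    then have "C \<inter> {i, k} = {} \<or> (\<exists>j\<in>C. C \<inter> {i, k} = {j})" by auto
    then show ?thesis unfolding eq using lip d_nonneg[OF x y] by auto
  qed
qed

text \<open>Along the walk the height of a visited client \<open>j\<close> starts at 0, reaches
  \<open>r j\<close> and returns to 0, since the depot lies outside the open ball; its variation is
  at least \<open>2 * r j\<close>. In each single step, the variations of all clients together are
  paid by the edge.\<close>

lemma tour_cost_ge: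
  assumes C: "C \<subseteq> clients I"
    and sep: "\<And>i j. i \<in> C \<Longrightarrow> j \<in> C \<Longrightarrow> i \<noteq> j \<Longrightarrow> r i + r j \<le> d i j"
    and depot: "\<And>j. j \<in> C \<Longrightarrow> r j \<le> d j (depot I)"
    and r: "\<And>j. j \<in> C \<Longrightarrow> r j \<ge> 0"
    and w: "depot_tour I w"
  shows "(\<Sum>j\<in>C \<inter> set w. 2 * r j) \<le> walk_cost I w"
proof -
  have fin: "finite C" using C finite_clients finite_subset by blast
  let ?n = "length w - 1"
  have ne: "w \<noteq> []" and sub: "set w \<subseteq> verts I"
    and suc: "successively (\<lambda>u v. {u, v} \<in> edges I) w"
    and hd: "w ! 0 = depot I" and last: "w ! ?n = depot I"
    using w unfolding depot_tour_def is_walk_def by (auto simp: hd_conv_nth last_conv_nth)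
  have V: "w ! i \<in> verts I" if "i < length w" for i using sub that by auto
  have E: "{w ! i, w ! Suc i} \<in> edges I" if "i < ?n" for i
    using suc that by (auto simp: successively_conv_nth)
  have "2 * r j \<le> (\<Sum>i<?n. \<bar>height r j (w ! i) - height r j (w ! Suc i)\<bar>)"
    if "j \<in> C \<inter> set w" for j
  proof -
    let ?f = "\<lambda>i. height r j (w ! i)"
    have j: "j \<in> C" "j \<in> set w" using that by auto
    obtain m where m: "m < length w" "w ! m = j" using j(2) unfolding in_set_conv_nth by blast
    have "j \<in> verts I" "r j \<le> d j (depot I)" "0 \<le> r j"
      using j(1) depot r C clients_verts by auto
    then have h: "?f 0 = 0" "?f ?n = 0" "?f m = r j"
      unfolding hd last m(2) by (auto simp: height_def d_self)
    have "\<bar>?f 0 - ?f m\<bar> + \<bar>?f m - ?f ?n\<bar> \<le>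
        (\<Sum>i=0..<m. \<bar>?f i - ?f (Suc i)\<bar>) + (\<Sum>i=m..<?n. \<bar>?f i - ?f (Suc i)\<bar>)"
      using m(1) by (intro add_mono abs_telescope) auto
    also have "\<dots> = (\<Sum>i=0..<?n. \<bar>?f i - ?f (Suc i)\<bar>)"
      using m(1) by (intro sum.atLeastLessThan_concat) auto
    finally show ?thesis using h unfolding lessThan_atLeast0 by linarith
  qed
  then have "(\<Sum>j\<in>C \<inter> set w. 2 * r j) \<le>
      (\<Sum>j\<in>C \<inter> set w. \<Sum>i<?n. \<bar>height r j (w ! i) - height r j (w ! Suc i)\<bar>)"
    by (rule sum_mono)
  also have "\<dots> \<le> (\<Sum>j\<in>C. \<Sum>i<?n. \<bar>height r j (w ! i) - height r j (w ! Suc i)\<bar>)"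
    using fin by (intro sum_mono2 sum_nonneg) auto
  also have "\<dots> = (\<Sum>i<?n. \<Sum>j\<in>C. \<bar>height r j (w ! i) - height r j (w ! Suc i)\<bar>)"
    by (rule sum.swap)
  also have "\<dots> \<le> walk_cost I w"
    unfolding walk_cost_def
  proof (rule sum_mono)
    fix i assume i: "i \<in> {..<?n}"
    then have "w ! i \<in> verts I" "w ! Suc i \<in> verts I" using V by auto
    then have "(\<Sum>j\<in>C. \<bar>height r j (w ! i) - height r j (w ! Suc i)\<bar>) \<le> d (w ! i) (w ! Suc i)"
      using C sep by (intro height_variation)
    also have "\<dots> \<le> weight I {w ! i, w ! Suc i}"
      using i V E by (intro d_edge) auto
    finally show "(\<Sum>j\<in>C. \<bar>height r j (w ! i) - height r j (w ! Suc i)\<bar>) \<le> weight I {w ! i, w ! Suc i}" .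
  qed
  finally show ?thesis .
qed

text \<open>The bound for a day is summed over one period and the order of summation exchanged:
  \<open>j\<close> collects \<open>2 * r j\<close> on each day of service, of which there are at
  least \<open>l / turnover I j\<close>.\<close>

lemma avg_cost_ge_packing:
  assumes C: "C \<subseteq> clients I"
    and sep: "\<And>i j. i \<in> C \<Longrightarrow> j \<in> C \<Longrightarrow> i \<noteq> j \<Longrightarrow> r i + r j \<le> d i j"
    and depot: "\<And>j. j \<in> C \<Longrightarrow> r j \<le> d j (depot I)"
    and r: "\<And>j. j \<in> C \<Longrightarrow> r j \<ge> 0"
    and sol: "periodic_solution I l T J"
  shows "(\<Sum>j\<in>C. 2 * r j / real (turnover I j)) \<le> avg_cost I l T"
proof -
  have fin: "finite C" using C finite_clients finite_subset by blast
  have l: "l \<ge> 1" using sol by (auto simp: periodic_solution_def periodic_def)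
  have "(\<Sum>j\<in>C. 2 * r j / real (turnover I j)) * real l \<le>
      (\<Sum>j\<in>C. 2 * r j * real (card {k \<in> {1..l}. j \<in> J k}))"
    unfolding sum_distrib_right
  proof (rule sum_mono)
    fix j assume j: "j \<in> C"
    then have t: "turnover I j \<ge> 1" using C turnover_pos by auto
    have "real l \<le> real (turnover I j) * real (card {k \<in> {1..l}. j \<in> J k})"
      using visits_per_period[OF sol, of j] j C by (metis of_nat_le_iff of_nat_mult subsetD)
    then have "2 * r j * real l \<le> 2 * r j * (real (turnover I j) * real (card {k \<in> {1..l}. j \<in> J k}))"
      using r[OF j] by (intro mult_left_mono) auto
    then show "2 * r j / real (turnover I j) * real l \<le> 2 * r j * real (card {k \<in> {1..l}. j \<in> J k})"
      using t by (simp add: field_simps)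
  qed
  also have "\<dots> = (\<Sum>j\<in>C. \<Sum>k=1..l. if j \<in> J k then 2 * r j else 0)"
  proof (intro sum.cong refl)
    fix j
    have "{k \<in> {1..l}. j \<in> J k} = {1..l} \<inter> {k. j \<in> J k}" by auto
    then show "2 * r j * real (card {k \<in> {1..l}. j \<in> J k}) = (\<Sum>k=1..l. if j \<in> J k then 2 * r j else 0)"
      by (simp add: sum.If_cases)
  qed
  also have "\<dots> = (\<Sum>k=1..l. \<Sum>j\<in>C. if j \<in> J k then 2 * r j else 0)"
    by (rule sum.swap)
  also have "\<dots> \<le> (\<Sum>k=1..l. walk_cost I (T k))"
  proof (rule sum_mono)
    fix k assume "k \<in> {1..l}"
    then have k: "depot_tour I (T k)" "J k \<subseteq> clients I \<inter> set (T k)"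
      using sol by (auto simp: periodic_solution_def feasible_def)
    have "(\<Sum>j\<in>C. if j \<in> J k then 2 * r j else 0) = (\<Sum>j\<in>C \<inter> J k. 2 * r j)"
      using fin by (simp add: sum.inter_restrict)
    also have "\<dots> \<le> (\<Sum>j\<in>C \<inter> set (T k). 2 * r j)"
      using fin k r by (intro sum_mono2) auto
    also have "\<dots> \<le> walk_cost I (T k)"
      by (rule tour_cost_ge[OF C sep depot r k(1)])
    finally show "(\<Sum>j\<in>C. if j \<in> J k then 2 * r j else 0) \<le> walk_cost I (T k)" .
  qed
  finally show ?thesis using l by (simp add: avg_cost_def field_simps)
qed

text \<open>
  If the ratios of \<open>\<delta> t\<close> to the turnover times agree up to a factor \<open>2\<close> on a set of clients, then the balls of radius \<open>\<delta> t / 3\<close> around them are disjoint.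
\<close>

theorem greedy_sum_le:
  fixes c :: "nat \<Rightarrow> 'v"
  assumes c: "bij_betw c {1..n} (clients I)" "c 0 = depot I"
    and mono: "\<And>s t. 1 \<le> s \<Longrightarrow> s \<le> t \<Longrightarrow> t \<le> n \<Longrightarrow> turnover I (c s) \<le> turnover I (c t)"
    and \<delta>: "\<And>s t. s < t \<Longrightarrow> t \<le> n \<Longrightarrow> \<delta> t \<le> d (c s) (c t)" "\<And>t. \<delta> t \<ge> 0"
    and sol: "periodic_solution I l T J"
    and R: "n \<le> 2 ^ R"
  shows "(\<Sum>t=1..n. \<delta> t / real (turnover I (c t))) \<le> real (R + 1) * (3 / 2 * avg_cost I l T)"
proof (rule dyadic_sum_bound)
  fix K assume K: "K \<subseteq> {1..n}"
    and ratio: "\<And>s t. s \<in> K \<Longrightarrow> t \<in> K \<Longrightarrow>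
      \<delta> s / real (turnover I (c s)) \<le> 2 * (\<delta> t / real (turnover I (c t)))"
  have inj: "inj_on c K" using c(1) K by (meson bij_betw_def inj_on_subset)
  define g where "g = inv_into K c"
  have g: "g (c t) = t" if "t \<in> K" for t unfolding g_def using inj that by simp
  have cl: "c t \<in> clients I" if "t \<in> K" for t using c(1) K that by (auto simp: bij_betw_def)
  have vs: "c t \<in> verts I" if "t \<in> K" for t using cl[OF that] clients_verts by auto
  \<comment> \<open>Origin of the radius: the earlier client \<open>s\<close> has the smaller
    turnover time, hence \<open>\<delta> s \<le> 2 * \<delta> t\<close> by the ratio condition, and
    a third of \<open>\<delta> s + \<delta> t\<close> is at most \<open>\<delta> t\<close>.\<close>
  have sep: "\<delta> s / 3 + \<delta> t / 3 \<le> d (c s) (c t)" if "s \<in> K" "t \<in> K" "s < t" for s t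
  proof -
    have "s \<in> {1..n}" "t \<in> {1..n}" using that K by auto
    then have tau: "turnover I (c s) \<ge> 1" "turnover I (c s) \<le> turnover I (c t)"
      using turnover_pos[OF cl[OF that(1)]] mono[of s t] that(3) by auto
    have "\<delta> s \<le> 2 * (\<delta> t / real (turnover I (c t))) * real (turnover I (c s))"
      using ratio[OF that(1,2)] tau by (simp add: field_simps)
    also have "\<dots> \<le> 2 * (\<delta> t / real (turnover I (c t))) * real (turnover I (c t))"
      using tau \<delta>(2)[of t] by (intro mult_left_mono) auto
    also have "\<dots> = 2 * \<delta> t" using tau by simp
    finally show ?thesis using \<delta>(1)[of s t] that K by auto
  qed
  have "(\<Sum>j\<in>c ` K. 2 * (\<delta> (g j) / 3) / real (turnover I j)) \<le> avg_cost I l T"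
  proof (rule avg_cost_ge_packing[OF _ _ _ _ sol])
    show "c ` K \<subseteq> clients I" using cl by auto
  next
    fix i j assume "i \<in> c ` K" "j \<in> c ` K" "i \<noteq> j"
    then obtain s t where st: "s \<in> K" "t \<in> K" "i = c s" "j = c t" "s \<noteq> t" by auto
    then show "\<delta> (g i) / 3 + \<delta> (g j) / 3 \<le> d i j"
      using sep[of s t] sep[of t s] d_sym[of i j] vs g by (cases "s < t") auto
  next
    fix j assume "j \<in> c ` K"
    then obtain t where t: "t \<in> K" "j = c t" by auto
    \<comment> \<open>Index 0 counts as a predecessor of every client, so \<open>\<delta> t\<close>
      is also at most the distance to the depot.\<close>
    then have "\<delta> t \<le> d (depot I) (c t)" using \<delta>(1)[of 0 t] K c(2) by auto
    then show "\<delta> (g j) / 3 \<le> d j (depot I)"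
      using t g \<delta>(2)[of t] d_sym[of "c t" "depot I"] vs depot_verts by auto
  qed (use \<delta> in auto)
  also have "(\<Sum>j\<in>c ` K. 2 * (\<delta> (g j) / 3) / real (turnover I j)) =
      2 / 3 * (\<Sum>t\<in>K. \<delta> t / real (turnover I (c t)))"
    using inj g by (simp add: sum.reindex sum_distrib_left mult.commute cong: sum.cong)
  finally show "(\<Sum>t\<in>K. \<delta> t / real (turnover I (c t))) \<le> 3 / 2 * avg_cost I l T" by simp
qed (use \<delta> R in auto)

end

section \<open>Shortest paths and the greedy cycle\<close>

declare upt_Suc [simp del]

text \<open>An argmin written as the loop that computes it. Ties keep the older candidate, so that
  program and specification agree on the vertex and not only on its value.\<close>

definition scan :: "(nat \<Rightarrow> nat) \<Rightarrow> nat \<Rightarrow> nat list \<Rightarrow> nat" where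
  "scan f a xs = fold (\<lambda>x y. if f x < f y then x else y) xs a"

lemma scan_in: "scan f a xs \<in> insert a (set xs)"
  by (induction xs arbitrary: a) (auto simp: scan_def)

lemma scan_le_init: "f (scan f a xs) \<le> f a"
proof (induction xs arbitrary: a)
  case (Cons x xs)
  have "scan f a (x # xs) = scan f (if f x < f a then x else a) xs" by (simp add: scan_def)
  then show ?case using Cons[of x] Cons[of a] by auto
qed (simp add: scan_def)

lemma scan_le: "x \<in> set xs \<Longrightarrow> f (scan f a xs) \<le> f x"
proof (induction xs arbitrary: a)
  case (Cons y xs)
  have *: "scan f a (y # xs) = scan f (if f y < f a then y else a) xs" by (simp add: scan_def)
  show ?case
  proof (cases "x = y")
    case True
    then show ?thesis unfolding * using scan_le_init[of f y xs] scan_le_init[of f a xs] by auto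
  next
    case False
    then show ?thesis unfolding * using Cons by auto
  qed
qed simp

lemma scan_cong:
  "(\<And>x. x \<in> insert a (set xs) \<Longrightarrow> f x = g x) \<Longrightarrow> scan f a xs = scan g a xs"
proof (induction xs arbitrary: a)
  case (Cons x xs)
  have "f x = g x" "f a = g a" using Cons.prems by auto
  then have "scan f a (x # xs) = scan f (if g x < g a then x else a) xs" by (simp add: scan_def)
  also have "\<dots> = scan g (if g x < g a then x else a) xs"
    by (rule Cons.IH) (use Cons.prems in \<open>auto split: if_splits\<close>)
  also have "\<dots> = scan g a (x # xs)" by (simp add: scan_def)
  finally show ?case .
qed (simp add: scan_def)

section \<open>Lengths of walks\<close>

fun step_sum :: "('a \<Rightarrow> 'a \<Rightarrow> 'b::comm_monoid_add) \<Rightarrow> 'a list \<Rightarrow> 'b" where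
  "step_sum f (x # y # xs) = f x y + step_sum f (y # xs)"
| "step_sum f xs = 0"

lemma step_sum_append: "step_sum f (xs @ x # ys) = step_sum f (xs @ [x]) + step_sum f (x # ys)"
  by (induction f xs rule: step_sum.induct) (auto simp: add_ac)

lemma step_sum_join:
  assumes "xs \<noteq> []" "ys \<noteq> []" "last xs = hd ys"
  shows "step_sum f (xs @ tl ys) = step_sum f xs + step_sum f ys"
proof -
  obtain A x B where "xs = A @ [x]" "ys = x # B"
    using assms by (metis append_butlast_last_id list.collapse)
  then show ?thesis using step_sum_append[of f A x B] by simp
qed

lemma step_sum_rev:
  assumes "\<And>x y. f x y = f y x"
  shows "step_sum f (rev xs) = step_sum f xs"
proof (induction xs rule: induct_list012)
  case (3 x y xs)
  have "step_sum f (rev (x # y # xs)) = step_sum f (rev (y # xs)) + f y x"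
    using step_sum_append[of f "rev xs" y "[x]"] by simp
  then show ?case using 3 assms[of x y] by (simp add: add.commute)
qed auto

lemma step_sum_conv_sum: "step_sum f xs = (\<Sum>i<length xs - 1. f (xs ! i) (xs ! Suc i))"
proof (induction f xs rule: step_sum.induct)
  case (1 f x y xs)
  then show ?case by (simp add: sum.lessThan_Suc_shift del: sum.lessThan_Suc)
qed auto

lemma step_sum_le:
  fixes f :: "'a \<Rightarrow> 'a \<Rightarrow> nat"
  shows "successively (\<lambda>x y. f x y \<le> c) xs \<Longrightarrow> step_sum f xs \<le> (length xs - 1) * c"
  by (induction f xs rule: step_sum.induct) auto

text \<open>Serves to show that a route shorter than the entry for non-edges contains no
  non-edge.\<close>

lemma step_le_step_sum:
  fixes f :: "'a \<Rightarrow> 'a \<Rightarrow> nat"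
  shows "step_sum f xs \<le> c \<Longrightarrow> successively (\<lambda>x y. f x y \<le> c) xs"
  by (induction f xs rule: step_sum.induct) auto

text \<open>The part between two occurrences of a vertex can be cut out: the remaining steps were
  all present before, so \<open>P\<close> persists and the sum does not grow. This limits the depth
  that the shortest path recursion needs.\<close>

lemma ex_distinct_walk:
  fixes f :: "'a \<Rightarrow> 'a \<Rightarrow> nat"
  assumes "w \<noteq> []" "successively P w"
  shows "\<exists>w'. w' \<noteq> [] \<and> distinct w' \<and> hd w' = hd w \<and> last w' = last w \<and> set w' \<subseteq> set w \<and>
    successively P w' \<and> step_sum f w' \<le> step_sum f w"
  using assms
proof (induction "length w" arbitrary: w rule: less_induct)
  case less
  show ?case
  proof (cases "distinct w")
    case False
    then obtain A x B C where w: "w = A @ x # B @ x # C"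
      using not_distinct_decomp[of w] by auto
    let ?w = "A @ x # C"
    have s: "successively P ?w"
      using less.prems(2) unfolding w by (auto simp: successively_append_iff successively_Cons)
    have "step_sum f w = step_sum f (A @ [x]) + step_sum f (x # B @ x # C)"
      unfolding w by (rule step_sum_append)
    also have "step_sum f (x # B @ x # C) = step_sum f (x # B @ [x]) + step_sum f (x # C)"
      using step_sum_append[of f "x # B" x C] by simp
    finally have c: "step_sum f ?w \<le> step_sum f w"
      using step_sum_append[of f A x C] by simp
    have "\<exists>w'. w' \<noteq> [] \<and> distinct w' \<and> hd w' = hd ?w \<and> last w' = last ?w \<and> set w' \<subseteq> set ?w \<and>
      successively P w' \<and> step_sum f w' \<le> step_sum f ?w"
      using s by (intro less.hyps) (auto simp: w)
    then obtain w' where "w' \<noteq> []" "distinct w'" "hd w' = hd ?w" "last w' = last ?w"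
      "set w' \<subseteq> set ?w" "successively P w'" "step_sum f w' \<le> step_sum f ?w"
      by blast
    moreover have "hd ?w = hd w" "last ?w = last w" "set ?w \<subseteq> set w"
      by (auto simp: w hd_append)
    ultimately have "w' \<noteq> [] \<and> distinct w' \<and> hd w' = hd w \<and> last w' = last w \<and> set w' \<subseteq> set w \<and>
      successively P w' \<and> step_sum f w' \<le> step_sum f w"
      using c by (intro conjI) (simp | blast | linarith)+
    then show ?thesis by blast
  qed (use less in auto)
qed

section \<open>Insertion into a cycle, as a list and as successor pointers\<close>

fun insert_after :: "'a \<Rightarrow> 'a \<Rightarrow> 'a list \<Rightarrow> 'a list" where
  "insert_after q j [] = []"
| "insert_after q j (x # xs) = (if x = q then x # j # xs else x # insert_after q j xs)"

lemma set_insert_after: "q \<in> set xs \<Longrightarrow> set (insert_after q j xs) = insert j (set xs)"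
  by (induction xs) auto

lemma insert_after_not_in: "q \<notin> set xs \<Longrightarrow> insert_after q j xs = xs"
  by (induction xs) auto

lemma distinct_insert_after: "distinct xs \<Longrightarrow> j \<notin> set xs \<Longrightarrow> distinct (insert_after q j xs)"
proof (induction xs)
  case (Cons x xs)
  then show ?case by (cases "q \<in> set xs") (auto simp: set_insert_after insert_after_not_in)
qed auto

lemma insert_after_nonempty: "xs \<noteq> [] \<Longrightarrow> insert_after q j xs \<noteq> [] \<and> hd (insert_after q j xs) = hd xs"
  by (cases xs) auto

lemma length_insert_after: "q \<in> set xs \<Longrightarrow> length (insert_after q j xs) = Suc (length xs)"
  by (induction xs) auto

text \<open>The step from \<open>q\<close> to its successor \<open>y\<close> becomes a detour
  through \<open>j\<close>, and \<open>f j y \<le> f q j + f q y\<close>. The closing vertex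
  \<open>z\<close> ensures that even the last vertex of \<open>xs\<close> has a successor.\<close>

lemma step_sum_insert_after:
  fixes f :: "'a \<Rightarrow> 'a \<Rightarrow> nat"
  assumes "\<And>x y z. x \<in> V \<Longrightarrow> y \<in> V \<Longrightarrow> z \<in> V \<Longrightarrow> f x z \<le> f x y + f y z"
    and "\<And>x y. x \<in> V \<Longrightarrow> y \<in> V \<Longrightarrow> f x y = f y x"
    and "q \<in> V" "j \<in> V" "set xs \<subseteq> V" "z \<in> V"
  shows "step_sum f (insert_after q j xs @ [z]) \<le> step_sum f (xs @ [z]) + 2 * f q j"
  using assms(5)
proof (induction xs)
  case (Cons x xs)
  show ?case
  proof (cases "x = q")
    case True
    obtain y r where y: "xs @ [z] = y # r" by (cases xs) auto
    have "y \<in> V" using y Cons.prems assms(6) by (cases xs) auto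
    then have "f j y \<le> f q j + f q y" using assms(1)[of j q y] assms(2)[of j q] assms(3,4) by simp
    then show ?thesis using True by (simp add: y)
  next
    case False
    have "hd (insert_after q j xs @ [z]) = hd (xs @ [z])" by (cases xs) auto
    then obtain y r r' where "xs @ [z] = y # r" "insert_after q j xs @ [z] = y # r'"
      by (metis hd_Cons_tl snoc_eq_iff_butlast)
    then show ?thesis using False Cons by simp
  qed
qed simp

text \<open>The form of a cycle in memory: \<open>nx\<close> is the array of successors. The
  successor of the last element is unconstrained, so a cycle is given by its vertices with the first
  one repeated at the end.\<close>

fun linked :: "('a \<Rightarrow> 'a) \<Rightarrow> 'a list \<Rightarrow> bool" where
  "linked nx (x # y # xs) = (nx x = y \<and> linked nx (y # xs))"
| "linked nx xs = True"

lemma linked_cong: "(\<And>x. x \<in> set (butlast xs) \<Longrightarrow> nx x = nx' x) \<Longrightarrow> linked nx xs = linked nx' xs"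
  by (induction nx xs rule: linked.induct) auto

text \<open>Only the pointers of \<open>j\<close> and \<open>q\<close> change. The closing vertex
  \<open>z\<close> may occur in \<open>xs\<close>, as the depot does.\<close>

lemma linked_insert_after:
  assumes "linked nx (xs @ [z])" "distinct xs" "j \<notin> set xs" "q \<in> set xs"
  shows "linked (nx(j := nx q, q := j)) (insert_after q j xs @ [z])"
  using assms
proof (induction xs)
  case (Cons x xs)
  obtain y r where y: "xs @ [z] = y # r" by (cases xs) auto
  show ?case
  proof (cases "x = q")
    case True
    define nx' where "nx' = nx(j := nx q, q := j)"
    have "linked nx' (xs @ [z]) = linked nx (xs @ [z])"
      by (rule linked_cong) (use Cons.prems True in \<open>auto simp: nx'_def\<close>)
    moreover have "nx' q = j" "nx' j = y" using True Cons.prems by (auto simp: nx'_def y)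
    ultimately have "linked nx' (insert_after q j (x # xs) @ [z])"
      using True Cons.prems by (simp add: y)
    then show ?thesis unfolding nx'_def .
  next
    case False
    have "hd (insert_after q j xs @ [z]) = hd (xs @ [z])" by (cases xs) auto
    then obtain r' where r': "insert_after q j xs @ [z] = y # r'"
      using y by (metis hd_Cons_tl list.sel(1) snoc_eq_iff_butlast)
    define nx' where "nx' = nx(j := nx q, q := j)"
    have "linked nx' (y # r')"
      unfolding nx'_def r'[symmetric] using Cons False by (intro Cons.IH) (auto simp: y)
    moreover have "nx' x = y" using False Cons.prems by (auto simp: nx'_def y)
    ultimately have "linked nx' (insert_after q j (x # xs) @ [z])" using False r' by simp
    then show ?thesis unfolding nx'_def .
  qed
qed simp

lemma linked_nth: "linked nx xs \<Longrightarrow> Suc i < length xs \<Longrightarrow> nx (xs ! i) = xs ! Suc i"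
proof (induction nx xs arbitrary: i rule: linked.induct)
  case (1 nx x y xs)
  then show ?case by (cases i) auto
qed auto

text \<open>
  The vertices are \<open>0, \<dots>, n\<close> with depot \<open>0\<close>, and \<open>W\<close> is the matrix of scaled edge lengths with zero
  diagonal and a huge entry for every non-edge.
\<close>

locale greedy_scheme =
  fixes n :: nat and W :: "nat \<Rightarrow> nat \<Rightarrow> nat" and \<tau> :: "nat \<Rightarrow> nat" and big :: nat
begin

abbreviation "N \<equiv> Suc n"

text \<open>The Bellman-Ford recursion: the least cost of a walk from \<open>i\<close> to
  \<open>j\<close> with at most \<open>Suc h\<close> steps, where the zero diagonal of
  \<open>W\<close> makes staying in place free. All layers are kept because a route is read off from
  the minimisers of each.\<close>

fun dst :: "nat \<Rightarrow> nat \<Rightarrow> nat \<Rightarrow> nat" where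
  "dst 0 i j = W i j"
| "dst (Suc h) i j = (let f = (\<lambda>x. W i x + dst h x j) in f (scan f i [0..<N]))"

fun hop :: "nat \<Rightarrow> nat \<Rightarrow> nat \<Rightarrow> nat" where
  "hop 0 i j = j"
| "hop (Suc h) i j = scan (\<lambda>x. W i x + dst h x j) i [0..<N]"

definition moves :: "nat \<Rightarrow> nat \<Rightarrow> nat list" where
  "moves i x = (if x = i then [] else [x])"

text \<open>The start vertex is left out, so routes can be concatenated directly. A minimiser equal
  to \<open>i\<close> contributes nothing, as a walk in the graph cannot stay in place.\<close>

fun route :: "nat \<Rightarrow> nat \<Rightarrow> nat \<Rightarrow> nat list" where
  "route 0 i j = moves i j"
| "route (Suc h) i j = moves i (hop (Suc h) i j) @ route h (hop (Suc h) i j) j"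

text \<open>Selection sort by turnover time: the depot and the clients already chosen carry the key
  \<open>big\<close>, above every turnover time.\<close>

fun keys :: "nat \<Rightarrow> nat \<Rightarrow> nat" where
  "keys 0 = \<tau>(0 := big)"
| "keys (Suc t) = (keys t)(scan (keys t) 0 [0..<N] := big)"

fun ord :: "nat \<Rightarrow> nat" where
  "ord 0 = 0"
| "ord (Suc t) = scan (keys t) 0 [0..<N]"

text \<open>The next period is the largest multiple of the present one that does not exceed the next
  turnover time; the product has the shape \<open>e * (g div e)\<close> that \<open>tame\<close>
  admits.\<close>

fun per :: "nat \<Rightarrow> nat" where
  "per 0 = 1"
| "per (Suc t) = per t * (\<tau> (ord (Suc t)) div per t)"

text \<open>The content of the array \<open>''ord''\<close> when its entries below \<open>t\<close>
  are in place: cells not yet written read 0, the depot. So a scan over all indices considers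
  predecessors only.\<close>

definition earlier :: "nat \<Rightarrow> nat \<Rightarrow> nat" where
  "earlier t x = (if x < t then ord x else 0)"

definition par :: "nat \<Rightarrow> nat" where
  "par t = earlier t (scan (\<lambda>x. dst n (earlier t x) (ord t)) 0 [0..<N])"

fun cyc :: "nat \<Rightarrow> nat list" where
  "cyc 0 = [0]"
| "cyc (Suc t) = insert_after (par (Suc t)) (ord (Suc t)) (cyc t)"

fun expand :: "nat list \<Rightarrow> nat list" where
  "expand (x # y # xs) = route n x y @ expand (y # xs)"
| "expand xs = []"

definition cnt :: "nat \<Rightarrow> nat" where
  "cnt k = card {t \<in> {1..n}. per t dvd k}"

definition tour :: "nat \<Rightarrow> nat list" where
  "tour k = 0 # expand (cyc (cnt k) @ [0])"

definition visited :: "nat \<Rightarrow> nat list" where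
  "visited k = map ord [1..<Suc (cnt k)]"

lemma expand_snoc: "expand (xs @ [x, y]) = expand (xs @ [x]) @ route n x y"
  by (induction xs rule: expand.induct) auto

lemma length_route: "length (route h i j) \<le> Suc h"
  by (induction h arbitrary: i) (auto simp: moves_def intro: le_SucI)

lemma length_expand: "length (expand xs) \<le> length xs * N"
proof (induction xs rule: expand.induct)
  case (1 x y xs)
  then show ?case using length_route[of n x y] by simp
qed auto

lemma route_Suc_cases:
  fixes h i j
  defines "x \<equiv> hop (Suc h) i j"
  obtains "x = i" "route (Suc h) i j = route h i j"
  | "x \<noteq> i" "route (Suc h) i j = x # route h x j"
  unfolding x_def by (cases "hop (Suc h) i j = i") (auto simp: moves_def simp del: hop.simps)

lemma last_route: "last (i # route h i j) = j"
proof (induction h arbitrary: i)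
  case (Suc h)
  show ?case by (cases rule: route_Suc_cases[of h i j]) (use Suc in \<open>auto simp del: last.simps hop.simps simp: last_ConsR\<close>)
qed (simp add: moves_def)

lemma hop_less: "i < N \<Longrightarrow> j < N \<Longrightarrow> hop h i j < N"
proof (cases h)
  case (Suc g)
  then show "i < N \<Longrightarrow> ?thesis"
    using scan_in[of "\<lambda>x. W i x + dst g x j" i "[0..<N]"] by auto
qed simp

lemma route_less: "i < N \<Longrightarrow> j < N \<Longrightarrow> set (route h i j) \<subseteq> {..<N}"
proof (induction h arbitrary: i)
  case (Suc h)
  then show ?case using hop_less[of i j "Suc h"] by (auto simp: moves_def simp del: hop.simps)
qed (auto simp: moves_def)

lemma successively_route: "successively (\<noteq>) (i # route h i j)"
proof (induction h arbitrary: i)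
  case (Suc h)
  show ?case by (cases rule: route_Suc_cases[of h i j]) (use Suc in \<open>auto simp del: hop.simps\<close>)
qed (simp add: moves_def)

end

locale metric_greedy_scheme = greedy_scheme +
  assumes W_self: "W i i = 0" and W_sym: "W i j = W j i"
    and \<tau>_pos: "j \<in> {1..n} \<Longrightarrow> \<tau> j \<ge> 1" and big: "j \<in> {1..n} \<Longrightarrow> \<tau> j < big"
begin

section \<open>Shortest paths\<close>

lemma step_sum_route: "step_sum W (i # route h i j) = dst h i j"
proof (induction h arbitrary: i)
  case 0
  then show ?case by (simp add: moves_def W_self)
next
  case (Suc h)
  let ?x = "hop (Suc h) i j"
  have *: "dst (Suc h) i j = W i ?x + dst h ?x j" by (simp add: Let_def)
  show ?case
  proof (cases rule: route_Suc_cases[of h i j])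
    case 1
    then show ?thesis using Suc[of i] * W_self[of i] by simp
  next
    case 2
    then show ?thesis using Suc[of ?x] * by simp
  qed
qed

lemma dst_le_W: "x < N \<Longrightarrow> dst (Suc h) i j \<le> W i x + dst h x j"
  using scan_le[of x "[0..<N]" "\<lambda>x. W i x + dst h x j" i] by (simp add: Let_def)

lemma dst_le_dst: "dst (Suc h) i j \<le> dst h i j"
  using scan_le_init[of "\<lambda>x. W i x + dst h x j" i "[0..<N]"] by (simp add: Let_def W_self)

lemma dst_self: "dst h i i = 0"
proof (induction h)
  case (Suc h)
  then show ?case using dst_le_dst[of h i i] by linarith
qed (simp add: W_self)

text \<open>A walk on \<open>h + 2\<close> vertices makes \<open>h + 1\<close> steps, which is what
  layer \<open>h\<close> covers: layer 0 is already a single step.\<close>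

lemma dst_le_step_sum_short:
  "w \<noteq> [] \<Longrightarrow> set w \<subseteq> {..<N} \<Longrightarrow> length w \<le> h + 2 \<Longrightarrow> dst h (hd w) (last w) \<le> step_sum W w"
proof (induction w arbitrary: h rule: induct_list012)
  case (3 x y w)
  show ?case
  proof (cases h)
    case 0
    then show ?thesis using 3 by simp
  next
    case (Suc g)
    have "dst g (hd (y # w)) (last (y # w)) \<le> step_sum W (y # w)"
      using 3 Suc by (intro 3) auto
    moreover have "y < N" using 3 by simp
    ultimately show ?thesis using dst_le_W[of y g x "last (y # w)"] Suc by simp
  qed
qed (auto simp: dst_self)

text \<open>Repetitions are cut out; a walk with distinct vertices among \<open>0, ..., n\<close>
  has at most \<open>n + 1\<close> of them, so layer \<open>n\<close> is deep enough.\<close>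

lemma dst_le_step_sum:
  assumes "w \<noteq> []" "set w \<subseteq> {..<N}"
  shows "dst n (hd w) (last w) \<le> step_sum W w"
proof -
  obtain v where v: "v \<noteq> []" "distinct v" "hd v = hd w" "last v = last w" "set v \<subseteq> set w"
    "step_sum W v \<le> step_sum W w"
    using ex_distinct_walk[of w "\<lambda>_ _. True" W] assms(1) by (auto simp: successively_conv_nth)
  have "length v = card (set v)" using v(2) by (simp add: distinct_card)
  also have "\<dots> \<le> card {..<N}" using v(5) assms(2) by (intro card_mono) auto
  finally have "dst n (hd v) (last v) \<le> step_sum W v"
    using v assms(2) by (intro dst_le_step_sum_short) auto
  with v show ?thesis by simp
qed

text \<open>\<open>dst n\<close> is at once the length of a route and a lower bound for all walks.
  Joining two routes therefore gives the triangle inequality, and reversing one gives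
  symmetry.\<close>

lemma dst_triangle:
  assumes "i < N" "j < N" "k < N"
  shows "dst n i k \<le> dst n i j + dst n j k"
proof -
  let ?w = "(i # route n i j) @ tl (j # route n j k)"
  have "dst n (hd ?w) (last ?w) \<le> step_sum W ?w"
    using assms route_less by (intro dst_le_step_sum) auto
  moreover have "hd ?w = i" by simp
  moreover have "last ?w = k"
    using last_route[of i n j] last_route[of j n k] by (cases "route n j k") auto
  moreover have "step_sum W ?w = dst n i j + dst n j k"
    using last_route[of i n j] by (subst step_sum_join) (auto simp: step_sum_route)
  ultimately show ?thesis by simp
qed

lemma dst_sym_le:
  assumes "i < N" "j < N"
  shows "dst n i j \<le> dst n j i"
proof -
  let ?w = "rev (j # route n j i)"
  have "dst n (hd ?w) (last ?w) \<le> step_sum W ?w"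
    using assms route_less[of j i n] by (intro dst_le_step_sum) auto
  moreover have "hd ?w = i" unfolding hd_rev by (rule last_route)
  moreover have "step_sum W ?w = dst n j i"
    unfolding step_sum_rev[of W, OF W_sym] by (rule step_sum_route)
  ultimately show ?thesis by simp
qed

lemma dst_sym: "i < N \<Longrightarrow> j < N \<Longrightarrow> dst n i j = dst n j i"
  by (intro antisym dst_sym_le)

section \<open>Order of the clients and their periods\<close>

lemma keys_eq: "keys t j = (if j \<in> ord ` {..t} then big else \<tau> j)"
proof (induction t arbitrary: j)
  case (Suc t)
  have "{..Suc t} = insert (Suc t) {..t}" by auto
  then show ?case using Suc by simp
qed simp

text \<open>The \<open>t + 1\<close> vertices chosen so far cannot exhaust \<open>0, ..., n\<close>,
  so some key is below \<open>big\<close> and the minimiser has not been chosen before. It is not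
  the depot, which counts as chosen at index 0.\<close>

lemma ord_Suc:
  assumes "t < n"
  shows "ord (Suc t) \<in> {1..n} - ord ` {..t}"
    and "j \<in> {1..n} - ord ` {..t} \<Longrightarrow> \<tau> (ord (Suc t)) \<le> \<tau> j"
proof -
  let ?m = "ord (Suc t)"
  have le: "keys t ?m \<le> keys t j" if "j < N" for j
    using scan_le[of j "[0..<N]" "keys t" 0] that by simp
  have in_N: "?m < N" using scan_in[of "keys t" 0 "[0..<N]"] by auto
  have "card (ord ` {..t}) \<le> Suc t" using card_image_le[of "{..t}" ord] by simp
  then have "\<not> {..n} \<subseteq> ord ` {..t}"
    using assms card_mono[of "ord ` {..t}" "{..n}"] by auto
  then obtain i where i: "i \<le> n" "i \<notin> ord ` {..t}" by blast
  have "0 = ord 0" by simp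
  then have 0: "0 \<in> ord ` {..t}" by blast
  have "i \<noteq> 0" using i 0 by auto
  then have "keys t i < big" using i big[of i] by (simp add: keys_eq)
  then have "keys t ?m < big" using le[of i] i by simp
  then have m: "?m \<notin> ord ` {..t}" unfolding keys_eq by (auto split: if_splits)
  then show "?m \<in> {1..n} - ord ` {..t}" using in_N 0 by (cases "?m = 0") auto
  show "\<tau> ?m \<le> \<tau> j" if "j \<in> {1..n} - ord ` {..t}"
    using le[of j] that m by (simp add: keys_eq)
qed

lemma ord_in: "1 \<le> t \<Longrightarrow> t \<le> n \<Longrightarrow> ord t \<in> {1..n}"
  using ord_Suc(1)[of "t - 1"] by simp

lemma ord_less: "t \<le> n \<Longrightarrow> ord t < N"
  using ord_in[of t] by (cases "t = 0") auto

lemma ord_neq: "s < t \<Longrightarrow> t \<le> n \<Longrightarrow> ord s \<noteq> ord t"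
proof -
  assume *: "s < t" "t \<le> n"
  then obtain u where u: "t = Suc u" by (cases t) auto
  then have "ord t \<notin> ord ` {..u}" using ord_Suc(1)[of u] * by simp
  moreover have "ord s \<in> ord ` {..u}" using u * by auto
  ultimately show ?thesis by metis
qed

lemma inj_on_ord: "inj_on ord {..n}"
  by (rule linorder_inj_onI) (use ord_neq in auto)

lemma bij_betw_ord: "bij_betw ord {1..n} {1..n}"
proof -
  have inj: "inj_on ord {1..n}" by (rule inj_on_subset[OF inj_on_ord]) auto
  moreover have "ord ` {1..n} = {1..n}"
    using inj ord_in by (intro card_subset_eq) (auto simp: card_image)
  ultimately show ?thesis by (simp add: bij_betw_def)
qed

lemma \<tau>_ord_mono:
  assumes "1 \<le> s" "s \<le> t" "t \<le> n"
  shows "\<tau> (ord s) \<le> \<tau> (ord t)"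
proof (cases "s = t")
  case False
  have "ord t \<notin> ord ` {..s - 1}"
  proof
    assume "ord t \<in> ord ` {..s - 1}"
    then obtain x where "x \<le> s - 1" "ord t = ord x" by auto
    moreover have "x < t" using \<open>x \<le> s - 1\<close> assms by linarith
    ultimately show False using ord_neq[of x t] assms by simp
  qed
  then show ?thesis using ord_Suc(2)[of "s - 1" "ord t"] ord_in[of t] assms by simp
qed simp

text \<open>The current period is at most the current turnover time and hence at most the next one,
  so the quotient in \<open>per\<close> is at least 1. The remainder lost is less than the old
  period and thus less than the new one, whence the factor 2.\<close>

lemma per_bounds: "t < n \<Longrightarrow>
   per (Suc t) \<ge> 1 \<and> per (Suc t) \<le> \<tau> (ord (Suc t)) \<and> \<tau> (ord (Suc t)) < 2 * per (Suc t)"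
proof (induction t)
  case 0
  then show ?case using \<tau>_pos[OF ord_in[of 1]] by simp
next
  case (Suc t)
  let ?p = "per (Suc t)" and ?x = "\<tau> (ord (Suc (Suc t)))"
  have p: "?p \<ge> 1" using Suc by simp
  have "?p \<le> \<tau> (ord (Suc t))" using Suc by simp
  also have "\<dots> \<le> ?x" using Suc.prems by (intro \<tau>_ord_mono) auto
  finally have q: "?x div ?p \<ge> 1" using p by (simp add: Suc_le_eq div_greater_zero_iff)
  have "?x mod ?p < ?p" using p by simp
  moreover have "?p * 1 \<le> ?p * (?x div ?p)" using q by (intro mult_left_mono) auto
  moreover have "?x = ?p * (?x div ?p) + ?x mod ?p" by simp
  moreover have "per (Suc (Suc t)) = ?p * (?x div ?p)" by simp
  ultimately show ?case using p by linarith
qed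

lemma per_bounds_ord:
  assumes "t \<in> {1..n}"
  shows "per t \<ge> 1" "per t \<le> \<tau> (ord t)" "\<tau> (ord t) < 2 * per t"
proof -
  obtain s where s: "t = Suc s" "s < n" using assms by (cases t) auto
  show "per t \<ge> 1" "per t \<le> \<tau> (ord t)" "\<tau> (ord t) < 2 * per t"
    unfolding s(1) using per_bounds[OF s(2)] by (simp_all only:)
qed

lemma per_pos: "t \<le> n \<Longrightarrow> per t \<ge> 1"
  using per_bounds[of "t - 1"] by (cases t) auto

lemma per_dvd: "s \<le> t \<Longrightarrow> per s dvd per t"
  by (induction rule: dec_induct) auto

text \<open>If \<open>per t\<close> divides \<open>k\<close>, so does every earlier period. The due
  indices are thus closed downwards, and an initial segment is determined by its
  cardinality.\<close>

lemma per_dvd_iff: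
  assumes "t \<in> {1..n}"
  shows "per t dvd k \<longleftrightarrow> t \<le> cnt k"
proof -
  define S where "S = {t \<in> {1..n}. per t dvd k}"
  have "\<exists>m. S = {1..m}"
  proof (cases "S = {}")
    case True
    then show ?thesis by (intro exI[of _ 0]) simp
  next
    case False
    have fin: "finite S" by (simp add: S_def)
    have "{1..Max S} \<subseteq> S"
    proof
      fix t assume t: "t \<in> {1..Max S}"
      have "Max S \<in> S" using fin False by (rule Max_in)
      then show "t \<in> S" using t dvd_trans[OF per_dvd[of t "Max S"], of k] by (auto simp: S_def)
    qed
    moreover have "S \<subseteq> {1..Max S}" using Max_ge[OF fin] by (auto simp: S_def)
    ultimately show ?thesis by blast
  qed
  then obtain m where m: "S = {1..m}" by blast
  then have "cnt k = m" by (simp add: cnt_def S_def)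
  moreover have "per t dvd k \<longleftrightarrow> t \<in> S" using assms by (simp add: S_def)
  ultimately show ?thesis using m assms by simp
qed

lemma cnt_le: "cnt k \<le> n"
proof -
  have "cnt k \<le> card {1..n}" unfolding cnt_def by (intro card_mono) auto
  then show ?thesis by simp
qed

lemma cnt_add_per: "cnt (k + per n) = cnt k"
proof -
  have "per t dvd k + per n \<longleftrightarrow> per t dvd k" if "t \<in> {1..n}" for t
    using per_dvd[of t n] that by (simp add: dvd_add_left_iff)
  then show ?thesis unfolding cnt_def by (metis (mono_tags, lifting) Collect_cong)
qed

section \<open>The greedy cycle and the tours\<close>

definition \<delta> :: "nat \<Rightarrow> nat" where
  "\<delta> t = dst n (par t) (ord t)"

lemma par_earlier: "1 \<le> t \<Longrightarrow> t \<le> n \<Longrightarrow> par t \<in> ord ` {..<t}"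
proof -
  assume t: "1 \<le> t"
  have "0 = ord 0" by simp
  then have "0 \<in> ord ` {..<t}" using t by (intro image_eqI[of _ _ 0]) auto
  then show ?thesis by (auto simp: par_def earlier_def)
qed

lemma \<delta>_le: "s < t \<Longrightarrow> t \<le> n \<Longrightarrow> \<delta> t \<le> dst n (ord s) (ord t)"
  using scan_le[of s "[0..<N]" "\<lambda>x. dst n (earlier t x) (ord t)" 0]
  by (simp add: \<delta>_def par_def earlier_def)

lemma cyc_props: "t \<le> n \<Longrightarrow> set (cyc t) = ord ` {..t} \<and> distinct (cyc t) \<and> cyc t \<noteq> [] \<and>
   hd (cyc t) = 0 \<and> length (cyc t) = Suc t"
proof (induction t)
  case (Suc t)
  have p: "par (Suc t) \<in> set (cyc t)" using par_earlier[of "Suc t"] Suc by (simp add: lessThan_Suc_atMost)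
  have "ord (Suc t) \<notin> set (cyc t)" using ord_Suc(1)[of t] Suc by simp
  then show ?case
    using Suc p insert_after_nonempty[of "cyc t"]
    by (auto simp: set_insert_after distinct_insert_after length_insert_after atMost_Suc simp del: ord.simps)
qed simp

lemma cyc_cost: "t \<le> n \<Longrightarrow> step_sum (dst n) (cyc t @ [0]) \<le> 2 * (\<Sum>s=1..t. \<delta> s)"
proof (induction t)
  case 0
  then show ?case by (simp add: dst_self)
next
  case (Suc t)
  have "step_sum (dst n) (cyc (Suc t) @ [0]) \<le> step_sum (dst n) (cyc t @ [0]) + 2 * dst n (par (Suc t)) (ord (Suc t))"
    unfolding cyc.simps
  proof (rule step_sum_insert_after[where V = "{..<N}"])
    show "set (cyc t) \<subseteq> {..<N}" using cyc_props[of t] Suc ord_less by auto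
    show "par (Suc t) \<in> {..<N}" using par_earlier[of "Suc t"] Suc ord_less by auto
    show "ord (Suc t) \<in> {..<N}" using ord_less Suc by blast
  qed (use dst_triangle dst_sym in auto)
  then show ?case using Suc by (simp add: \<delta>_def)
qed

lemma linked_cyc_step:
  assumes "t < n" "linked nx (cyc t @ [0])"
  shows "linked (nx(ord (Suc t) := nx (par (Suc t)), par (Suc t) := ord (Suc t))) (cyc (Suc t) @ [0])"
  unfolding cyc.simps
  using assms cyc_props[of t] par_earlier[of "Suc t"] ord_Suc(1)[of t]
  by (intro linked_insert_after) (auto simp: lessThan_Suc_atMost simp del: ord.simps)

text \<open>A route omits its start and ends at its target, so replacing each step by a route
  preserves cost and still passes every vertex of the list. Hence the cycle can be built as if the
  graph were complete.\<close>

lemma expand_props: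
  assumes "xs \<noteq> []" "set xs \<subseteq> {..<N}"
  shows "step_sum W (hd xs # expand xs) = step_sum (dst n) xs \<and>
    last (hd xs # expand xs) = last xs \<and> set xs \<subseteq> set (hd xs # expand xs) \<and>
    set (expand xs) \<subseteq> {..<N}"
  using assms
proof (induction xs rule: expand.induct)
  case (1 x y xs)
  let ?r = "route n x y" and ?e = "expand (y # xs)"
  have IH: "step_sum W (y # ?e) = step_sum (dst n) (y # xs)" "last (y # ?e) = last (y # xs)"
    "set (y # xs) \<subseteq> set (y # ?e)" "set ?e \<subseteq> {..<N}"
    using 1 by auto
  have l: "last (x # ?r) = y" by (rule last_route)
  have y: "y \<in> set (x # ?r)" using l last_in_set[of "x # ?r"] by simp
  have e: "hd (x # y # xs) # expand (x # y # xs) = (x # ?r) @ ?e" by simp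
  have "step_sum W ((x # ?r) @ tl (y # ?e)) = step_sum W (x # ?r) + step_sum W (y # ?e)"
    using l by (intro step_sum_join) auto
  then have "step_sum W ((x # ?r) @ ?e) = step_sum (dst n) (x # y # xs)"
    using IH(1) by (simp add: step_sum_route)
  moreover have "last ((x # ?r) @ ?e) = last (x # y # xs)"
    using l IH(2) by (cases "?e = []") auto
  moreover have "set (x # y # xs) \<subseteq> set ((x # ?r) @ ?e)" using IH(3) y by auto
  moreover have "set (expand (x # y # xs)) \<subseteq> {..<N}" using IH(4) route_less[of x y n] 1 by auto
  ultimately show ?case unfolding e by blast
qed auto

lemma successively_expand:
  assumes P: "\<And>x y. x < N \<Longrightarrow> y < N \<Longrightarrow> successively P (x # route n x y)"
    and "xs \<noteq> []" "set xs \<subseteq> {..<N}"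
  shows "successively P (hd xs # expand xs)"
  using assms(2,3)
proof (induction xs rule: expand.induct)
  case (1 x y xs)
  let ?r = "route n x y" and ?e = "expand (y # xs)"
  have "successively P (y # ?e)" "successively P (x # ?r)" using 1 P[of x y] by auto
  then have "successively P ((x # ?r) @ ?e)"
    unfolding successively_append_iff
    using last_route[of x n y] by (cases ?e) (auto simp del: last.simps)
  then show ?case by simp
qed auto

lemma successively_tour:
  assumes "\<And>x y. x < N \<Longrightarrow> y < N \<Longrightarrow> successively P (x # route n x y)"
  shows "successively P (tour k)"
proof -
  let ?c = "cyc (cnt k) @ [0]"
  have c: "set (cyc (cnt k)) = ord ` {..cnt k}" "hd ?c = 0" using cyc_props[OF cnt_le, of k] by auto
  have "set ?c \<subseteq> {..<N}" using c ord_less cnt_le[of k] by auto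
  with successively_expand[of P ?c] assms show ?thesis unfolding tour_def c(2) by blast
qed

lemma tour_props:
  shows "hd (tour k) = 0" "last (tour k) = 0" "tour k \<noteq> []" "set (tour k) \<subseteq> {..<N}"
    and "set (visited k) \<subseteq> set (tour k)"
    and "step_sum W (tour k) \<le> 2 * (\<Sum>t=1..cnt k. \<delta> t)"
proof -
  let ?c = "cyc (cnt k) @ [0]"
  have c: "set (cyc (cnt k)) = ord ` {..cnt k}" "hd ?c = 0" using cyc_props[OF cnt_le, of k] by auto
  have N: "set ?c \<subseteq> {..<N}" using c ord_less cnt_le[of k] by auto
  note p = expand_props[of ?c, OF _ N, unfolded c(2), folded tour_def]
  have "step_sum W (tour k) = step_sum (dst n) ?c" using p by auto
  also have "\<dots> \<le> 2 * (\<Sum>t=1..cnt k. \<delta> t)" by (rule cyc_cost[OF cnt_le])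
  finally show "step_sum W (tour k) \<le> 2 * (\<Sum>t=1..cnt k. \<delta> t)" .
  show "last (tour k) = 0" using p by auto
  show "hd (tour k) = 0" "tour k \<noteq> []" by (auto simp: tour_def)
  show "set (tour k) \<subseteq> {..<N}" using p by (auto simp: tour_def)
  have "set (visited k) \<subseteq> set ?c" unfolding visited_def using c(1) by (auto simp: image_iff)
  then show "set (visited k) \<subseteq> set (tour k)" using p by blast
qed

lemma visited_iff: "t \<in> {1..n} \<Longrightarrow> ord t \<in> set (visited k) \<longleftrightarrow> per t dvd k"
proof -
  assume t: "t \<in> {1..n}"
  have "{1..<Suc (cnt k)} \<subseteq> {..n}" using cnt_le[of k] by auto
  then have "ord t \<in> ord ` {1..<Suc (cnt k)} \<longleftrightarrow> t \<in> {1..<Suc (cnt k)}"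
    using t by (intro inj_on_image_mem_iff[OF inj_on_ord]) auto
  then show ?thesis using t by (auto simp: per_dvd_iff visited_def)
qed

lemma set_visited: "set (visited k) \<subseteq> {1..n}"
  unfolding visited_def using ord_in cnt_le[of k] by fastforce

end

section \<open>The algorithm as a program\<close>

text \<open>The invariant must be insensitive to the counter array, which the loop writes before
  each round and after the last one. The step may assume that arrays outside the body's writes are
  still as in \<open>s\<close>, so the invariant need only speak about those that change.\<close>

lemma sem_For_inv:
  assumes "aval e s = M" "I 0 s"
    and step: "\<And>i s'. i < M \<Longrightarrow> I i s' \<Longrightarrow> s' x 0 = i \<Longrightarrow>
      (\<forall>y. y \<notin> insert x (mods p) \<longrightarrow> s' y = s y) \<Longrightarrow> I (Suc i) (sem p s')"
    and upd: "\<And>i s' v. I i s' \<Longrightarrow> I i (s'(x := v))"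
  shows "I M (sem (PFor x e p) s)"
proof -
  let ?F = "\<lambda>i s. sem p (s(x := (s x)(0 := i)))"
  have "i \<le> M \<Longrightarrow> I i (fold ?F [0..<i] s) \<and>
    (\<forall>y. y \<notin> insert x (mods p) \<longrightarrow> fold ?F [0..<i] s y = s y)" for i
  proof (induction i)
    case (Suc i)
    let ?s = "fold ?F [0..<i] s"
    let ?t = "?s(x := (?s x)(0 := i))"
    have IH: "I i ?s" "\<forall>y. y \<notin> insert x (mods p) \<longrightarrow> ?s y = s y"
      using Suc.IH Suc.prems by (blast dest: Suc_leD)+
    from IH(1) have "I i ?t" by (rule upd)
    moreover have fr: "\<forall>y. y \<notin> insert x (mods p) \<longrightarrow> ?t y = s y" using IH(2) by simp
    ultimately have fin: "I (Suc i) (sem p ?t)" using Suc.prems by (intro step) auto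
    have eq: "fold ?F [0..<Suc i] s = sem p ?t" by (simp add: upt_Suc_append)
    show ?case
      unfolding eq
    proof (intro conjI allI impI fin)
      fix y assume y: "y \<notin> insert x (mods p)"
      then have "sem p ?t y = ?t y" by (intro sem_unmodified) blast
      also have "\<dots> = s y" using fr y by blast
      finally show "sem p ?t y = s y" .
    qed
  qed (use assms in auto)
  then show ?thesis using assms(1) upd by (simp add: Let_def)
qed

lemma all_less_Suc_row:
  "\<forall>i'<i. \<forall>j\<le>n. P i' j \<Longrightarrow> \<forall>j<Suc n. P i j \<Longrightarrow> \<forall>i'<Suc i. \<forall>j\<le>n. P i' j"
  by (simp add: less_Suc_eq_le le_less[of _ i])

lemma all_le_Suc_layer:
  "\<forall>h'\<le>h. \<forall>i\<le>n. \<forall>j\<le>n. P h' i j \<Longrightarrow> \<forall>i<Suc n. \<forall>j\<le>n. P (Suc h) i j \<Longrightarrow>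
    \<forall>h'\<le>Suc h. \<forall>i\<le>n. \<forall>j\<le>n. P h' i j"
  by (simp add: less_Suc_eq_le le_Suc_eq)

text \<open>\<open>f\<close> is an expression with a hole for the index, filled once with the best
  candidate \<open>y\<close> and once with the counter \<open>x\<close>.\<close>

definition argmin_prog :: "string \<Rightarrow> string \<Rightarrow> exp \<Rightarrow> exp \<Rightarrow> (exp \<Rightarrow> exp) \<Rightarrow> prog" where
  "argmin_prog y x bound init f =
     PSeq (PAssign y (Num 0) init)
       (PFor x bound
         (PIf (Minus (f (Get y (Num 0))) (f (Get x (Num 0)))) (PAssign y (Num 0) (Get x (Num 0))) PSkip))"

lemma mods_argmin_prog: "mods (argmin_prog y x bound init f) = {x, y}"
  by (auto simp: argmin_prog_def)

lemma sem_argmin_prog: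
  assumes "y \<noteq> x" and bound: "\<And>v. aval bound (s(y := v)) = M"
    and f: "\<And>s' z. (\<forall>w. w \<notin> {x, y} \<longrightarrow> s' w = s w) \<Longrightarrow> z \<in> {x, y} \<Longrightarrow>
      s' z 0 \<in> insert (aval init s) {..<M} \<Longrightarrow> aval (f (Get z (Num 0))) s' = F (s' z 0)"
  shows "sem (argmin_prog y x bound init f) s y 0 = scan F (aval init s) [0..<M]"
proof -
  let ?a = "aval init s"
  let ?s0 = "s(y := (s y)(0 := ?a))"
  let ?b = "PIf (Minus (f (Get y (Num 0))) (f (Get x (Num 0)))) (PAssign y (Num 0) (Get x (Num 0))) PSkip"
  let ?I = "\<lambda>i s'. s' y 0 = scan F ?a [0..<i]"
  have "?I M (sem (PFor x bound ?b) ?s0)"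
  proof (rule sem_For_inv[where I = ?I])
    show "aval bound ?s0 = M" by (rule bound)
    show "?I 0 ?s0" by (simp add: scan_def)
    fix i s' assume i: "i < M" "?I i s'" "s' x 0 = i" and
      fr: "\<forall>w. w \<notin> insert x (mods ?b) \<longrightarrow> s' w = ?s0 w"
    have fr': "\<forall>w. w \<notin> {x, y} \<longrightarrow> s' w = s w" using fr by simp
    have "s' y 0 \<in> insert ?a (set [0..<i])" using scan_in[of F ?a "[0..<i]"] i by simp
    then have "aval (f (Get y (Num 0))) s' = F (s' y 0)"
      using i by (intro f fr') auto
    moreover have "aval (f (Get x (Num 0))) s' = F (s' x 0)" using i by (intro f fr') auto
    ultimately show "?I (Suc i) (sem ?b s')"
      using i by (auto simp: scan_def upt_Suc_append)
  qed (use assms(1) in auto)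
  then show ?thesis by (simp add: argmin_prog_def)
qed

text \<open>A common denominator, though not the least one: it takes only multiplications by input
  numbers, and its length is at most the sum of the lengths of the denominators.\<close>

definition scale :: "(nat \<times> nat \<times> nat \<times> nat) list \<Rightarrow> nat" where
  "scale es = prod_list (map (\<lambda>(u, v, a, b). b) es)"

definition scaled_weight :: "nat \<Rightarrow> nat \<times> nat \<times> nat \<times> nat \<Rightarrow> nat" where
  "scaled_weight q = (\<lambda>(u, v, a, b). q div b * a)"

text \<open>Exceeds \<open>Suc n\<close> times the scaled weight of every edge, hence the length of
  any walk along edges that repeats no vertex.\<close>

definition no_edge :: "nat \<Rightarrow> (nat \<times> nat \<times> nat \<times> nat) list \<Rightarrow> nat" where
  "no_edge n es = Suc (sum_list (map (\<lambda>e. scaled_weight (scale es) e * Suc n) es))"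

definition put_edge ::
    "nat \<Rightarrow> nat \<times> nat \<times> nat \<times> nat \<Rightarrow> (nat \<Rightarrow> nat \<Rightarrow> nat) \<Rightarrow> nat \<Rightarrow> nat \<Rightarrow> nat" where
  "put_edge q = (\<lambda>(u, v, a, b) M i j. if (i, j) \<in> {(u, v), (v, u)} then q div b * a else M i j)"

text \<open>A fold over the edge list, so that the state after any number of rounds of the filling
  loop is described by the same fold over an initial part.\<close>

definition edge_matrix :: "nat \<Rightarrow> (nat \<times> nat \<times> nat \<times> nat) list \<Rightarrow> nat \<Rightarrow> nat \<Rightarrow> nat" where
  "edge_matrix n es =
     fold (put_edge (scale es)) es (\<lambda>i j. if i = j then 0 else no_edge n es)"

abbreviation V :: "string \<Rightarrow> exp" where
  "V x \<equiv> Get x (Num 0)"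

abbreviation assign_var :: "string \<Rightarrow> exp \<Rightarrow> prog" (infix "::=" 62) where
  "x ::= e \<equiv> PAssign x (Num 0) e"

abbreviation seq_prog :: "prog \<Rightarrow> prog \<Rightarrow> prog" (infixr ";;" 60) where
  "p ;; q \<equiv> PSeq p q"

text \<open>Layout of the input: cell 0 holds the day, cell 1 the number \<open>n\<close> of
  clients, cells 2 to \<open>n + 1\<close> the turnover times, cell \<open>n + 2\<close> the number
  of edges; from \<open>n + 3\<close> on, each edge takes four cells.\<close>

definition kE :: exp where "kE = Get ''in'' (Num 0)"
definition nE :: exp where "nE = Get ''in'' (Num 1)"
definition NE :: exp where "NE = Plus nE (Num 1)"
definition mE :: exp where "mE = Get ''in'' (Plus nE (Num 2))"
definition tauE :: "exp \<Rightarrow> exp" where "tauE j = Get ''in'' (Plus j (Num 1))"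
definition edgeE :: "nat \<Rightarrow> exp" where
  "edgeE c = Get ''in'' (Plus (Plus nE (Num (3 + c))) (Times (V ''e'') (Num 4)))"
text \<open>Layer, row and column are digits in base \<open>N\<close>. The factor \<open>NE\<close>
  is \<open>input_sized\<close>, which keeps the address tame.\<close>

definition idxE :: "exp \<Rightarrow> exp \<Rightarrow> exp \<Rightarrow> exp" where
  "idxE h i j = Plus (Times (Plus (Times h NE) i) NE) j"
definition unequalE :: "exp \<Rightarrow> exp \<Rightarrow> exp" where
  "unequalE e f = Plus (Minus e f) (Minus f e)"

abbreviation dstE :: "exp \<Rightarrow> exp \<Rightarrow> exp \<Rightarrow> exp" where
  "dstE h i j \<equiv> Get ''D'' (idxE h i j)"

definition scale_prog :: prog where
  "scale_prog =
     ''q'' ::= Num 1 ;;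
     PFor ''e'' mE (''q'' ::= Times (V ''q'') (edgeE 3)) ;;
     ''inf'' ::= Num 1 ;;
     PFor ''e'' mE
       (''inf'' ::= Plus (V ''inf'') (Times (Times (Div (V ''q'') (edgeE 3)) (edgeE 2)) NE))"

definition matrix_prog :: prog where
  "matrix_prog =
     PFor ''i'' NE (PFor ''j'' NE
       (PAssign ''H'' (idxE (Num 0) (V ''i'') (V ''j'')) (V ''j'') ;;
        PIf (unequalE (V ''i'') (V ''j''))
          (PAssign ''D'' (idxE (Num 0) (V ''i'') (V ''j'')) (V ''inf''))
          (PAssign ''D'' (idxE (Num 0) (V ''i'') (V ''j'')) (Num 0)))) ;;
     PFor ''e'' mE
       (PAssign ''D'' (idxE (Num 0) (edgeE 0) (edgeE 1)) (Times (Div (V ''q'') (edgeE 3)) (edgeE 2)) ;;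
        PAssign ''D'' (idxE (Num 0) (edgeE 1) (edgeE 0)) (Times (Div (V ''q'') (edgeE 3)) (edgeE 2)))"

definition relax_prog :: prog where
  "relax_prog =
     argmin_prog ''g'' ''x'' NE (V ''i'')
       (\<lambda>x. Plus (dstE (Num 0) (V ''i'') x) (dstE (V ''h'') x (V ''j''))) ;;
     PAssign ''H'' (idxE (Plus (V ''h'') (Num 1)) (V ''i'') (V ''j'')) (V ''g'') ;;
     PAssign ''D'' (idxE (Plus (V ''h'') (Num 1)) (V ''i'') (V ''j''))
       (Plus (dstE (Num 0) (V ''i'') (V ''g'')) (dstE (V ''h'') (V ''g'') (V ''j'')))"

definition distance_prog :: prog where
  "distance_prog = PFor ''h'' nE (PFor ''i'' NE (PFor ''j'' NE relax_prog))"

text \<open>The assignment of \<open>''big''\<close> to \<open>''key''\<close> hits cell 0 and bars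
  the depot from selection. Cell 0 of \<open>''ord''\<close> is never written; its initial 0 is the
  depot.\<close>

definition order_prog :: prog where
  "order_prog =
     ''big'' ::= Num 1 ;;
     PFor ''j'' nE
       (PAssign ''key'' (Plus (V ''j'') (Num 1)) (tauE (Plus (V ''j'') (Num 1))) ;;
        ''big'' ::= Plus (V ''big'') (tauE (Plus (V ''j'') (Num 1)))) ;;
     ''key'' ::= V ''big'' ;;
     ''p'' ::= Num 1 ;;
     PFor ''t'' nE
       (argmin_prog ''g'' ''x'' NE (Num 0) (Get ''key'') ;;
        PAssign ''key'' (V ''g'') (V ''big'') ;;
        ''p'' ::= Times (V ''p'') (Div (tauE (V ''g'')) (V ''p'')) ;;
        PAssign ''per'' (Plus (V ''t'') (Num 1)) (V ''p'') ;;
        argmin_prog ''y'' ''x'' NE (Num 0) (\<lambda>x. dstE nE (Get ''ord'' x) (V ''g'')) ;;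
        PAssign ''par'' (Plus (V ''t'') (Num 1)) (Get ''ord'' (V ''y'')) ;;
        PAssign ''ord'' (Plus (V ''t'') (Num 1)) (V ''g''))"

text \<open>The test computes \<open>k mod per\<close> by a subtraction whose product
  \<open>per * (k div per)\<close> is tame. \<open>''nx''\<close> needs no initialisation: all zeros
  describe the cycle of the depot alone.\<close>

definition cycle_prog :: prog where
  "cycle_prog =
     PFor ''t'' nE
       (PIf (Minus kE (Times (Get ''per'' (Plus (V ''t'') (Num 1)))
                         (Div kE (Get ''per'' (Plus (V ''t'') (Num 1))))))
          PSkip
          (PAssign ''nx'' (Get ''ord'' (Plus (V ''t'') (Num 1)))
             (Get ''nx'' (Get ''par'' (Plus (V ''t'') (Num 1)))) ;;
           PAssign ''nx'' (Get ''par'' (Plus (V ''t'') (Num 1)))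
             (Get ''ord'' (Plus (V ''t'') (Num 1))) ;;
           ''cnt'' ::= Plus (V ''cnt'') (Num 1)))"

text \<open>Round \<open>r\<close> consults layer \<open>n - r\<close> of the hops, down to layer 0.
  The offset 2 reserves cells 0 and 1 of \<open>''out''\<close> for the period and the length of the
  tour.\<close>

definition route_prog :: prog where
  "route_prog =
     PFor ''r'' NE
       (''x'' ::= Get ''H'' (idxE (Minus nE (V ''r'')) (V ''u'') (V ''v'')) ;;
        PIf (unequalE (V ''x'') (V ''u''))
          (PAssign ''out'' (Plus (V ''len'') (Num 2)) (V ''x'') ;;
           ''len'' ::= Plus (V ''len'') (Num 1) ;;
           ''u'' ::= V ''x'')
          PSkip)"

text \<open>Loop bounds may read only the input, so the loops run for the maximal number of rounds
  and test against \<open>''cnt''\<close>. \<open>''len''\<close> starts at 1 because cell 2 already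
  holds 0, the depot at which the tour starts.\<close>

definition output_prog :: prog where
  "output_prog =
     ''out'' ::= V ''p'' ;;
     ''len'' ::= Num 1 ;;
     PFor ''t'' NE
       (PIf (Minus (Plus (V ''cnt'') (Num 1)) (V ''t''))
          (''v'' ::= Get ''nx'' (V ''u'') ;; route_prog)
          PSkip) ;;
     PAssign ''out'' (Num 1) (V ''len'') ;;
     PFor ''t'' nE
       (PIf (Minus (V ''cnt'') (V ''t''))
          (PAssign ''out'' (Plus (Plus (V ''len'') (Num 2)) (V ''t''))
             (Get ''ord'' (Plus (V ''t'') (Num 1))))
          PSkip) ;;
     ''outlen'' ::= Plus (Plus (V ''len'') (Num 2)) (V ''cnt'')"

definition solver_prog :: prog where
  "solver_prog = scale_prog ;; matrix_prog ;; distance_prog ;; order_prog ;; cycle_prog ;; output_prog"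

lemmas exp_defs = kE_def nE_def NE_def mE_def tauE_def edgeE_def idxE_def unequalE_def

lemmas prog_defs = solver_prog_def scale_prog_def matrix_prog_def distance_prog_def relax_prog_def
  order_prog_def cycle_prog_def route_prog_def output_prog_def

lemma wf_solver_prog: "wf_prog solver_prog"
  by (simp add: prog_defs argmin_prog_def exp_defs)

lemma bounds_solver_prog: "bounds solver_prog \<subseteq> {nE, NE, mE}"
  by (simp add: prog_defs argmin_prog_def)

lemma mult_add_eq_iff:
  fixes a b c d N :: nat
  assumes "b < N" "d < N"
  shows "a * N + b = c * N + d \<longleftrightarrow> a = c \<and> b = d"
proof
  assume "a * N + b = c * N + d"
  then have "(a * N + b) div N = (c * N + d) div N" "(a * N + b) mod N = (c * N + d) mod N" by simp_all
  then show "a = c \<and> b = d" using assms by simp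
qed simp

section \<open>Correctness of the phases of the program\<close>

definition key_bound :: "nat \<Rightarrow> (nat \<Rightarrow> nat) \<Rightarrow> nat" where
  "key_bound n \<tau> = Suc (sum \<tau> {1..n})"

locale solver_run = metric_greedy_scheme n "edge_matrix n es" \<tau> "key_bound n \<tau>"
  for n es \<tau> +
  fixes k :: nat and inp :: "nat \<Rightarrow> nat"
  assumes inp_k: "inp 0 = k" and inp_n: "inp (Suc 0) = n"
    and inp_\<tau>: "j \<in> {1..n} \<Longrightarrow> inp (Suc j) = \<tau> j"
    and inp_m: "inp (n + 2) = length es"
    and inp_edge: "e < length es \<Longrightarrow> es ! e = (u, v, a, b) \<Longrightarrow>
      inp (n + 3 + e * 4) = u \<and> inp (n + 4 + e * 4) = v \<and> inp (n + 5 + e * 4) = a \<and> inp (n + 6 + e * 4) = b"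
    and edge_le: "(u, v, a, b) \<in> set es \<Longrightarrow> u \<le> n \<and> v \<le> n"
begin

definition idx :: "nat \<Rightarrow> nat \<Rightarrow> nat \<Rightarrow> nat" where
  "idx h i j = (h * N + i) * N + j"

lemma idx_eq_iff:
  assumes "i \<le> n" "j \<le> n" "i' \<le> n" "j' \<le> n"
  shows "idx h i j = idx h' i' j' \<longleftrightarrow> h = h' \<and> i = i' \<and> j = j'"
proof -
  have "idx h i j = idx h' i' j' \<longleftrightarrow> h * N + i = h' * N + i' \<and> j = j'"
    unfolding idx_def using assms by (intro mult_add_eq_iff) auto
  also have "h * N + i = h' * N + i' \<longleftrightarrow> h = h' \<and> i = i'"
    using assms by (intro mult_add_eq_iff) auto
  finally show ?thesis by simp
qed

lemma aval_simps:
  assumes "s ''in'' = inp"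
  shows "aval kE s = k" "aval nE s = n" "aval NE s = N" "aval mE s = length es"
    and "aval (idxE x y z) s = idx (aval x s) (aval y s) (aval z s)"
    and "aval (tauE x) s = inp (Suc (aval x s))"
  using assms inp_k inp_n inp_m by (simp_all add: exp_defs idx_def)

lemma aval_unequal: "aval (unequalE x y) s = 0 \<longleftrightarrow> aval x s = aval y s"
  by (auto simp: unequalE_def)

lemma aval_edge:
  assumes "s ''in'' = inp" "s ''e'' 0 = e" "e < length es" "es ! e = (u, v, a, b)"
  shows "aval (edgeE 0) s = u" "aval (edgeE (Suc 0)) s = v" "aval (edgeE 2) s = a" "aval (edgeE 3) s = b"
  using inp_edge[OF assms(3,4)] assms(1,2) inp_n by (simp_all add: edgeE_def nE_def add_ac)

lemma sem_scale_prog: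
  assumes "s ''in'' = inp"
  shows "sem scale_prog s ''q'' 0 = scale es \<and> sem scale_prog s ''inf'' 0 = no_edge n es"
proof -
  let ?p = "''q'' ::= Times (V ''q'') (edgeE 3)"
  let ?r = "''inf'' ::= Plus (V ''inf'') (Times (Times (Div (V ''q'') (edgeE 3)) (edgeE 2)) NE)"
  define s1 where "s1 = sem (PFor ''e'' mE ?p) (sem (''q'' ::= Num 1) s)"
  define s2 where "s2 = sem (PFor ''e'' mE ?r) (sem (''inf'' ::= Num 1) s1)"
  have "s1 ''q'' 0 = scale (take (length es) es)"
    unfolding s1_def
  proof (rule sem_For_inv[where I = "\<lambda>e s. s ''q'' 0 = scale (take e es)"])
    fix e s' assume e: "e < length es" "s' ''q'' 0 = scale (take e es)" "s' ''e'' 0 = e"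
      "\<forall>y. y \<notin> insert ''e'' (mods ?p) \<longrightarrow> s' y = sem (''q'' ::= Num 1) s y"
    obtain u v a b where es: "es ! e = (u, v, a, b)" by (cases "es ! e")
    have "s' ''in'' = inp" using e(4) assms by simp
    from aval_edge[OF this e(3,1) es] e(2)
    show "sem ?p s' ''q'' 0 = scale (take (Suc e) es)"
      using e(1) es by (simp add: take_Suc_conv_app_nth scale_def)
  qed (use assms in \<open>auto simp: aval_simps scale_def\<close>)
  then have q: "s1 ''q'' 0 = scale es" by simp
  have in1: "s1 ''in'' = inp" unfolding s1_def using assms by (subst sem_unmodified) auto
  have "s2 ''inf'' 0 = Suc (sum_list (map (\<lambda>e. scaled_weight (scale es) e * Suc n) (take (length es) es)))"
    unfolding s2_def
  proof (rule sem_For_inv[where I = "\<lambda>i s. s ''inf'' 0 =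
      Suc (sum_list (map (\<lambda>e. scaled_weight (scale es) e * Suc n) (take i es)))"])
    fix e s' assume e: "e < length es" "s' ''inf'' 0 = Suc (sum_list (map (\<lambda>e. scaled_weight (scale es) e * Suc n) (take e es)))"
      "s' ''e'' 0 = e" "\<forall>y. y \<notin> insert ''e'' (mods ?r) \<longrightarrow> s' y = sem (''inf'' ::= Num 1) s1 y"
    obtain u v a b where es: "es ! e = (u, v, a, b)" by (cases "es ! e")
    have s': "s' ''in'' = inp" "s' ''q'' 0 = scale es" using e(4) in1 q by auto
    from aval_edge[OF this(1) e(3,1) es] e(2)
    show "sem ?r s' ''inf'' 0 =
        Suc (sum_list (map (\<lambda>e. scaled_weight (scale es) e * Suc n) (take (Suc e) es)))"
      using e(1) es s' by (simp add: take_Suc_conv_app_nth scaled_weight_def aval_simps)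
  qed (use in1 in \<open>auto simp: aval_simps\<close>)
  moreover have "s2 ''q'' 0 = scale es"
    unfolding s2_def using q by (subst sem_unmodified) auto
  moreover have "sem scale_prog s = s2" by (simp add: scale_prog_def s1_def s2_def)
  ultimately show ?thesis by (simp add: no_edge_def)
qed

lemma sem_matrix_prog:
  assumes "s ''in'' = inp" "s ''q'' 0 = scale es" "s ''inf'' 0 = no_edge n es" "i \<le> n" "j \<le> n"
  shows "sem matrix_prog s ''D'' (idx 0 i j) = edge_matrix n es i j \<and>
    sem matrix_prog s ''H'' (idx 0 i j) = j"
proof -
  let ?base = "\<lambda>i j. if i = j then 0 else no_edge n es"
  let ?ok = "\<lambda>i j (s::state). s ''D'' (idx 0 i j) = ?base i j \<and> s ''H'' (idx 0 i j) = j"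
  let ?b = "PAssign ''H'' (idxE (Num 0) (V ''i'') (V ''j'')) (V ''j'') ;;
        PIf (unequalE (V ''i'') (V ''j''))
          (PAssign ''D'' (idxE (Num 0) (V ''i'') (V ''j'')) (V ''inf''))
          (PAssign ''D'' (idxE (Num 0) (V ''i'') (V ''j'')) (Num 0))"
  let ?e = "PAssign ''D'' (idxE (Num 0) (edgeE 0) (edgeE 1)) (Times (Div (V ''q'') (edgeE 3)) (edgeE 2)) ;;
        PAssign ''D'' (idxE (Num 0) (edgeE 1) (edgeE 0)) (Times (Div (V ''q'') (edgeE 3)) (edgeE 2))"
  define s1 where "s1 = sem (PFor ''i'' NE (PFor ''j'' NE ?b)) s"
  define s2 where "s2 = sem (PFor ''e'' mE ?e) s1"
  have 1: "\<forall>i'<N. \<forall>j'\<le>n. ?ok i' j' s1"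
    unfolding s1_def
  proof (rule sem_For_inv[where I = "\<lambda>i s. \<forall>i'<i. \<forall>j'\<le>n. ?ok i' j' s"])
    fix i s' assume i: "i < N" "\<forall>i'<i. \<forall>j'\<le>n. ?ok i' j' s'" "s' ''i'' 0 = i"
      "\<forall>y. y \<notin> insert ''i'' (mods (PFor ''j'' NE ?b)) \<longrightarrow> s' y = s y"
    have s': "s' ''in'' = inp" "s' ''inf'' 0 = no_edge n es" using i(4) assms by auto
    have "(\<forall>i'<i. \<forall>j'\<le>n. ?ok i' j' (sem (PFor ''j'' NE ?b) s')) \<and>
      (\<forall>j'<N. ?ok i j' (sem (PFor ''j'' NE ?b) s'))"
    proof (rule sem_For_inv[where I = "\<lambda>j s. (\<forall>i'<i. \<forall>j'\<le>n. ?ok i' j' s) \<and> (\<forall>j'<j. ?ok i j' s)"])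
      fix j t assume j: "j < N" "(\<forall>i'<i. \<forall>j'\<le>n. ?ok i' j' t) \<and> (\<forall>j'<j. ?ok i j' t)" "t ''j'' 0 = j"
        "\<forall>y. y \<notin> insert ''j'' (mods ?b) \<longrightarrow> t y = s' y"
      have t: "t ''in'' = inp" "t ''inf'' 0 = no_edge n es" "t ''i'' 0 = i" using j(4) s' i(3) by auto
      have D: "sem ?b t ''D'' = (t ''D'')(idx 0 i j := ?base i j)"
        and H: "sem ?b t ''H'' = (t ''H'')(idx 0 i j := j)"
        using t j(3) by (auto simp: aval_simps aval_unequal)
      show "(\<forall>i'<i. \<forall>j'\<le>n. ?ok i' j' (sem ?b t)) \<and> (\<forall>j'<Suc j. ?ok i j' (sem ?b t))"
        unfolding D H using j(1,2) i(1) by (auto simp: idx_eq_iff less_Suc_eq)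
    qed (use i s' in \<open>auto simp: aval_simps\<close>)
    then show "\<forall>i'<Suc i. \<forall>j'\<le>n. ?ok i' j' (sem (PFor ''j'' NE ?b) s')"
      by (elim conjE) (rule all_less_Suc_row)
  qed (use assms in \<open>auto simp: aval_simps\<close>)
  have s1: "s1 ''in'' = inp" "s1 ''q'' 0 = scale es"
    unfolding s1_def using assms by (subst sem_unmodified; simp)+
  have "\<forall>i\<le>n. \<forall>j\<le>n. s2 ''D'' (idx 0 i j) = fold (put_edge (scale es)) (take (length es) es) ?base i j"
    unfolding s2_def
  proof (rule sem_For_inv[where I = "\<lambda>e s. \<forall>i\<le>n. \<forall>j\<le>n. s ''D'' (idx 0 i j) =
      fold (put_edge (scale es)) (take e es) ?base i j"])
    fix e s' assume e: "e < length es"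
      "\<forall>i\<le>n. \<forall>j\<le>n. s' ''D'' (idx 0 i j) = fold (put_edge (scale es)) (take e es) ?base i j"
      "s' ''e'' 0 = e" "\<forall>y. y \<notin> insert ''e'' (mods ?e) \<longrightarrow> s' y = s1 y"
    obtain u v a b where uv: "es ! e = (u, v, a, b)" by (cases "es ! e")
    have le: "u \<le> n" "v \<le> n" using edge_le[of u v a b] e(1) uv by (metis nth_mem)+
    have s': "s' ''in'' = inp" "s' ''q'' 0 = scale es" using e(4) s1 by auto
    note ev = aval_edge[OF _ _ e(1) uv]
    have D: "sem ?e s' ''D'' = (s' ''D'')(idx 0 u v := scale es div b * a, idx 0 v u := scale es div b * a)"
      using s' e(3) by (simp add: aval_simps ev)
    show "\<forall>i\<le>n. \<forall>j\<le>n. sem ?e s' ''D'' (idx 0 i j) =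
        fold (put_edge (scale es)) (take (Suc e) es) ?base i j"
    proof (intro allI impI)
      fix i j assume ij: "i \<le> n" "j \<le> n"
      let ?M = "fold (put_edge (scale es)) (take e es) ?base"
      have "fold (put_edge (scale es)) (take (Suc e) es) ?base = put_edge (scale es) (u, v, a, b) ?M"
        using e(1) uv by (simp add: take_Suc_conv_app_nth)
      moreover have "put_edge (scale es) (u, v, a, b) ?M i j =
          (if i = v \<and> j = u \<or> i = u \<and> j = v then scale es div b * a else ?M i j)"
        unfolding put_edge_def by auto
      moreover have "s' ''D'' (idx 0 i j) = ?M i j" using e(2) ij by blast
      moreover have "idx 0 i j = idx 0 v u \<longleftrightarrow> i = v \<and> j = u" "idx 0 i j = idx 0 u v \<longleftrightarrow> i = u \<and> j = v"
        using ij le by (simp_all add: idx_eq_iff)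
      moreover have "sem ?e s' ''D'' (idx 0 i j) =
          (if idx 0 i j = idx 0 v u \<or> idx 0 i j = idx 0 u v then scale es div b * a
           else s' ''D'' (idx 0 i j))"
        unfolding D by simp
      ultimately show "sem ?e s' ''D'' (idx 0 i j) =
          fold (put_edge (scale es)) (take (Suc e) es) ?base i j"
        by (simp only:)
    qed
  next
    show "\<forall>i\<le>n. \<forall>j\<le>n. s1 ''D'' (idx 0 i j) = fold (put_edge (scale es)) (take 0 es) ?base i j"
      using 1 by simp
  qed (use s1 in \<open>auto simp: aval_simps\<close>)
  then have "s2 ''D'' (idx 0 i j) = edge_matrix n es i j"
    using assms(4,5) by (simp add: edge_matrix_def)
  moreover have "s2 ''H'' = s1 ''H''" unfolding s2_def by (subst sem_unmodified) auto
  moreover have "sem matrix_prog s = s2" by (simp add: matrix_prog_def s1_def s2_def)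
  ultimately show ?thesis using 1 assms(4,5) by simp
qed

definition layer_done :: "state \<Rightarrow> nat \<Rightarrow> nat \<Rightarrow> nat \<Rightarrow> bool" where
  "layer_done s h i j \<longleftrightarrow> s ''D'' (idx h i j) = dst h i j \<and> s ''H'' (idx h i j) = hop h i j"

lemma layer_done_upd: "x \<notin> {''D'', ''H''} \<Longrightarrow> layer_done (s(x := v)) h i j = layer_done s h i j"
  by (auto simp: layer_done_def)

lemma sem_relax_prog:
  assumes "s ''in'' = inp" "s ''h'' 0 = h" "s ''i'' 0 = i" "s ''j'' 0 = j" "i \<le> n" "j \<le> n"
    and D: "\<And>h' i j. h' \<le> h \<Longrightarrow> i \<le> n \<Longrightarrow> j \<le> n \<Longrightarrow> layer_done s h' i j"
  shows "sem relax_prog s ''D'' = (s ''D'')(idx (Suc h) i j := dst (Suc h) i j) \<and>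
    sem relax_prog s ''H'' = (s ''H'')(idx (Suc h) i j := hop (Suc h) i j)"
proof -
  let ?f = "\<lambda>x. Plus (dstE (Num 0) (V ''i'') x) (dstE (V ''h'') x (V ''j''))"
  define s1 where "s1 = sem (argmin_prog ''g'' ''x'' NE (V ''i'') ?f) s"
  have fr: "s1 y = s y" if "y \<notin> {''x'', ''g''}" for y
    unfolding s1_def using that by (intro sem_unmodified) (simp add: mods_argmin_prog)
  have "s1 ''g'' 0 = scan (\<lambda>x. edge_matrix n es i x + dst h x j) (aval (V ''i'') s) [0..<N]"
    unfolding s1_def
  proof (rule sem_argmin_prog)
    fix s' z assume z: "\<forall>w. w \<notin> {''x'', ''g''} \<longrightarrow> s' w = s w" "z \<in> {''x'', ''g''}"
      "s' z 0 \<in> insert (aval (V ''i'') s) {..<N}"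
    have le: "s' z 0 \<le> n" using z(3) assms(3,5) by auto
    have "s' ''in'' = inp" "s' ''D'' = s ''D''" "s' ''h'' 0 = h" "s' ''i'' 0 = i" "s' ''j'' 0 = j"
      using z(1) assms(1-4) by simp_all
    then have "aval (?f (V z)) s' = s ''D'' (idx 0 i (s' z 0)) + s ''D'' (idx h (s' z 0) j)"
      by (simp add: aval_simps)
    also have "\<dots> = dst 0 i (s' z 0) + dst h (s' z 0) j"
      using D[of 0 i "s' z 0"] D[of h "s' z 0" j] le assms(5,6) unfolding layer_done_def by simp
    finally show "aval (?f (V z)) s' = edge_matrix n es i (s' z 0) + dst h (s' z 0) j" by simp
  qed (use assms(1) in \<open>auto simp: aval_simps\<close>)
  then have g: "s1 ''g'' 0 = hop (Suc h) i j" using assms(3) by simp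
  moreover have "hop (Suc h) i j \<le> n" using hop_less[of i j "Suc h"] assms(5,6) by simp
  moreover have "dst (Suc h) i j = edge_matrix n es i (hop (Suc h) i j) + dst h (hop (Suc h) i j) j"
    by (simp add: Let_def)
  ultimately show ?thesis
    using fr assms(1-6) D[of 0 i "hop (Suc h) i j"] D[of h "hop (Suc h) i j" j]
    by (simp add: relax_prog_def aval_simps layer_done_def flip: s1_def del: dst.simps(2) hop.simps(2))
qed

text \<open>One invariant per loop: \<open>?I\<close> for the finished layers, \<open>?J\<close> for
  the finished rows of the layer in progress, \<open>?K\<close> for the finished cells of the
  current row. The layers share two arrays, and injectivity of \<open>idx\<close> protects the other
  cells from a write.\<close>

lemma sem_distance_prog:
  assumes "s ''in'' = inp" "\<And>i j. i \<le> n \<Longrightarrow> j \<le> n \<Longrightarrow> layer_done s 0 i j"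
    and "h \<le> n" "i \<le> n" "j \<le> n"
  shows "layer_done (sem distance_prog s) h i j"
proof -
  let ?I = "\<lambda>h s. \<forall>h'\<le>h. \<forall>i\<le>n. \<forall>j\<le>n. layer_done s h' i j"
  let ?J = "\<lambda>h i s. \<forall>i'<i. \<forall>j\<le>n. layer_done s (Suc h) i' j"
  let ?K = "\<lambda>h i j s. \<forall>j'<j. layer_done s (Suc h) i j'"
  have mods_relax: "mods relax_prog = {''D'', ''H'', ''x'', ''g''}"
    by (auto simp: relax_prog_def mods_argmin_prog)
  have "?I n (sem (PFor ''h'' nE (PFor ''i'' NE (PFor ''j'' NE relax_prog))) s)"
  proof (rule sem_For_inv[where I = ?I])
    fix h s1 assume h: "h < n" "?I h s1" "s1 ''h'' 0 = h"
      "\<forall>y. y \<notin> insert ''h'' (mods (PFor ''i'' NE (PFor ''j'' NE relax_prog))) \<longrightarrow> s1 y = s y"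
    have s1: "s1 ''in'' = inp" using h(4) assms(1) by (simp add: mods_relax)
    have "?I h (sem (PFor ''i'' NE (PFor ''j'' NE relax_prog)) s1) \<and>
        ?J h N (sem (PFor ''i'' NE (PFor ''j'' NE relax_prog)) s1)"
    proof (rule sem_For_inv[where I = "\<lambda>i s. ?I h s \<and> ?J h i s"])
      fix i s2 assume i: "i < N" "?I h s2 \<and> ?J h i s2" "s2 ''i'' 0 = i"
        "\<forall>y. y \<notin> insert ''i'' (mods (PFor ''j'' NE relax_prog)) \<longrightarrow> s2 y = s1 y"
      have s2: "s2 ''in'' = inp" "s2 ''h'' 0 = h" using i(4) s1 h(3) by (simp_all add: mods_relax)
      have "?I h (sem (PFor ''j'' NE relax_prog) s2) \<and> ?J h i (sem (PFor ''j'' NE relax_prog) s2) \<and>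
          ?K h i N (sem (PFor ''j'' NE relax_prog) s2)"
      proof (rule sem_For_inv[where I = "\<lambda>j s. ?I h s \<and> ?J h i s \<and> ?K h i j s"])
        fix j s3 assume j: "j < N" "?I h s3 \<and> ?J h i s3 \<and> ?K h i j s3" "s3 ''j'' 0 = j"
          "\<forall>y. y \<notin> insert ''j'' (mods relax_prog) \<longrightarrow> s3 y = s2 y"
        have s3: "s3 ''in'' = inp" "s3 ''h'' 0 = h" "s3 ''i'' 0 = i"
          using j(4) s2 i(3) by (simp_all add: mods_relax)
        have r: "sem relax_prog s3 ''D'' = (s3 ''D'')(idx (Suc h) i j := dst (Suc h) i j)"
          "sem relax_prog s3 ''H'' = (s3 ''H'')(idx (Suc h) i j := hop (Suc h) i j)"
          using sem_relax_prog[OF s3 j(3)] i(1) j(1,2) by auto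
        have ok: "layer_done (sem relax_prog s3) h' i' j'"
          if "i' \<le> n" "j' \<le> n" "(h', i', j') = (Suc h, i, j) \<or> layer_done s3 h' i' j'" for h' i' j'
          using that i(1) j(1) unfolding layer_done_def r
          by (auto simp: idx_eq_iff simp del: dst.simps hop.simps)
        show "?I h (sem relax_prog s3) \<and> ?J h i (sem relax_prog s3) \<and> ?K h i (Suc j) (sem relax_prog s3)"
          using j(1,2) i(1) by (auto intro!: ok simp: less_Suc_eq)
      qed (use i(2) s2 in \<open>auto simp: aval_simps layer_done_upd\<close>)
      then show "?I h (sem (PFor ''j'' NE relax_prog) s2) \<and> ?J h (Suc i) (sem (PFor ''j'' NE relax_prog) s2)"
        by (elim conjE, intro conjI all_less_Suc_row)
    qed (use h(2) s1 in \<open>auto simp: aval_simps layer_done_upd\<close>)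
    then show "?I (Suc h) (sem (PFor ''i'' NE (PFor ''j'' NE relax_prog)) s1)"
      by (elim conjE) (rule all_le_Suc_layer)
  qed (use assms in \<open>auto simp: aval_simps layer_done_upd\<close>)
  then show ?thesis using assms(3-5) by (simp add: distance_prog_def del: sem.simps)
qed

lemma earlier_le: "t \<le> Suc n \<Longrightarrow> earlier t x \<le> n"
  using ord_less[of x] by (auto simp: earlier_def)

definition ordered :: "nat \<Rightarrow> state \<Rightarrow> bool" where
  "ordered t s \<longleftrightarrow> s ''p'' 0 = per t \<and> s ''ord'' = earlier (Suc t) \<and>
     (\<forall>i\<in>{1..t}. s ''per'' i = per i \<and> s ''par'' i = par i)"

lemma sem_order_prog:
  assumes "s ''in'' = inp" "s ''ord'' = (\<lambda>_. 0)"
    and D: "\<And>i j. i \<le> n \<Longrightarrow> j \<le> n \<Longrightarrow> s ''D'' (idx n i j) = dst n i j"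
  shows "ordered n (sem order_prog s)"
proof -
  let ?big = "key_bound n \<tau>"
  let ?k = "PAssign ''key'' (Plus (V ''j'') (Num 1)) (tauE (Plus (V ''j'') (Num 1))) ;;
        ''big'' ::= Plus (V ''big'') (tauE (Plus (V ''j'') (Num 1)))"
  let ?f = "\<lambda>x. dstE nE (Get ''ord'' x) (V ''g'')"
  let ?a = "argmin_prog ''g'' ''x'' NE (Num 0) (Get ''key'')"
  let ?c = "argmin_prog ''y'' ''x'' NE (Num 0) ?f"
  let ?u1 = "PAssign ''key'' (V ''g'') (V ''big'') ;;
        ''p'' ::= Times (V ''p'') (Div (tauE (V ''g'')) (V ''p'')) ;;
        PAssign ''per'' (Plus (V ''t'') (Num 1)) (V ''p'')"
  let ?u2 = "PAssign ''par'' (Plus (V ''t'') (Num 1)) (Get ''ord'' (V ''y'')) ;;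
        PAssign ''ord'' (Plus (V ''t'') (Num 1)) (V ''g'')"
  let ?b = "?a ;; PAssign ''key'' (V ''g'') (V ''big'') ;;
        ''p'' ::= Times (V ''p'') (Div (tauE (V ''g'')) (V ''p'')) ;;
        PAssign ''per'' (Plus (V ''t'') (Num 1)) (V ''p'') ;; ?c ;; ?u2"
  let ?I = "\<lambda>t s. (\<forall>x\<le>n. s ''key'' x = keys t x) \<and> ordered t s"
  define s1 where "s1 = sem (PFor ''j'' nE ?k) (sem (''big'' ::= Num 1) s)"
  define s2 where "s2 = sem (''key'' ::= V ''big'' ;; ''p'' ::= Num 1) s1"
  have "(\<forall>i\<in>{1..n}. s1 ''key'' i = \<tau> i) \<and> s1 ''big'' 0 = Suc (sum \<tau> {1..n})"
    unfolding s1_def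
  proof (rule sem_For_inv[where I = "\<lambda>j s. (\<forall>i\<in>{1..j}. s ''key'' i = \<tau> i) \<and> s ''big'' 0 = Suc (sum \<tau> {1..j})"])
    fix j s' assume j: "j < n" "(\<forall>i\<in>{1..j}. s' ''key'' i = \<tau> i) \<and> s' ''big'' 0 = Suc (sum \<tau> {1..j})"
      "s' ''j'' 0 = j" "\<forall>y. y \<notin> insert ''j'' (mods ?k) \<longrightarrow> s' y = sem (''big'' ::= Num 1) s y"
    have s': "s' ''in'' = inp" using j(4) assms(1) by simp
    have "inp (Suc (Suc j)) = \<tau> (Suc j)" using inp_\<tau>[of "Suc j"] j(1) by simp
    then have "sem ?k s' ''key'' = (s' ''key'')(Suc j := \<tau> (Suc j))"
      and "sem ?k s' ''big'' 0 = s' ''big'' 0 + \<tau> (Suc j)"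
      using s' j(3) by (simp_all add: aval_simps)
    then show "(\<forall>i\<in>{1..Suc j}. sem ?k s' ''key'' i = \<tau> i) \<and>
        sem ?k s' ''big'' 0 = Suc (sum \<tau> {1..Suc j})"
      using j(2) by (simp del: sem.simps)
  qed (use assms(1) in \<open>auto simp: aval_simps\<close>)
  then have 1: "\<forall>i\<in>{1..n}. s1 ''key'' i = \<tau> i" "s1 ''big'' 0 = ?big"
    by (simp_all add: key_bound_def)
  have s1: "s1 ''in'' = inp" "s1 ''ord'' = (\<lambda>_. 0)" "s1 ''D'' = s ''D''"
    unfolding s1_def using assms(1,2) by (subst sem_unmodified; simp)+
  have "?I n (sem (PFor ''t'' nE ?b) s2)"
  proof (rule sem_For_inv[where I = ?I])
    show "aval nE s2 = n" using s1 by (simp add: s2_def aval_simps)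
    have "s2 ''key'' x = keys 0 x" if "x \<le> n" for x
      using 1 that by (cases "x = 0") (auto simp: s2_def)
    moreover have "earlier (Suc 0) = (\<lambda>_. 0)" by (auto simp: earlier_def)
    ultimately show "?I 0 s2" using s1 by (simp add: s2_def ordered_def)
    show "?I i (s'(''t'' := v))" if "?I i s'" for i s' v
      using that by (simp add: ordered_def)
    fix t s' assume t: "t < n" "?I t s'" "s' ''t'' 0 = t"
      and fr: "\<forall>y. y \<notin> insert ''t'' (mods ?b) \<longrightarrow> s' y = s2 y"
    have s': "s' ''in'' = inp" "s' ''D'' = s ''D''" "s' ''big'' 0 = ?big"
      using fr s1 1 by (simp_all add: mods_argmin_prog s2_def)
    have ordd: "s' ''p'' 0 = per t" "s' ''ord'' = earlier (Suc t)"
      "\<forall>i\<in>{1..t}. s' ''per'' i = per i \<and> s' ''par'' i = par i"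
      using t(2) by (simp_all add: ordered_def)
    define a1 where "a1 = sem ?a s'"
    define a2 where "a2 = sem ?u1 a1"
    define a3 where "a3 = sem ?c a2"
    have fr1: "a1 y = s' y" if "y \<notin> {''x'', ''g''}" for y
      unfolding a1_def using that by (intro sem_unmodified) (simp add: mods_argmin_prog)
    have fr3: "a3 y = a2 y" if "y \<notin> {''x'', ''y''}" for y
      unfolding a3_def using that by (intro sem_unmodified) (simp add: mods_argmin_prog)
    have "a1 ''g'' 0 = scan (s' ''key'') (aval (Num 0) s') [0..<N]"
      unfolding a1_def
    proof (rule sem_argmin_prog)
      fix r z assume "\<forall>w. w \<notin> {''x'', ''g''} \<longrightarrow> r w = s' w"
      then have "r ''key'' = s' ''key''" by simp
      then show "aval (Get ''key'' (V z)) r = s' ''key'' (r z 0)" by simp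
    qed (use s' in \<open>simp_all add: aval_simps\<close>)
    \<comment> \<open>The array is known to agree with \<open>keys t\<close> only up to
      \<open>n\<close>, but the scan looks no further.\<close>
    also have "\<dots> = scan (keys t) 0 [0..<N]"
      unfolding aval.simps using t(2) by (intro scan_cong) auto
    finally have g: "a1 ''g'' 0 = ord (Suc t)" by simp
    have o: "ord (Suc t) \<in> {1..n}" using ord_in[of "Suc t"] t(1) by simp
    have a2: "a2 ''key'' = (s' ''key'')(ord (Suc t) := ?big)" "a2 ''p'' 0 = per (Suc t)"
      "a2 ''per'' = (s' ''per'')(Suc t := per (Suc t))" "a2 ''g'' 0 = ord (Suc t)"
      "a2 ''t'' 0 = t" "a2 ''in'' = inp" "a2 ''D'' = s ''D''" "a2 ''ord'' = earlier (Suc t)"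
      "a2 ''par'' = s' ''par''"
      using fr1 g s' ordd t(3) inp_\<tau>[OF o] by (simp_all add: a2_def aval_simps del: ord.simps)
    have "a3 ''y'' 0 = scan (\<lambda>x. dst n (earlier (Suc t) x) (ord (Suc t))) (aval (Num 0) a2) [0..<N]"
      unfolding a3_def
    proof (rule sem_argmin_prog)
      fix r z assume "\<forall>w. w \<notin> {''x'', ''y''} \<longrightarrow> r w = a2 w"
      then have "r ''in'' = inp" "r ''D'' = s ''D''" "r ''ord'' = earlier (Suc t)" "r ''g'' 0 = ord (Suc t)"
        using a2 by simp_all
      then have "aval (?f (V z)) r = s ''D'' (idx n (earlier (Suc t) (r z 0)) (ord (Suc t)))"
        by (simp add: aval_simps)
      also have "\<dots> = dst n (earlier (Suc t) (r z 0)) (ord (Suc t))"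
        using earlier_le[of "Suc t" "r z 0"] t(1) o by (intro D) auto
      finally show "aval (?f (V z)) r = dst n (earlier (Suc t) (r z 0)) (ord (Suc t))" .
    qed (use a2 in \<open>simp_all add: aval_simps\<close>)
    then have y: "earlier (Suc t) (a3 ''y'' 0) = par (Suc t)" unfolding par_def by simp
    have "sem ?b s' = sem ?u2 a3" by (simp add: a1_def a2_def a3_def)
    moreover have "sem ?u2 a3 ''key'' = (s' ''key'')(ord (Suc t) := ?big)"
      "sem ?u2 a3 ''p'' 0 = per (Suc t)" "sem ?u2 a3 ''per'' = (s' ''per'')(Suc t := per (Suc t))"
      "sem ?u2 a3 ''par'' = (s' ''par'')(Suc t := par (Suc t))"
      "sem ?u2 a3 ''ord'' = (earlier (Suc t))(Suc t := ord (Suc t))"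
      using fr3 a2 y by simp_all
    moreover have "(earlier (Suc t))(Suc t := ord (Suc t)) = earlier (Suc (Suc t))"
      by (auto simp: earlier_def less_Suc_eq simp del: ord.simps)
    ultimately show "?I (Suc t) (sem ?b s')"
      using t(2) ordd(3) unfolding ordered_def by (auto simp: le_Suc_eq simp del: per.simps)
  qed
  moreover have "sem order_prog s = sem (PFor ''t'' nE ?b) s2"
    by (simp add: order_prog_def s1_def s2_def)
  ultimately show ?thesis by (simp only:)
qed

text \<open>The due clients come first in the order: the rounds below \<open>cnt k\<close> perform
  the insertions that define \<open>cyc\<close>, and all later rounds do nothing. Hence the minimum
  of \<open>t\<close> and \<open>cnt k\<close> in the invariant.\<close>

lemma sem_cycle_prog:
  assumes "s ''in'' = inp" "ordered n s" "s ''nx'' = (\<lambda>_. 0)" "s ''cnt'' 0 = 0"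
  shows "sem cycle_prog s ''cnt'' 0 = cnt k \<and> linked (sem cycle_prog s ''nx'') (cyc (cnt k) @ [0])"
proof -
  let ?perE = "Get ''per'' (Plus (V ''t'') (Num 1))"
  let ?ordE = "Get ''ord'' (Plus (V ''t'') (Num 1))"
  let ?parE = "Get ''par'' (Plus (V ''t'') (Num 1))"
  let ?b = "PIf (Minus kE (Times ?perE (Div kE ?perE))) PSkip
      (PAssign ''nx'' ?ordE (Get ''nx'' ?parE) ;; PAssign ''nx'' ?parE ?ordE ;;
       ''cnt'' ::= Plus (V ''cnt'') (Num 1))"
  let ?I = "\<lambda>t s. s ''cnt'' 0 = min t (cnt k) \<and> linked (s ''nx'') (cyc (min t (cnt k)) @ [0])"
  have "?I n (sem (PFor ''t'' nE ?b) s)"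
  proof (rule sem_For_inv[where I = ?I])
    show "?I 0 s" using assms(3,4) by simp
    fix t s' assume t: "t < n" "?I t s'" "s' ''t'' 0 = t"
      and fr: "\<forall>y. y \<notin> insert ''t'' (mods ?b) \<longrightarrow> s' y = s y"
    have "s' ''in'' = inp" "s' ''per'' = s ''per''" "s' ''ord'' = s ''ord''" "s' ''par'' = s ''par''"
      using fr assms(1) by simp_all
    moreover have "s ''per'' (Suc t) = per (Suc t)" "s ''par'' (Suc t) = par (Suc t)"
      "s ''ord'' (Suc t) = ord (Suc t)"
      using assms(2) t(1) by (simp_all add: ordered_def earlier_def del: per.simps ord.simps)
    ultimately have s': "s' ''in'' = inp" "s' ''per'' (Suc t) = per (Suc t)"
      "s' ''par'' (Suc t) = par (Suc t)" "s' ''ord'' (Suc t) = ord (Suc t)" by simp_all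
    have test: "aval (Minus kE (Times ?perE (Div kE ?perE))) s' = k mod per (Suc t)"
      using s' t(3) by (simp add: aval_simps minus_mult_div_eq_mod del: per.simps)
    have iff: "k mod per (Suc t) = 0 \<longleftrightarrow> Suc t \<le> cnt k"
      using per_dvd_iff[of "Suc t" k] t(1) by (simp add: dvd_eq_mod_eq_0 del: per.simps)
    show "?I (Suc t) (sem ?b s')"
    proof (cases "Suc t \<le> cnt k")
      case True
      have m: "min t (cnt k) = t" "min (Suc t) (cnt k) = Suc t" using True by auto
      have "aval (Minus kE (Times ?perE (Div kE ?perE))) s' = 0" unfolding test iff by (rule True)
      then have "sem ?b s' = sem (PAssign ''nx'' ?ordE (Get ''nx'' ?parE) ;; PAssign ''nx'' ?parE ?ordE ;;
           ''cnt'' ::= Plus (V ''cnt'') (Num 1)) s'"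
        by (simp only: sem.simps) simp
      moreover have "sem (PAssign ''nx'' ?ordE (Get ''nx'' ?parE) ;; PAssign ''nx'' ?parE ?ordE ;;
           ''cnt'' ::= Plus (V ''cnt'') (Num 1)) s' ''nx'' =
          (s' ''nx'')(ord (Suc t) := s' ''nx'' (par (Suc t)), par (Suc t) := ord (Suc t))"
        using s' t(3) by (simp del: ord.simps)
      moreover have "sem (PAssign ''nx'' ?ordE (Get ''nx'' ?parE) ;; PAssign ''nx'' ?parE ?ordE ;;
           ''cnt'' ::= Plus (V ''cnt'') (Num 1)) s' ''cnt'' 0 = Suc t"
        using t(2) m by simp
      moreover have "linked (s' ''nx'') (cyc t @ [0])" using t(2) unfolding m by blast
      note linked_cyc_step[OF t(1) this]
      ultimately show ?thesis unfolding m by (simp only: simp_thms)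
    next
      case False
      have m: "min (Suc t) (cnt k) = min t (cnt k)" using False by auto
      have "aval (Minus kE (Times ?perE (Div kE ?perE))) s' \<noteq> 0" unfolding test iff by (rule False)
      then have "sem ?b s' = s'" by (simp only: sem.simps) simp
      then show ?thesis using t(2) unfolding m by (simp only:)
    qed
  qed (use assms(1) in \<open>simp_all add: aval_simps\<close>)
  then show ?thesis using cnt_le[of k] by (simp add: cycle_prog_def min_absorb2 del: sem.simps)
qed

text \<open>One equation for all layers, like the loop body, in which layer 0 is no special
  case.\<close>

lemma route_unfold:
  "route h i j = moves i (hop h i j) @ (case h of 0 \<Rightarrow> [] | Suc g \<Rightarrow> route g (hop h i j) j)"
  by (cases h) simp_all

definition buffer :: "state \<Rightarrow> nat list" where
  "buffer s = map (\<lambda>i. s ''out'' (i + 2)) [0..<s ''len'' 0]"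

lemma buffer_upd: "x \<notin> {''out'', ''len''} \<Longrightarrow> buffer (s(x := f)) = buffer s"
  by (auto simp: buffer_def)

text \<open>Invariant: the vertices written so far, followed by the route still to be walked from
  \<open>''u''\<close>, make up the whole output. Layer 0 hops directly to \<open>v\<close>, so the
  last of the \<open>n + 1\<close> rounds ends there.\<close>

lemma sem_route_prog:
  assumes "s ''in'' = inp" "s ''u'' 0 \<le> n" "s ''v'' 0 = v" "v \<le> n"
    and H: "\<And>h i j. h \<le> n \<Longrightarrow> i \<le> n \<Longrightarrow> j \<le> n \<Longrightarrow> s ''H'' (idx h i j) = hop h i j"
  shows "buffer (sem route_prog s) = buffer s @ route n (s ''u'' 0) v \<and>
    sem route_prog s ''u'' 0 = v \<and> sem route_prog s ''out'' 0 = s ''out'' 0"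
proof -
  let ?b = "''x'' ::= Get ''H'' (idxE (Minus nE (V ''r'')) (V ''u'') (V ''v'')) ;;
        PIf (unequalE (V ''x'') (V ''u''))
          (PAssign ''out'' (Plus (V ''len'') (Num 2)) (V ''x'') ;;
           ''len'' ::= Plus (V ''len'') (Num 1) ;;
           ''u'' ::= V ''x'')
          PSkip"
  let ?rest = "\<lambda>r (s::state). if r \<le> n then route (n - r) (s ''u'' 0) v else []"
  let ?I = "\<lambda>r s'. buffer s' @ ?rest r s' = buffer s @ route n (s ''u'' 0) v \<and>
      (n < r \<longrightarrow> s' ''u'' 0 = v) \<and> s' ''u'' 0 \<le> n \<and> s' ''out'' 0 = s ''out'' 0"
  have "?I N (sem (PFor ''r'' NE ?b) s)"
  proof (rule sem_For_inv[where I = ?I])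
    show "?I 0 s" using assms(2) by simp
    show "?I i (s'(''r'' := f))" if "?I i s'" for i s' f
    proof -
      have "(s'(''r'' := f)) ''u'' = s' ''u''" "(s'(''r'' := f)) ''out'' = s' ''out''"
        "buffer (s'(''r'' := f)) = buffer s'"
        by (simp_all add: buffer_upd)
      note eqs = this
      show ?thesis unfolding eqs by (rule that)
    qed
    fix r s' assume r: "r < N" "?I r s'" "s' ''r'' 0 = r"
      and fr: "\<forall>y. y \<notin> insert ''r'' (mods ?b) \<longrightarrow> s' y = s y"
    let ?u = "s' ''u'' 0"
    define x where "x = hop (n - r) ?u v"
    have s': "s' ''in'' = inp" "s' ''v'' 0 = v" "s' ''H'' = s ''H''" using fr assms(1,3) by simp_all
    have u: "?u \<le> n" using r(2) by blast
    have x: "x \<le> n" using hop_less[of ?u v "n - r"] u assms(4) by (simp add: x_def)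
    have xH: "s' ''H'' (idx (n - r) ?u v) = x"
      unfolding s'(3) x_def using u assms(4) by (intro H) auto
    have b: "sem ?b s' ''u'' 0 = x" "sem ?b s' ''out'' 0 = s' ''out'' 0"
      "buffer (sem ?b s') = buffer s' @ moves ?u x"
      using s' xH r(3) by (auto simp: aval_simps aval_unequal moves_def buffer_def upt_Suc_append)
    have rest: "?rest r s' = moves ?u x @ ?rest (Suc r) (sem ?b s')"
    proof (cases "r = n")
      case True
      then have "n - r = 0" "\<not> Suc r \<le> n" "r \<le> n" by simp_all
      then show ?thesis by (simp add: x_def del: sem.simps)
    next
      case False
      then obtain g where g: "n - r = Suc g" using r(1) by (cases "n - r") auto
      then have "n - Suc r = g" by simp
      then show ?thesis using False r(1) g route_unfold[of "Suc g" ?u v] unfolding b(1)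
        by (simp add: x_def del: route.simps hop.simps)
    qed
    have "x = v" if "n < Suc r"
    proof -
      have "n - r = 0" using that by simp
      then show ?thesis by (simp add: x_def)
    qed
    then show "?I (Suc r) (sem ?b s')"
      using r(2) x unfolding b rest by (simp del: sem.simps)
  qed (use assms(1) in \<open>simp add: aval_simps\<close>)
  then show ?thesis by (simp add: route_prog_def del: sem.simps)
qed

lemma mods_route_prog: "mods route_prog = {''r'', ''x'', ''out'', ''len'', ''u''}"
  by (auto simp: route_prog_def)

lemma sem_output_prog:
  assumes "s ''in'' = inp" "ordered n s" "s ''out'' = (\<lambda>_. 0)" "s ''u'' 0 = 0"
    and H: "\<And>h i j. h \<le> n \<Longrightarrow> i \<le> n \<Longrightarrow> j \<le> n \<Longrightarrow> s ''H'' (idx h i j) = hop h i j"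
    and c: "s ''cnt'' 0 = cnt k" and lk: "linked (s ''nx'') (cyc (cnt k) @ [0])"
  shows "output_of (sem output_prog s) = per n # length (tour k) # tour k @ visited k"
proof -
  let ?c = "cnt k"
  let ?L = "cyc ?c @ [0]"
  have L: "length ?L = ?c + 2" "hd ?L = 0" "?L ! 0 = 0" "?L ! Suc ?c = 0" "set ?L \<subseteq> {..n}"
    using cyc_props[OF cnt_le, of k] ord_less cnt_le[of k]
    by (auto simp: nth_append hd_conv_nth less_Suc_eq_le)
  have Ln: "?L ! i \<le> n" if "i < length ?L" for i using nth_mem[OF that] L(5) by blast
  let ?b = "PIf (Minus (Plus (V ''cnt'') (Num 1)) (V ''t''))
          (''v'' ::= Get ''nx'' (V ''u'') ;; route_prog)
          PSkip"
  let ?d = "PIf (Minus (V ''cnt'') (V ''t''))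
          (PAssign ''out'' (Plus (Plus (V ''len'') (Num 2)) (V ''t''))
             (Get ''ord'' (Plus (V ''t'') (Num 1))))
          PSkip"
  define s1 where "s1 = sem (''out'' ::= V ''p'' ;; ''len'' ::= Num 1) s"
  define s2 where "s2 = sem (PFor ''t'' NE ?b) s1"
  define s3 where "s3 = sem (PAssign ''out'' (Num 1) (V ''len'')) s2"
  define s4 where "s4 = sem (PFor ''t'' nE ?d) s3"
  \<comment> \<open>The cycle has \<open>Suc ?c\<close> legs; later rounds change nothing.\<close>
  let ?m = "\<lambda>t. min t (Suc ?c)"
  let ?I = "\<lambda>t s. buffer s = 0 # expand (take (Suc (?m t)) ?L) \<and> s ''u'' 0 = ?L ! ?m t \<and>
      s ''out'' 0 = per n"
  have "?I N s2"
    unfolding s2_def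
  proof (rule sem_For_inv[where I = ?I])
    show "aval NE s1 = N" using assms(1) by (simp add: s1_def aval_simps)
    have "take (Suc 0) ?L = [0]" using L by (cases ?L) auto
    \<comment> \<open>Nothing has been written to cell 2: its initial 0 is the depot.\<close>
    moreover have "buffer s1 = [0]" using assms(3)
      by (simp add: s1_def buffer_def upt_rec)
    ultimately show "?I 0 s1" using assms(2,4) L(3) by (simp add: s1_def ordered_def)
    show "?I i (s'(''t'' := f))" if "?I i s'" for i s' f
      using that by (simp add: buffer_upd)
    fix t s' assume t: "t < N" "?I t s'" "s' ''t'' 0 = t"
      and fr: "\<forall>y. y \<notin> insert ''t'' (mods ?b) \<longrightarrow> s' y = s1 y"
    have s': "s' ''in'' = inp" "s' ''H'' = s ''H''" "s' ''nx'' = s ''nx''" "s' ''cnt'' 0 = ?c"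
      using fr assms(1) c by (simp_all add: mods_route_prog s1_def)
    show "?I (Suc t) (sem ?b s')"
    proof (cases "t \<le> ?c")
      case True
      have m: "?m t = t" "?m (Suc t) = Suc t" using True by auto
      let ?r = "s'(''v'' := (s' ''v'')(0 := ?L ! Suc t))"
      have u: "s' ''u'' 0 = ?L ! t" using t(2) unfolding m by blast
      have "s ''nx'' (?L ! t) = ?L ! Suc t" using linked_nth[OF lk, of t] True L(1) by simp
      then have b: "sem ?b s' = sem route_prog ?r"
        using True t(3) s'(3,4) u by simp
      have le: "?L ! t \<le> n" "?L ! Suc t \<le> n" using Ln[of t] Ln[of "Suc t"] True L(1) by auto
      have rp: "buffer (sem route_prog ?r) = buffer ?r @ route n (?r ''u'' 0) (?L ! Suc t) \<and>
          sem route_prog ?r ''u'' 0 = ?L ! Suc t \<and> sem route_prog ?r ''out'' 0 = ?r ''out'' 0"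
        by (rule sem_route_prog) (use s' u le H in simp_all)
      have bu: "buffer ?r = buffer s'" by (simp add: buffer_def)
      have tk: "take (Suc t) ?L = take t ?L @ [?L ! t]" "take (Suc (Suc t)) ?L = take t ?L @ [?L ! t, ?L ! Suc t]"
        using True L(1) by (simp_all add: take_Suc_conv_app_nth del: take_append)
      have "expand (take (Suc (Suc t)) ?L) = expand (take (Suc t) ?L) @ route n (?L ! t) (?L ! Suc t)"
        unfolding tk by (rule expand_snoc)
      then show ?thesis using t(2) rp u unfolding m b bu by (simp del: take_append)
    next
      case False
      have m: "?m (Suc t) = ?m t" using False by auto
      have "sem ?b s' = s'" using False t(3) s'(4) by simp
      then show ?thesis using t(2) unfolding m by (simp only:)
    qed
  qed
  moreover have "?m N = Suc ?c" using cnt_le[of k] by simp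
  moreover have "take (Suc (Suc ?c)) ?L = ?L" using L(1) by simp
  ultimately have s2: "buffer s2 = tour k" "s2 ''out'' 0 = per n" by (simp_all add: tour_def)
  have fr2: "s2 y = s1 y" if "y \<notin> {''t'', ''v'', ''r'', ''x'', ''out'', ''len'', ''u''}" for y
    unfolding s2_def by (rule sem_unmodified) (use that in \<open>simp add: mods_route_prog\<close>)
  let ?l = "s2 ''len'' 0"
  have len: "length (tour k) = ?l" unfolding s2(1)[symmetric] by (simp add: buffer_def)
  have s3: "s3 ''in'' = inp" "s3 ''len'' 0 = ?l" "s3 ''cnt'' 0 = ?c" "s3 ''ord'' = earlier N"
    "s3 ''out'' = (s2 ''out'')(1 := ?l)"
    using fr2 assms(1,2) c by (simp_all add: s3_def s1_def ordered_def)
  let ?n = "\<lambda>t. min t ?c"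
  let ?J = "\<lambda>t s. s ''out'' 0 = per n \<and> s ''out'' 1 = ?l \<and>
      map (\<lambda>i. s ''out'' (i + 2)) [0..<?l + ?n t] = tour k @ map ord [1..<Suc (?n t)]"
  have "?J n s4"
    unfolding s4_def
  proof (rule sem_For_inv[where I = ?J])
    show "aval nE s3 = n" using s3 by (simp add: aval_simps)
    have "map (\<lambda>i. s3 ''out'' (i + 2)) [0..<?l] = buffer s2" unfolding s3 buffer_def by simp
    then show "?J 0 s3" using s2 s3(5) by simp
    fix t s' assume t: "t < n" "?J t s'" "s' ''t'' 0 = t"
      and fr: "\<forall>y. y \<notin> insert ''t'' (mods ?d) \<longrightarrow> s' y = s3 y"
    have s': "s' ''len'' 0 = ?l" "s' ''cnt'' 0 = ?c" "s' ''ord'' (Suc t) = ord (Suc t)"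
      using fr s3 t(1) by (simp_all add: earlier_def del: ord.simps)
    show "?J (Suc t) (sem ?d s')"
    proof (cases "t < ?c")
      case True
      have m: "?n t = t" "?n (Suc t) = Suc t" using True by auto
      let ?o = "(s' ''out'')(?l + 2 + t := ord (Suc t))"
      have o: "sem ?d s' ''out'' = ?o"
        using True t(3) s' by (simp del: ord.simps)
      have "map (\<lambda>i. ?o (i + 2)) [0..<?l + Suc t] = map (\<lambda>i. s' ''out'' (i + 2)) [0..<?l + t] @ [ord (Suc t)]"
        by (auto simp: upt_Suc_append simp del: ord.simps)
      also have "map (\<lambda>i. s' ''out'' (i + 2)) [0..<?l + t] = tour k @ map ord [1..<Suc t]"
        using t(2) unfolding m by blast
      also have "(tour k @ map ord [1..<Suc t]) @ [ord (Suc t)] = tour k @ map ord [1..<Suc (Suc t)]"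
        by (simp add: upt_Suc_append[of "Suc 0" "Suc t"] del: ord.simps)
      finally have "map (\<lambda>i. ?o (i + 2)) [0..<?l + Suc t] = tour k @ map ord [1..<Suc (Suc t)]" .
      moreover have "?o 0 = per n" "?o 1 = ?l" using t(2) by simp_all
      ultimately show ?thesis unfolding m o by blast
    next
      case False
      have m: "?n (Suc t) = ?n t" using False by auto
      have "sem ?d s' = s'" using False t(3) s'(2) by simp
      then show ?thesis using t(2) unfolding m by (simp only:)
    qed
  qed simp_all
  then have s4: "s4 ''out'' 0 = per n" "s4 ''out'' 1 = ?l"
      "map (\<lambda>i. s4 ''out'' (i + 2)) [0..<?l + ?c] = tour k @ visited k"
    using cnt_le[of k] by (simp_all add: min_absorb2 visited_def)
  have s4': "s4 ''len'' 0 = ?l" "s4 ''cnt'' 0 = ?c"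
    unfolding s4_def using s3 by (simp_all add: sem_unmodified del: sem.simps)
  have "sem output_prog s = sem (''outlen'' ::= Plus (Plus (V ''len'') (Num 2)) (V ''cnt'')) s4"
    by (simp add: output_prog_def s1_def s2_def s3_def s4_def)
  then have "output_of (sem output_prog s) = map (s4 ''out'') [0..<2 + ?l + ?c]"
    using s4' by (simp add: output_of_def add_ac)
  also have "\<dots> = s4 ''out'' 0 # s4 ''out'' 1 # map (\<lambda>i. s4 ''out'' (i + 2)) [0..<?l + ?c]"
    by (simp add: map_upt_Suc del: upt_Suc)
  finally show ?thesis using s4 len by simp
qed

text \<open>The phases communicate through a few arrays. Frame facts carry these, and the initial
  zeros on which \<open>''ord''\<close>, \<open>''nx''\<close>, \<open>''cnt''\<close>,
  \<open>''out''\<close> and \<open>''u''\<close> rely, past the phases in between.\<close>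

theorem output_solver_prog:
  assumes "s ''in'' = inp" "\<And>x. x \<notin> {''in'', ''inlen''} \<Longrightarrow> s x = (\<lambda>_. 0)"
  shows "output_of (sem solver_prog s) = per n # length (tour k) # tour k @ visited k"
proof -
  define s1 where "s1 = sem scale_prog s"
  define s2 where "s2 = sem matrix_prog s1"
  define s3 where "s3 = sem distance_prog s2"
  define s4 where "s4 = sem order_prog s3"
  define s5 where "s5 = sem cycle_prog s4"
  note defs = s1_def s2_def s3_def s4_def s5_def
  have "wf_prog scale_prog" "wf_prog matrix_prog" "wf_prog distance_prog" "wf_prog order_prog"
    "wf_prog cycle_prog"
    using wf_solver_prog by (simp_all add: solver_prog_def)
  then have ins: "s1 ''in'' = inp" "s2 ''in'' = inp" "s3 ''in'' = inp" "s4 ''in'' = inp" "s5 ''in'' = inp"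
    using assms(1) by (simp_all add: defs sem_in)
  note mp = scale_prog_def matrix_prog_def distance_prog_def relax_prog_def
    order_prog_def cycle_prog_def mods_argmin_prog
  have "s3 ''ord'' = s ''ord''"
    unfolding defs by (simp add: sem_unmodified mp del: sem.simps)
  moreover have "s4 ''nx'' = s ''nx''" "s4 ''cnt'' = s ''cnt''"
    unfolding defs by (simp_all add: sem_unmodified mp del: sem.simps)
  moreover have "s5 ''out'' = s ''out''" "s5 ''u'' = s ''u''"
    unfolding defs by (simp_all add: sem_unmodified mp del: sem.simps)
  ultimately have z: "s3 ''ord'' = (\<lambda>_. 0)" "s4 ''nx'' = (\<lambda>_. 0)" "s4 ''cnt'' 0 = 0"
    "s5 ''out'' = (\<lambda>_. 0)" "s5 ''u'' 0 = 0"
    using assms(2) by simp_all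
  have fr4: "s4 ''H'' = s3 ''H''"
    unfolding s4_def by (rule sem_unmodified) (simp add: mp)
  have fr5: "s5 y = s4 y" if "y \<notin> {''t'', ''nx'', ''cnt''}" for y
    unfolding s5_def by (rule sem_unmodified) (use that in \<open>simp add: mp\<close>)
  have 1: "s1 ''q'' 0 = scale es" "s1 ''inf'' 0 = no_edge n es"
    using sem_scale_prog[of s, OF assms(1)] by (simp_all add: s1_def)
  have 2: "layer_done s2 0 i j" if "i \<le> n" "j \<le> n" for i j
    using sem_matrix_prog[OF ins(1) 1 that] by (simp add: s2_def layer_done_def)
  have 3: "layer_done s3 h i j" if "h \<le> n" "i \<le> n" "j \<le> n" for h i j
    unfolding s3_def using ins(2) 2 that by (intro sem_distance_prog) auto
  have 4: "ordered n s4"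
    unfolding s4_def by (rule sem_order_prog[OF ins(3) z(1)]) (use 3 in \<open>simp add: layer_done_def\<close>)
  have 5: "s5 ''cnt'' 0 = cnt k" "linked (s5 ''nx'') (cyc (cnt k) @ [0])"
    using sem_cycle_prog[OF ins(4) 4 z(2,3)] by (simp_all add: s5_def)
  have 6: "ordered n s5" using 4 fr5 by (simp add: ordered_def)
  have 7: "s5 ''H'' (idx h i j) = hop h i j" if "h \<le> n" "i \<le> n" "j \<le> n" for h i j
    using 3[OF that] fr4 fr5 by (simp add: layer_done_def)
  have "sem solver_prog s = sem output_prog s5" by (simp add: solver_prog_def defs)
  then show ?thesis using sem_output_prog[OF ins(5) 6 z(4,5) 7 5] by (simp only:)
qed

end

section \<open>The approximation guarantee\<close>

definition same_ends :: "nat \<times> nat \<times> nat \<times> nat \<Rightarrow> nat set" where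
  "same_ends = (\<lambda>(u, v, a, b). {u, v})"

lemma put_edge_eq:
  "put_edge q e M i j = (if same_ends e = {i, j} then scaled_weight q e else M i j)"
  by (cases e) (auto simp: put_edge_def same_ends_def scaled_weight_def doubleton_eq_iff)

lemma fold_put_edge_other:
  "{i, j} \<notin> same_ends ` set es \<Longrightarrow> fold (put_edge q) es M i j = M i j"
  by (induction es arbitrary: M) (auto simp: put_edge_eq)

text \<open>No two entries of the list join the same pair of vertices, so the value written for
  \<open>e\<close> is not overwritten.\<close>

lemma fold_put_edge:
  assumes "distinct (map same_ends es)" "e \<in> set es" "same_ends e = {i, j}"
  shows "fold (put_edge q) es M i j = scaled_weight q e"
  using assms
proof (induction es arbitrary: M)
  case (Cons f es)
  show ?case
  proof (cases "f = e")
    case True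
    then have "{i, j} \<notin> same_ends ` set es" using Cons.prems by auto
    then have "fold (put_edge q) es (put_edge q e M) i j = put_edge q e M i j"
      by (rule fold_put_edge_other)
    moreover have "put_edge q e M i j = scaled_weight q e"
      using Cons.prems(3) by (simp add: put_edge_eq)
    ultimately show ?thesis using True by simp
  next
    case False
    then show ?thesis using Cons by simp
  qed
qed simp

lemma nth_concat_4:
  assumes "\<And>x. x \<in> set xs \<Longrightarrow> length (f x) = 4" "i < length xs" "c < 4"
  shows "concat (map f xs) ! (i * 4 + c) = f (xs ! i) ! c \<and> i * 4 + c < length (concat (map f xs))"
  using assms
proof (induction xs arbitrary: i)
  case (Cons x xs)
  show ?case
  proof (cases i)
    case 0
    then show ?thesis using Cons.prems by (simp add: nth_append)
  next
    case (Suc j)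
    then show ?thesis using Cons.prems Cons.IH[of j] by (simp add: nth_append)
  qed
qed simp

lemma card_multiples: "p \<ge> 1 \<Longrightarrow> card {k \<in> {1..m * p}. p dvd k} = (m :: nat)"
proof -
  assume p: "p \<ge> 1"
  have "{k \<in> {1..m * p}. p dvd k} = (\<lambda>i. i * p) ` {1..m}"
  proof (intro set_eqI iffI)
    fix k assume k: "k \<in> {k \<in> {1..m * p}. p dvd k}"
    then obtain i where i: "k = i * p" by (auto elim!: dvdE simp: mult.commute)
    then have "i * p \<le> m * p" "i * p \<noteq> 0" using k by auto
    then have "i \<le> m" "i \<noteq> 0" using p by auto
    then have "i \<in> {1..m}" by simp
    with i show "k \<in> (\<lambda>i. i * p) ` {1..m}" by blast
  qed (use p in auto)
  moreover have "inj_on (\<lambda>i. i * p) {1..m}" using p by (auto simp: inj_on_def)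
  ultimately show ?thesis by (simp add: card_image)
qed

definition client_turnover :: "rftt_input \<Rightarrow> nat \<Rightarrow> nat" where
  "client_turnover X j = fst X ! (j - 1)"

locale valid_instance =
  fixes X :: rftt_input
  assumes valid: "valid_input X"
begin

abbreviation "n \<equiv> length (fst X)"
abbreviation "es \<equiv> snd X"
abbreviation "I \<equiv> to_rftt X"
abbreviation "\<tau> \<equiv> client_turnover X"
abbreviation "W \<equiv> edge_matrix n es"

lemma inst: "rftt_instance I"
  using valid by (simp add: valid_input_def)

lemma I_simps: "depot I = 0" "clients I = {1..n}" "turnover I = \<tau>"
  by (simp_all add: to_rftt_def client_turnover_def fun_eq_iff)

lemma verts_I: "verts I = {..<Suc n}"
  by (auto simp: verts_def I_simps)

lemma edges_I: "edges I = same_ends ` set es"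
  by (force simp: to_rftt_def edge_table_def same_ends_def image_image split_beta)

lemma distinct_ends: "distinct (map same_ends es)"
proof -
  have eq: "map fst (edge_table X) = map same_ends es"
    by (simp add: edge_table_def same_ends_def split_beta comp_def)
  have "distinct (map fst (edge_table X))" using valid unfolding valid_input_def by blast
  then show ?thesis unfolding eq .
qed

lemma edge_ends:
  assumes "e \<in> set es"
  obtains u v where "u \<le> n" "v \<le> n" "u \<noteq> v" "same_ends e = {u, v}"
proof -
  have "\<forall>e\<in>edges I. \<exists>u\<in>verts I. \<exists>v\<in>verts I. u \<noteq> v \<and> e = {u, v}"
    using inst unfolding rftt_instance_def by (elim conjE)
  moreover have "same_ends e \<in> edges I" using assms unfolding edges_I by (rule imageI)
  ultimately obtain u v where uv: "u \<in> verts I" "v \<in> verts I" "u \<noteq> v" "same_ends e = {u, v}"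
    by blast
  have "u \<le> n" "v \<le> n" using uv(1,2) by (simp_all add: verts_I)
  then show ?thesis using uv(3,4) by (rule that)
qed

lemma denominator_pos: "(u, v, a, b) \<in> set es \<Longrightarrow> b > 0"
  using valid unfolding valid_input_def by blast

lemma scale_pos: "scale es > 0"
proof -
  have "0 < prod_list bs" if "\<forall>b\<in>set bs. b > 0" for bs :: "nat list"
    using that by (induction bs) auto
  moreover have "\<forall>b\<in>set (map (\<lambda>(u, v, a, b). b) es). b > 0"
    using denominator_pos by auto
  ultimately show ?thesis unfolding scale_def by blast
qed

lemma weight_I:
  assumes "(u, v, a, b) \<in> set es"
  shows "weight I {u, v} = real a / real b"
proof -
  have "({u, v}, real a / real b) \<in> set (edge_table X)"
    unfolding edge_table_def set_map using assms by (rule rev_image_eqI) simp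
  moreover have "distinct (map fst (edge_table X))" using valid unfolding valid_input_def by blast
  ultimately have "map_of (edge_table X) {u, v} = Some (real a / real b)" by (intro map_of_is_SomeI)
  then show ?thesis by (simp add: to_rftt_def)
qed

text \<open>The denominator is a factor of \<open>scale es\<close>, which makes the division exact;
  the scaled weight times \<open>Suc n\<close> is one of the summands of
  \<open>no_edge\<close>.\<close>

lemma W_edge:
  assumes "{i, j} \<in> edges I"
  shows "real (W i j) = real (scale es) * weight I {i, j}" "W i j * Suc n < no_edge n es"
proof -
  obtain e where e: "e \<in> set es" "same_ends e = {i, j}" using assms by (auto simp: edges_I)
  obtain u v a b where uv: "e = (u, v, a, b)" by (cases e)
  have W: "W i j = scaled_weight (scale es) e"
    unfolding edge_matrix_def by (rule fold_put_edge[OF distinct_ends e])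
  have "b \<in> set (map (\<lambda>(u, v, a, b). b) es)"
    unfolding set_map using e(1) uv by (intro rev_image_eqI) auto
  then have "b dvd scale es" unfolding scale_def by (rule prod_list_dvd)
  moreover have "b > 0" using denominator_pos e(1) uv by simp
  ultimately have "real (scaled_weight (scale es) e) = real (scale es) * (real a / real b)"
    by (auto simp: scaled_weight_def uv elim!: dvdE)
  moreover have "{u, v} = {i, j}" using e(2) uv by (simp add: same_ends_def)
  ultimately show "real (W i j) = real (scale es) * weight I {i, j}"
    using weight_I[of u v a b] e(1) uv W by simp
  have "scaled_weight (scale es) e * Suc n \<le> sum_list (map (\<lambda>e. scaled_weight (scale es) e * Suc n) es)"
    using e(1) by (intro member_le_sum_list) auto
  then show "W i j * Suc n < no_edge n es" unfolding W no_edge_def by simp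
qed

lemma W_no_edge: "{i, j} \<notin> edges I \<Longrightarrow> W i j = (if i = j then 0 else no_edge n es)"
  unfolding edge_matrix_def edges_I by (simp add: fold_put_edge_other)

sublocale metric_greedy_scheme n W \<tau> "key_bound n \<tau>"
proof
  show "W i i = 0" for i
  proof -
    have "{i, i} \<notin> edges I"
    proof
      assume "{i, i} \<in> edges I"
      then obtain e where "e \<in> set es" "same_ends e = {i, i}" by (auto simp: edges_I)
      then show False using edge_ends[of e] by (metis doubleton_eq_iff)
    qed
    then show ?thesis by (simp add: W_no_edge)
  qed
  show "W i j = W j i" for i j
  proof (cases "{i, j} \<in> edges I")
    case True
    have "{j, i} = {i, j}" by auto
    then have "real (W i j) = real (W j i)"
      using W_edge(1)[of i j] W_edge(1)[of j i] True by (simp only:)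
    then show ?thesis by simp
  next
    case False
    then show ?thesis using W_no_edge[of i j] W_no_edge[of j i] by (simp add: insert_commute)
  qed
  show "\<tau> j \<ge> 1" if "j \<in> {1..n}" for j
  proof -
    have "turnover I j \<ge> 1" using inst that unfolding rftt_instance_def I_simps(2) by blast
    then show ?thesis by (simp add: I_simps)
  qed
  show "\<tau> j < key_bound n \<tau>" if "j \<in> {1..n}" for j
    using member_le_sum[of j "{1..n}" \<tau>] that by (simp add: key_bound_def)
qed

definition d :: "nat \<Rightarrow> nat \<Rightarrow> real" where
  "d i j = real (dst n i j) / real (scale es)"

lemma step_sum_W:
  assumes "successively (\<lambda>u v. {u, v} \<in> edges I) w"
  shows "real (step_sum W w) = real (scale es) * walk_cost I w"
proof -
  have "{w ! i, w ! Suc i} \<in> edges I" if "i < length w - 1" for i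
    using assms that by (auto simp: successively_conv_nth)
  then show ?thesis
    by (simp add: step_sum_conv_sum walk_cost_def sum_distrib_left W_edge(1))
qed

lemma rftt_metric: "rftt_metric I d"
proof
  show "finite (clients I)" "depot I \<notin> clients I" by (simp_all add: I_simps)
  show "turnover I v \<ge> 1" if "v \<in> clients I" for v
    using inst that unfolding rftt_instance_def by blast
  show "d x x = 0" for x by (simp add: d_def dst_self)
  show "d x y = d y x" if "x \<in> verts I" "y \<in> verts I" for x y
    using dst_sym[of x y] that by (simp add: d_def verts_I)
  show "d x z \<le> d x y + d y z" if "x \<in> verts I" "y \<in> verts I" "z \<in> verts I" for x y z
  proof -
    have "real (dst n x z) \<le> real (dst n x y + dst n y z)"
      unfolding of_nat_le_iff using that by (intro dst_triangle) (auto simp: verts_I)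
    then show ?thesis unfolding d_def by (simp add: divide_right_mono flip: add_divide_distrib)
  qed
  show "d x y \<le> weight I {x, y}" if "x \<in> verts I" "y \<in> verts I" "{x, y} \<in> edges I" for x y
  proof -
    have "dst n x y \<le> W x y"
      using dst_le_step_sum[of "[x, y]"] that(1,2) by (simp add: verts_I)
    then have "real (dst n x y) \<le> real (scale es) * weight I {x, y}"
      unfolding W_edge(1)[OF that(3), symmetric] by simp
    then show ?thesis using scale_pos by (simp add: d_def field_simps)
  qed
qed

text \<open>Connectivity provides a walk along edges. Freed of repetitions it has at most
  \<open>Suc n\<close> steps, each of cost at most
  \<open>(no_edge n es - 1) div Suc n\<close>.\<close>

lemma dst_less_no_edge:
  assumes "i \<le> n" "j \<le> n"
  shows "dst n i j < no_edge n es"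
proof -
  obtain w where w: "is_walk I w" "hd w = i" "last w = j"
    using inst assms unfolding rftt_instance_def verts_I by (metis lessThan_iff less_Suc_eq_le)
  obtain v where v: "v \<noteq> []" "distinct v" "hd v = i" "last v = j" "set v \<subseteq> set w"
    "successively (\<lambda>u v. {u, v} \<in> edges I) v"
    using ex_distinct_walk[of w "\<lambda>u v. {u, v} \<in> edges I" W] w unfolding is_walk_def by blast
  have V: "set v \<subseteq> {..<Suc n}" using v(5) w(1) by (auto simp: is_walk_def verts_I)
  have "length v = card (set v)" using v(2) by (simp add: distinct_card)
  also have "\<dots> \<le> card {..<Suc n}" using V by (intro card_mono) auto
  finally have l: "length v - 1 \<le> Suc n" by simp
  define c where "c = (no_edge n es - 1) div Suc n"
  have "W x y \<le> c" if "{x, y} \<in> edges I" for x y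
    using W_edge(2)[OF that] by (simp add: c_def less_eq_div_iff_mult_less_eq del: mult_Suc_right)
  then have "step_sum W v \<le> (length v - 1) * c"
    using v(6) by (intro step_sum_le) (auto elim: successively_mono)
  also have "\<dots> \<le> Suc n * c" using l by (intro mult_right_mono) auto
  also have "\<dots> \<le> no_edge n es - 1" by (simp add: c_def del: mult_Suc)
  also have "\<dots> < no_edge n es" by (simp add: no_edge_def)
  finally show ?thesis using dst_le_step_sum[OF v(1) V] v(3,4) by simp
qed

text \<open>The steps of a route sum to \<open>dst n x y\<close>, which is less than
  \<open>no_edge n es\<close>; so none of them is a non-edge between distinct vertices, and
  successive vertices are distinct.\<close>

lemma depot_tour_tour: "depot_tour I (tour k)"
proof -
  have "successively (\<lambda>u v. {u, v} \<in> edges I) (x # route n x y)" if "x < Suc n" "y < Suc n" for x y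
  proof -
    have s: "successively (\<lambda>u v. W u v \<le> dst n x y) (x # route n x y)"
      by (rule step_le_step_sum) (simp add: step_sum_route)
    have "W u v \<le> dst n x y \<Longrightarrow> u \<noteq> v \<Longrightarrow> {u, v} \<in> edges I" for u v
      using W_no_edge[of u v] dst_less_no_edge[of x y] that by (cases "{u, v} \<in> edges I") auto
    then show ?thesis
      using s successively_route[of x n y] by (auto simp: successively_conv_nth)
  qed
  then have "successively (\<lambda>u v. {u, v} \<in> edges I) (tour k)" by (rule successively_tour)
  then show ?thesis
    using tour_props[of k] by (simp add: depot_tour_def is_walk_def verts_I I_simps)
qed

lemma tour_cost:
  "walk_cost I (tour k) \<le> 2 * (\<Sum>t=1..cnt k. real (\<delta> t) / real (scale es))"
proof -
  have "real (scale es) * walk_cost I (tour k) = real (step_sum W (tour k))"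
    using depot_tour_tour[of k] by (intro step_sum_W[symmetric]) (simp add: depot_tour_def is_walk_def)
  also have "\<dots> \<le> real (2 * (\<Sum>t=1..cnt k. \<delta> t))"
    unfolding of_nat_le_iff by (rule tour_props)
  finally have "walk_cost I (tour k) \<le> real (2 * (\<Sum>t=1..cnt k. \<delta> t)) / real (scale es)"
    using scale_pos by (simp add: field_simps)
  then show ?thesis by (simp flip: sum_divide_distrib)
qed

lemma solution: "periodic_solution I (per n) tour (\<lambda>k. set (visited k))"
proof -
  have "\<exists>k\<in>{s + 1..s + turnover I v}. v \<in> set (visited k)" if v: "v \<in> clients I" for s v
  proof -
    have "v \<in> ord ` {1..n}" using bij_betw_ord v by (simp add: bij_betw_def I_simps)
    then obtain t where t: "t \<in> {1..n}" "v = ord t" by blast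
    let ?p = "per t"
    have p: "?p \<ge> 1" "?p \<le> turnover I v"
      using per_bounds_ord[OF t(1)] t(2) by (simp_all add: I_simps)
    \<comment> \<open>The first multiple of the period after day \<open>s\<close>, at most
      \<open>?p\<close> days later and so within the turnover time.\<close>
    let ?k = "(s div ?p + 1) * ?p"
    have "s = s div ?p * ?p + s mod ?p" by simp
    moreover have "s mod ?p < ?p" using p by simp
    moreover have "?k = s div ?p * ?p + ?p" by simp
    ultimately have "s + 1 \<le> ?k" "?k \<le> s + ?p" by linarith+
    then have "?k \<in> {s + 1..s + turnover I v}"
      unfolding atLeastAtMost_iff using p(2) by linarith
    moreover have "v \<in> set (visited ?k)" using visited_iff[OF t(1), of ?k] t(2) by simp
    ultimately show ?thesis by blast
  qed
  moreover have "set (visited k) \<subseteq> clients I \<inter> set (tour k)" for k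
    unfolding I_simps(2) using set_visited[of k] tour_props(5)[of k] by blast
  ultimately have "feasible I tour (\<lambda>k. set (visited k))"
    unfolding feasible_def using depot_tour_tour by blast
  moreover have "per n \<ge> 1" by (rule per_pos) simp
  ultimately show ?thesis
    by (simp add: periodic_solution_def periodic_def tour_def visited_def cnt_add_per)
qed

text \<open>After exchanging the sums, client \<open>ord t\<close> is charged twice its scaled-back
  \<open>\<delta> t\<close> on the multiples of \<open>per t\<close>. These are exactly a fraction
  \<open>1 / per t\<close> of the days, as \<open>per t\<close> divides \<open>per n\<close>, and
  \<open>\<tau> (ord t) < 2 * per t\<close> turns 2 into 4.\<close>

lemma avg_cost_le:
  "avg_cost I (per n) tour \<le> 4 * (\<Sum>t=1..n. real (\<delta> t) / real (scale es) / real (\<tau> (ord t)))"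
proof -
  let ?r = "\<lambda>t. real (\<delta> t) / real (scale es)"
  let ?l = "per n"
  have l: "?l \<ge> 1" by (rule per_pos) simp
  have "(\<Sum>k=1..?l. walk_cost I (tour k)) \<le> (\<Sum>k=1..?l. \<Sum>t=1..n. if per t dvd k then 2 * ?r t else 0)"
  proof (rule sum_mono)
    fix k
    have "{1..cnt k} = {1..n} \<inter> {t. per t dvd k}"
      using per_dvd_iff[of _ k] cnt_le[of k] by auto
    then have "2 * (\<Sum>t=1..cnt k. ?r t) = (\<Sum>t=1..n. if per t dvd k then 2 * ?r t else 0)"
      by (simp add: sum.If_cases sum_distrib_left)
    then show "walk_cost I (tour k) \<le> (\<Sum>t=1..n. if per t dvd k then 2 * ?r t else 0)"
      using tour_cost[of k] by simp
  qed
  also have "\<dots> = (\<Sum>t=1..n. \<Sum>k=1..?l. if per t dvd k then 2 * ?r t else 0)"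
    by (rule sum.swap)
  also have "\<dots> \<le> (\<Sum>t=1..n. real ?l * (4 * (?r t / real (\<tau> (ord t)))))"
  proof (rule sum_mono)
    fix t assume t: "t \<in> {1..n}"
    let ?p = "per t"
    have p: "?p \<ge> 1" "?p \<le> \<tau> (ord t)" "\<tau> (ord t) < 2 * ?p" using per_bounds_ord[OF t] by blast+
    have "?p dvd ?l" using per_dvd[of t n] t by simp
    then obtain m where m: "?l = m * ?p" by (metis dvd_def mult.commute)
    have "(\<Sum>k=1..?l. if ?p dvd k then 2 * ?r t else 0) = 2 * ?r t * real (card {k \<in> {1..?l}. ?p dvd k})"
    proof -
      have "{k \<in> {1..?l}. ?p dvd k} = {1..?l} \<inter> {k. ?p dvd k}" by auto
      then show ?thesis by (simp add: sum.If_cases)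
    qed
    also have "\<dots> = 2 * ?r t * real m" unfolding m using card_multiples[OF p(1)] by simp
    also have "\<dots> = real ?l * (2 * ?r t / real ?p)" using p(1) by (simp add: m)
    finally have eq: "(\<Sum>k=1..?l. if ?p dvd k then 2 * ?r t else 0) = real ?l * (2 * ?r t / real ?p)" .
    have le: "2 * ?r t / real ?p \<le> 4 * (?r t / real (\<tau> (ord t)))"
    proof -
      have "1 / real ?p \<le> 2 / real (\<tau> (ord t))" using p by (simp add: field_simps)
      then have "2 * ?r t * (1 / real ?p) \<le> 2 * ?r t * (2 / real (\<tau> (ord t)))"
        by (intro mult_left_mono) auto
      then show ?thesis by simp
    qed
    show "(\<Sum>k=1..?l. if ?p dvd k then 2 * ?r t else 0) \<le> real ?l * (4 * (?r t / real (\<tau> (ord t))))"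
      unfolding eq by (rule mult_left_mono[OF le]) simp
  qed
  also have "\<dots> = real ?l * (4 * (\<Sum>t=1..n. ?r t / real (\<tau> (ord t))))"
    by (simp add: sum_distrib_left)
  finally show ?thesis using l by (simp add: avg_cost_def divide_le_eq mult.commute)
qed

lemma greedy_le:
  assumes "periodic_solution I l T J"
  shows "(\<Sum>t=1..n. real (\<delta> t) / real (scale es) / real (\<tau> (ord t)))
    \<le> real (floorlog 2 n + 1) * (3 / 2 * avg_cost I l T)"
proof -
  interpret m: rftt_metric I d by (rule rftt_metric)
  have "(\<Sum>t=1..n. real (\<delta> t) / real (scale es) / real (turnover I (ord t)))
      \<le> real (floorlog 2 n + 1) * (3 / 2 * avg_cost I l T)"
  proof (rule m.greedy_sum_le)
    show "bij_betw ord {1..n} (clients I)" using bij_betw_ord by (simp add: I_simps)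
    show "ord 0 = depot I" by (simp add: I_simps)
    show "turnover I (ord s) \<le> turnover I (ord t)" if "1 \<le> s" "s \<le> t" "t \<le> n" for s t
      using \<tau>_ord_mono[OF that] by (simp add: I_simps)
    show "real (\<delta> t) / real (scale es) \<le> d (ord s) (ord t)" if "s < t" "t \<le> n" for s t
      using \<delta>_le[OF that] by (simp add: d_def divide_right_mono)
    show "n \<le> 2 ^ floorlog 2 n" using less_2_power_iff[of n "floorlog 2 n"] by simp
  qed (use assms in auto)
  then show ?thesis by (simp add: I_simps)
qed

text \<open>The optimum is an infimum, so the comparison is made with every periodic solution. The
  factor 6 is 4 from the tours times 3/2 from the packing.\<close>

theorem approximation:
  "avg_cost I (per n) tour \<le> 6 * real (floorlog 2 n + 1) * min_avg_opt I"
proof -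
  let ?A = "{avg_cost I l T | l T J. periodic_solution I l T J}"
  have "avg_cost I (per n) tour / (6 * real (floorlog 2 n + 1)) \<le> Inf ?A"
  proof (rule cInf_greatest)
    show "?A \<noteq> {}" using solution by blast
    fix x assume "x \<in> ?A"
    then obtain l T J where x: "x = avg_cost I l T" "periodic_solution I l T J" by blast
    have "avg_cost I (per n) tour \<le> 4 * (real (floorlog 2 n + 1) * (3 / 2 * x))"
      using avg_cost_le greedy_le[OF x(2)] unfolding x(1) by linarith
    then show "avg_cost I (per n) tour / (6 * real (floorlog 2 n + 1)) \<le> x"
      by (simp add: divide_le_eq algebra_simps)
  qed
  then show ?thesis by (simp add: min_avg_opt_def divide_le_eq algebra_simps)
qed

lemma solver_run:
  "solver_run n es \<tau> k (input_state (enc_query (X, k)) ''in'')"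
proof -
  let ?q = "\<lambda>(u, v, a, b). [u, v, a, b :: nat]"
  let ?xs = "enc_query (X, k)"
  let ?ys = "k # n # fst X @ length es # concat (map ?q es)"
  have nth: "input_state ?xs ''in'' i = ?ys ! i" if "i < length ?ys" for i
    using that by (simp add: input_state_def enc_query_def enc_input_def)
  show ?thesis
  proof
    show "input_state ?xs ''in'' 0 = k" "input_state ?xs ''in'' (Suc 0) = n"
      by (simp_all add: nth)
    show "input_state ?xs ''in'' (Suc j) = \<tau> j" if "j \<in> {1..n}" for j
      using that by (cases j) (auto simp: nth nth_append client_turnover_def)
    show "input_state ?xs ''in'' (n + 2) = length es"
      by (simp add: nth nth_append)
    show "input_state ?xs ''in'' (n + 3 + e * 4) = u \<and> input_state ?xs ''in'' (n + 4 + e * 4) = v \<and>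
        input_state ?xs ''in'' (n + 5 + e * 4) = a \<and> input_state ?xs ''in'' (n + 6 + e * 4) = b"
      if e: "e < length es" "es ! e = (u, v, a, b)" for e u v a b
    proof -
      have c: "input_state ?xs ''in'' (n + 3 + (e * 4 + c)) = [u, v, a, b] ! c" if "c < 4" for c
      proof -
        have "concat (map ?q es) ! (e * 4 + c) = ?q (es ! e) ! c \<and> e * 4 + c < length (concat (map ?q es))"
          using e that by (intro nth_concat_4) auto
        moreover have "n + 3 + (e * 4 + c) = Suc (Suc (n + Suc (e * 4 + c)))" by simp
        ultimately show ?thesis using e by (simp add: nth nth_append)
      qed
      show ?thesis using c[of 0] c[of 1] c[of 2] c[of 3] by (simp add: numeral_eq_Suc)
    qed
    show "u \<le> n \<and> v \<le> n" if e: "(u, v, a, b) \<in> set es" for u v a b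
    proof -
      obtain x y where "x \<le> n" "y \<le> n" "same_ends (u, v, a, b) = {x, y}" using edge_ends[OF e] by metis
      then show ?thesis by (auto simp: same_ends_def doubleton_eq_iff)
    qed
  qed
qed

lemma solver_output:
  "output_of (sem solver_prog (input_state (enc_query (X, k)))) = enc_answer (per n, tour k, visited k)"
proof -
  interpret solver_run n es \<tau> k "input_state (enc_query (X, k)) ''in''" by (rule solver_run)
  have "output_of (sem solver_prog (input_state (enc_query (X, k)))) =
      per n # length (tour k) # tour k @ visited k"
    by (rule output_solver_prog) (auto simp: input_state_def)
  then show ?thesis by (simp add: enc_answer_def)
qed

lemma length_enc_query: "n + length es + 3 \<le> length (enc_query (X, k))"
proof -
  have "length xs \<le> length (concat (map (\<lambda>(u, v, a, b). [u, v, a, b :: nat]) xs))" for xs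
    by (induction xs) auto
  from this[of es] show ?thesis by (simp add: enc_query_def enc_input_def)
qed

lemma loop_bound:
  assumes "e \<in> bounds solver_prog"
  shows "aval e (input_state (enc_query (X, k))) \<le> enc_size (enc_query (X, k))"
proof -
  interpret solver_run n es \<tau> k "input_state (enc_query (X, k)) ''in''" by (rule solver_run)
  have "aval e (input_state (enc_query (X, k))) \<le> n + length es + 3"
    using assms bounds_solver_prog aval_simps(2-4)[of "input_state (enc_query (X, k))"] by auto
  then show ?thesis using length_enc_query[of k] length_le_enc_size[of "enc_query (X, k)"] by linarith
qed

text \<open>A tour consists of at most \<open>n + 1\<close> routes with at most \<open>n + 1\<close>
  vertices each, besides its start.\<close>

lemma answer_length:
  "length (enc_answer (per n, tour k, visited k)) \<le> (\<lambda>z. z * z + 2 * z) (enc_size (enc_query (X, k)))"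
proof -
  let ?z = "enc_size (enc_query (X, k))"
  have z: "n + 3 \<le> ?z" using length_enc_query[of k] length_le_enc_size[of "enc_query (X, k)"] by linarith
  have "length (cyc (cnt k) @ [0]) = cnt k + 2" using cyc_props[OF cnt_le, of k] by simp
  then have "length (tour k) \<le> 1 + (cnt k + 2) * Suc n"
    using length_expand[of "cyc (cnt k) @ [0]"] by (simp add: tour_def)
  also have "(cnt k + 2) * Suc n \<le> ?z * ?z" using z cnt_le[of k] by (intro mult_mono) auto
  finally have "length (tour k) \<le> 1 + ?z * ?z" by simp
  moreover have "length (visited k) \<le> n" using cnt_le[of k] by (simp add: visited_def)
  ultimately show ?thesis using z by (simp add: enc_answer_def)
qed

end

text \<open>The objects of the locale as functions of every input, valid or not, since
  \<open>l\<close>, \<open>T\<close> and \<open>J\<close> are chosen before the instance.\<close>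

definition answer_period :: "rftt_input \<Rightarrow> nat" where
  "answer_period X = greedy_scheme.per (length (fst X)) (client_turnover X)
     (key_bound (length (fst X)) (client_turnover X)) (length (fst X))"

definition answer_tour :: "rftt_input \<Rightarrow> nat \<Rightarrow> nat list" where
  "answer_tour X = greedy_scheme.tour (length (fst X)) (edge_matrix (length (fst X)) (snd X))
     (client_turnover X) (key_bound (length (fst X)) (client_turnover X))"

definition answer_visited :: "rftt_input \<Rightarrow> nat \<Rightarrow> nat list" where
  "answer_visited X = greedy_scheme.visited (length (fst X)) (client_turnover X)
     (key_bound (length (fst X)) (client_turnover X))"

lemmas answer_defs = answer_period_def answer_tour_def answer_visited_def

lemma poly_time_answer:
  "poly_time_computable enc_query enc_answer {(X, k). valid_input X \<and> k \<ge> 1}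
     (\<lambda>(X, k). (answer_period X, answer_tour X k, answer_visited X k))"
proof (rule poly_time_computableI[OF wf_solver_prog])
  show "poly_bounded (\<lambda>z. z * z + 2 * z)"
    by (intro poly_bounded_add poly_bounded_mult poly_bounded_const poly_bounded_id)
  fix x :: "rftt_input \<times> nat" assume x: "x \<in> {(X, k). valid_input X \<and> k \<ge> 1}"
  obtain X k where Xk: "x = (X, k)" by (cases x)
  interpret valid_instance X by unfold_locales (use x Xk in simp)
  show "aval e (input_state (enc_query x)) \<le> enc_size (enc_query x)" if "e \<in> bounds solver_prog" for e
    using loop_bound[OF that] by (simp add: Xk)
  show "output_of (sem solver_prog (input_state (enc_query x))) =
      enc_answer (case x of (X, k) \<Rightarrow> (answer_period X, answer_tour X k, answer_visited X k))"
    using solver_output by (simp add: Xk answer_defs)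
  show "length (enc_answer (case x of (X, k) \<Rightarrow> (answer_period X, answer_tour X k, answer_visited X k)))
      \<le> enc_size (enc_query x) * enc_size (enc_query x) + 2 * enc_size (enc_query x)"
    using answer_length[of k] by (simp add: Xk answer_defs)
qed

text \<open>From 3 on, \<open>ln n\<close> is at least 1 and absorbs the additive constants. At 1 it
  vanishes, so the estimate can only hold eventually.\<close>

lemma floorlog_bigo: "(\<lambda>n. 6 * real (floorlog 2 n + 1)) \<in> O(\<lambda>n. ln (real n))"
proof (rule bigoI[of _ "6 * (1 / ln 2 + 2)"])
  have "norm (6 * real (floorlog 2 n + 1)) \<le> 6 * (1 / ln 2 + 2) * norm (ln (real n))" if "n \<ge> 3" for n
  proof -
    have "exp 1 \<le> (3 :: real)" by (rule exp_le)
    then have ln: "1 \<le> ln (real n)" using that by (simp add: ln_ge_iff)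
    have "real (floorlog 2 n) = of_int \<lfloor>log 2 (real n)\<rfloor> + 1"
      using that by (simp add: floorlog_def)
    also have "\<dots> \<le> ln (real n) / ln 2 + 1" by (simp add: log_def)
    finally have "real (floorlog 2 n + 1) \<le> ln (real n) / ln 2 + 2" by simp
    also have "\<dots> \<le> ln (real n) / ln 2 + 2 * ln (real n)" using ln by simp
    also have "\<dots> = (1 / ln 2 + 2) * ln (real n)" by (simp add: algebra_simps)
    finally have le: "real (floorlog 2 n + 1) \<le> (1 / ln 2 + 2) * ln (real n)" .
    have nrm: "norm (ln (real n)) = ln (real n)" using ln by simp
    have "norm (6 * real (floorlog 2 n + 1)) = 6 * real (floorlog 2 n + 1)" by simp
    also have "\<dots> \<le> 6 * ((1 / ln 2 + 2) * ln (real n))"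
      by (rule mult_left_mono[OF le]) simp
    finally show ?thesis unfolding nrm by (simp only: mult.assoc)
  qed
  then show "\<forall>\<^sub>F n in sequentially. norm (6 * real (floorlog 2 n + 1)) \<le> 6 * (1 / ln 2 + 2) * norm (ln (real n))"
    unfolding eventually_sequentially by blast
qed

theorem theorem8:
  shows "\<exists>\<alpha> :: nat \<Rightarrow> real. \<alpha> \<in> O(\<lambda>n. ln (real n)) \<and> poly_time_min_avg_approximable \<alpha>"
proof (intro exI conjI)
  show "(\<lambda>n. 6 * real (floorlog 2 n + 1)) \<in> O(\<lambda>n. ln (real n))" by (rule floorlog_bigo)
  have "periodic_solution (to_rftt X) (answer_period X) (answer_tour X) (\<lambda>k. set (answer_visited X k)) \<and>
      avg_cost (to_rftt X) (answer_period X) (answer_tour X)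
        \<le> 6 * real (floorlog 2 (card (clients (to_rftt X))) + 1) * min_avg_opt (to_rftt X)"
    if "valid_input X" for X
  proof -
    interpret valid_instance X by unfold_locales (rule that)
    show ?thesis using solution approximation by (simp add: answer_defs I_simps)
  qed
  then show "poly_time_min_avg_approximable (\<lambda>n. 6 * real (floorlog 2 n + 1))"
    unfolding poly_time_min_avg_approximable_def using poly_time_answer by blast
qed

end
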